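(* There is an algorithm that, given a Markov decision process $G=((V,E),(V_1,V_P),\delta)$ with $n=|V|$ states and a tree decomposition of width $k$ of the MDP graph $(V,E)$ (edges treated as undirected), computes the maximal end-component decomposition of $G$ in $O(n\cdot 2^k\cdot k^{2.38})$ time.
   Context: A Markov decision process (MDP) $G=((V,E),(V_1,V_P),\delta)$ consists of a finite directed graph $(V,E)$ (the MDP graph), a partition $(V_1,V_P)$ of $V$, and a probabilistic transition function $\delta: V_P\to\mathcal D(V)$ such that for $u\in V_P$, $uv\in E$ iff $\delta(u)(v)>0$. An end-component is a set $U\subseteq V$ such that the subgraph induced by $U$ is strongly connected and for every edge $uv\in E$ with $u\in U\cap V_P$ we have $v\in U$. A maximal end-component (MEC) is an end-component maximal w.r.t. inclusion. The MEC decomposition consists of all MECs of $G$ together with the vertices of $V$ that belong to no MEC. A tree decomposition of an undirected graph $(V,E)$ is a pair $(B,T)$ where $B$ is a family of subsets (bags) of $V$ and $T$ is a tree whose nodes are the bags, such that the bags cover $V$, every edge has both endpoints in some bag, and for every vertex the bags containing it form a connected subtree of $T$; its width is the maximum bag size minus one. *)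

theory Defs
  imports
    "Graph_Theory.Digraph_Component"
    "HOL-Probability.Probability_Mass_Function"
begin

section \<open>Markov decision processes and end-components\<close>

locale mdp = pair_fin_digraph G
  for G :: "'v pair_pre_digraph" +
  fixes V1 VP :: "'v set" and \<delta> :: "'v \<Rightarrow> 'v pmf"
  assumes partition: "V1 \<union> VP = pverts G" "V1 \<inter> VP = {}"
    and delta_on_vertices: "u \<in> VP \<Longrightarrow> set_pmf (\<delta> u) \<subseteq> pverts G"
    and delta_support:
      "u \<in> VP \<Longrightarrow> v \<in> pverts G \<Longrightarrow> (u, v) \<in> parcs G \<longleftrightarrow> pmf (\<delta> u) v > 0"

text \<open>
  As in \<^const>\<open>strongly_connected\<close>, a strongly connected graph is nonempty, and a single vertex
  is strongly connected even without a self-loop.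
\<close>

definition end_component :: "'v pair_pre_digraph \<Rightarrow> 'v set \<Rightarrow> 'v set \<Rightarrow> bool" where
  "end_component G VP U \<longleftrightarrow>
     U \<subseteq> pverts G \<and>
     strongly_connected (with_proj G \<restriction> U) \<and>
     (\<forall>(u, v) \<in> parcs G. u \<in> U \<inter> VP \<longrightarrow> v \<in> U)"

definition MECs :: "'v pair_pre_digraph \<Rightarrow> 'v set \<Rightarrow> 'v set set" where
  "MECs G VP =
     {U. end_component G VP U \<and> (\<forall>U'. end_component G VP U' \<and> U \<subseteq> U' \<longrightarrow> U' = U)}"

definition mec_decomposition :: "'v pair_pre_digraph \<Rightarrow> 'v set \<Rightarrow> 'v set set \<times> 'v set" where
  "mec_decomposition G VP = (MECs G VP, pverts G - \<Union>(MECs G VP))"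


section \<open>Tree decompositions\<close>

text \<open>
  Undirected graphs are symmetric digraphs. The constant \<open>Digraph_Component.tree\<close> is not usable
  here: it only excludes directed cycles, hence admits acyclic orientations of undirected cycles
  and rejects every symmetric digraph with an arc. In a symmetric digraph without loops, the
  cycles of length 2 run back and forth along one edge; the longer ones are the cycles of the
  undirected graph.
\<close>

definition undirected_tree :: "'a pair_pre_digraph \<Rightarrow> bool" where
  "undirected_tree T \<longleftrightarrow>
     pair_graph T \<and>
     Digraph_Component.connected (with_proj T) \<and>
     \<not> (\<exists>p. pre_digraph.cycle (with_proj T) p \<and> length p \<ge> 3)"

text \<open>The bags are the nodes of \<open>T\<close>; in particular they are pairwise different sets.\<close>

definition tree_decomposition :: "'v pair_pre_digraph \<Rightarrow> 'v set pair_pre_digraph \<Rightarrow> bool" where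
  "tree_decomposition G T \<longleftrightarrow>
     undirected_tree T \<and>
     (\<forall>X \<in> pverts T. X \<subseteq> pverts G) \<and>
     \<Union>(pverts T) = pverts G \<and>
     (\<forall>(u, v) \<in> parcs G. \<exists>X \<in> pverts T. u \<in> X \<and> v \<in> X) \<and>
     (\<forall>v \<in> pverts G. Digraph_Component.connected (with_proj T \<restriction> {X \<in> pverts T. v \<in> X}))"

definition width :: "'v set pair_pre_digraph \<Rightarrow> nat" where
  "width T = Max (card ` pverts T) - 1"


section \<open>A random access machine\<close>

text \<open>
  Programs of a unit-cost RAM in structured form. The memory consists of named arrays of natural
  numbers; a program mentions finitely many of them, and scalar variables are cells at index 0.
  Subtraction is truncated; comparisons yield 0 or 1; conditions hold if they are nonzero.
\<close>

datatype binop = Plus | Minus | Times | Div | Mod | Less | Equal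

datatype expr = Const nat | Read string expr | Op binop expr expr

datatype com =
    Skip
  | Write string expr expr
  | Seq com com
  | If expr com com
  | While expr com

type_synonym store = "string \<Rightarrow> nat \<Rightarrow> nat"

fun apply_op :: "binop \<Rightarrow> nat \<Rightarrow> nat \<Rightarrow> nat" where
  "apply_op Plus a b = a + b"
| "apply_op Minus a b = a - b"
| "apply_op Times a b = a * b"
| "apply_op Div a b = a div b"
| "apply_op Mod a b = a mod b"
| "apply_op Less a b = (if a < b then 1 else 0)"
| "apply_op Equal a b = (if a = b then 1 else 0)"

fun val :: "expr \<Rightarrow> store \<Rightarrow> nat" where
  "val (Const c) s = c"
| "val (Read x e) s = s x (val e s)"
| "val (Op f e1 e2) s = apply_op f (val e1 s) (val e2 s)"

fun cost :: "expr \<Rightarrow> nat" where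
  "cost (Const c) = 1"
| "cost (Read x e) = 1 + cost e"
| "cost (Op f e1 e2) = 1 + cost e1 + cost e2"

text \<open>All numbers arising in the evaluation of an expression, addresses included, are at most \<open>W\<close>.\<close>

fun fits :: "nat \<Rightarrow> expr \<Rightarrow> store \<Rightarrow> bool" where
  "fits W (Const c) s \<longleftrightarrow> c \<le> W"
| "fits W (Read x e) s \<longleftrightarrow> fits W e s \<and> val (Read x e) s \<le> W"
| "fits W (Op f e1 e2) s \<longleftrightarrow> fits W e1 s \<and> fits W e2 s \<and> val (Op f e1 e2) s \<le> W"

text \<open>
  \<open>exec W c s t s'\<close>: started in \<open>s\<close>, program \<open>c\<close> halts in \<open>s'\<close> after \<open>t\<close> steps, and every number
  it handles is at most \<open>W\<close>, that is, fits into a machine word. A program that exceeds \<open>W\<close> gets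
  stuck, so unit cost arithmetic on huge numbers is impossible.
\<close>

inductive exec :: "nat \<Rightarrow> com \<Rightarrow> store \<Rightarrow> nat \<Rightarrow> store \<Rightarrow> bool" for W :: nat where
  Skip: "exec W Skip s 1 s"
| Write: "fits W i s \<Longrightarrow> fits W e s \<Longrightarrow>
    exec W (Write x i e) s (1 + cost i + cost e) (s(x := (s x)(val i s := val e s)))"
| Seq: "exec W c1 s t1 s1 \<Longrightarrow> exec W c2 s1 t2 s2 \<Longrightarrow> exec W (Seq c1 c2) s (1 + t1 + t2) s2"
| IfTrue: "fits W e s \<Longrightarrow> val e s \<noteq> 0 \<Longrightarrow> exec W c1 s t s' \<Longrightarrow>
    exec W (If e c1 c2) s (1 + cost e + t) s'"
| IfFalse: "fits W e s \<Longrightarrow> val e s = 0 \<Longrightarrow> exec W c2 s t s' \<Longrightarrow>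
    exec W (If e c1 c2) s (1 + cost e + t) s'"
| WhileFalse: "fits W e s \<Longrightarrow> val e s = 0 \<Longrightarrow> exec W (While e c) s (1 + cost e) s"
| WhileTrue: "fits W e s \<Longrightarrow> val e s \<noteq> 0 \<Longrightarrow> exec W c s t1 s1 \<Longrightarrow>
    exec W (While e c) s1 t2 s2 \<Longrightarrow> exec W (While e c) s (1 + cost e + t1 + t2) s2"


section \<open>Input and output\<close>

text \<open>
  The vertices are \<open>0, \<dots>, n - 1\<close>. The arcs, the bags, the elements of each bag and the links of the
  tree are listed in arbitrary order without repetitions. A link is a pair of indices of bags;
  each edge of the tree is listed in both directions.
\<close>

definition lists_input ::
  "nat pair_pre_digraph \<Rightarrow> nat set pair_pre_digraph \<Rightarrow>
   (nat \<times> nat) list \<Rightarrow> nat list list \<Rightarrow> (nat \<times> nat) list \<Rightarrow> bool" where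
  "lists_input G T es bags links \<longleftrightarrow>
     distinct es \<and> set es = parcs G \<and>
     (\<forall>b \<in> set bags. distinct b) \<and> distinct (map set bags) \<and> set (map set bags) = pverts T \<and>
     distinct links \<and> set links \<subseteq> {..<length bags} \<times> {..<length bags} \<and>
     (\<lambda>(i, j). (set (bags ! i), set (bags ! j))) ` set links = parcs T"

definition array :: "nat list \<Rightarrow> nat \<Rightarrow> nat" where
  "array xs i = (if i < length xs then xs ! i else 0)"

text \<open>
  Bag \<open>i\<close> occupies the cells of \<open>bag\<close> from \<open>bag_start[i]\<close> up to, but excluding,
  \<open>bag_start[i + 1]\<close>. The transition probabilities are not supplied: maximal end-components only
  depend on the arcs, so the algorithm has to work for every \<open>\<delta>\<close> with the given support.
\<close>

definition input_store ::
  "nat \<Rightarrow> nat set \<Rightarrow> (nat \<times> nat) list \<Rightarrow> nat list list \<Rightarrow> (nat \<times> nat) list \<Rightarrow> store" where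
  "input_store n VP es bags links =
     (\<lambda>_ _. 0)
     (''n'' := array [n],
      ''is_random'' := array (map (\<lambda>v. if v \<in> VP then 1 else 0) [0..<n]),
      ''num_arcs'' := array [length es],
      ''arc_tail'' := array (map fst es),
      ''arc_head'' := array (map snd es),
      ''num_bags'' := array [length bags],
      ''bag_start'' := array (map (\<lambda>i. length (concat (take i bags))) [0..<length bags + 1]),
      ''bag'' := array (concat bags),
      ''num_links'' := array [length links],
      ''link_fst'' := array (map fst links),
      ''link_snd'' := array (map snd links))"

text \<open>
  On termination \<open>mec[v]\<close> is 0 if \<open>v\<close> lies in no class, and otherwise the nonzero label of its class.
\<close>

definition output_classes :: "nat \<Rightarrow> store \<Rightarrow> nat set set \<times> nat set" where
  "output_classes n s =
     ((\<lambda>v. {u. u < n \<and> s ''mec'' u = s ''mec'' v}) ` {v. v < n \<and> s ''mec'' v \<noteq> 0},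
      {v. v < n \<and> s ''mec'' v = 0})"

end

theory Submission
  imports Defs
begin

text \<open>
  Order the bags of the tree decomposition by a traversal of the tree, and rank the vertices in the
  order in which the bags introduce them. Let \<open>N v\<close> be the set of vertices of smaller rank in the bag
  that introduces \<open>v\<close>. Then \<open>N v\<close> has at most \<open>k\<close> elements, contains the earlier neighbours of \<open>v\<close>, and
  is included in \<open>insert p (N p)\<close>, where \<open>p\<close> is the last element of \<open>N v\<close>, the parent of \<open>v\<close>.

  Call a set \<open>Y\<close> of vertices supported at \<open>i\<close> if no random arc leaves it and each of its vertices is
  reachable inside \<open>Y\<close> from, and reaches inside \<open>Y\<close>, a vertex of rank less than \<open>i\<close>. Supported sets are
  closed under unions, so for each trace \<open>S\<close> on the vertices of rank less than \<open>i\<close> there is a largest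
  one, or none, in which case \<open>S\<close> is bad. Together with a relation on \<open>S\<close> that has the
  reachability of the largest \<open>Y\<close>, this information can be maintained while \<open>i\<close> decreases: the eliminated
  vertex \<open>v\<close> joins \<open>Y\<close> iff \<open>insert v S\<close> is not bad and \<open>v\<close> has arcs from and to other vertices of \<open>S\<close>;
  afterwards paths through \<open>v\<close> are replaced by arcs. All this only depends on the trace on
  \<open>N v\<close>, so that it is stored in tables with \<open>O(2\<^sup>k)\<close> rows at \<open>v\<close> and passed on to the parent of \<open>v\<close>.
  In the opposite direction, the recorded decisions propagate the labels of the maximal
  end-components; a vertex without a labelled component starts a new one iff \<open>{v}\<close> is not bad.

  A row takes time \<open>O(k\<^sup>2)\<close>. The number of bags is at most \<open>n 2\<^sup>k + 1\<close> because the bags are different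
  sets: each nonempty bag consists of its last vertex \<open>v\<close> and a subset of \<open>N v\<close>.
\<close>

section \<open>A loop language for the random access machine\<close>

text \<open>The relations in the tables are never closed transitively: this keeps a row at
  \<open>O(k^2)\<close> and leaves matrix multiplication aside. It works because the only question
  put to a relation is whether the vertex \<open>v\<close> to be eliminated reaches, and is reached
  from, other vertices of the trace. As the relation lives on the trace, this holds iff one arc
  leads from \<open>v\<close> to another vertex and one leads back. Children can likewise be merged
  by uniting arcs and disjoining bad flags, since only the reachability of the union matters. The
  tables range over all traces because membership cannot be decided greedily: whether a random arc
  leaves the set depends on vertices that are eliminated later. Propagation back is sound because a
  maximal end-component that meets the vertices of rank less than \<open>i\<close> is itself the
  largest supported set with its trace. Time and word size are mostly read off the syntax: counting
  loops give the time, and the time together with the sizes of the expressions bounds every number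
  handled.\<close>

datatype prog =
    PSkip
  | PWrite string expr expr
  | PSeq prog prog
  | PIf expr prog prog
  | PFor string expr prog

abbreviation Var :: "string \<Rightarrow> expr" where
  "Var x \<equiv> Read x (Const 0)"

definition upd :: "string \<Rightarrow> nat \<Rightarrow> nat \<Rightarrow> store \<Rightarrow> store" where
  "upd x i v s = s(x := (s x)(i := v))"

lemma upd_apply: "upd x i v s y = (if y = x then (s x)(i := v) else s y)"
  by (simp add: upd_def)

primrec compile :: "prog \<Rightarrow> com" where
  "compile PSkip = Skip"
| "compile (PWrite x i e) = Write x i e"
| "compile (PSeq p q) = Seq (compile p) (compile q)"
| "compile (PIf e p q) = If e (compile p) (compile q)"
| "compile (PFor x e p) =
     Seq (Write x (Const 0) (Const 0))
       (While (Op Less (Var x) e)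
         (Seq (compile p) (Write x (Const 0) (Op Plus (Var x) (Const 1)))))"

text \<open>The bound is evaluated once here but before every pass in the compiled loop. The two
  agree if the body overwrites neither the counter nor an array read by the bound, which is what
  \<open>ok\<close> demands.\<close>

primrec loop :: "(store \<Rightarrow> store) \<Rightarrow> string \<Rightarrow> nat \<Rightarrow> store \<Rightarrow> store" where
  "loop f x 0 s = upd x 0 0 s"
| "loop f x (Suc i) s = upd x 0 (Suc i) (f (loop f x i s))"

primrec sem :: "prog \<Rightarrow> store \<Rightarrow> store" where
  "sem PSkip = (\<lambda>s. s)"
| "sem (PWrite x i e) = (\<lambda>s. upd x (val i s) (val e s) s)"
| "sem (PSeq p q) = (\<lambda>s. sem q (sem p s))"
| "sem (PIf e p q) = (\<lambda>s. if val e s \<noteq> 0 then sem p s else sem q s)"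
| "sem (PFor x e p) = (\<lambda>s. loop (sem p) x (val e s) s)"

text \<open>In a loop, 8 is 3 for the initialisation, 1 for the sequence and 4 for the failing test,
  without the cost of \<open>e\<close>. A pass costs 4 for the test, 1 for the sequence and 6 for
  the increment, again besides \<open>e\<close> and the body.\<close>

primrec time :: "prog \<Rightarrow> store \<Rightarrow> nat" where
  "time PSkip = (\<lambda>s. 1)"
| "time (PWrite x i e) = (\<lambda>s. 1 + cost i + cost e)"
| "time (PSeq p q) = (\<lambda>s. 1 + time p s + time q (sem p s))"
| "time (PIf e p q) = (\<lambda>s. 1 + cost e + (if val e s \<noteq> 0 then time p s else time q s))"
| "time (PFor x e p) =
     (\<lambda>s. 8 + cost e + (\<Sum>i<val e s. 11 + cost e + time p (loop (sem p) x i s)))"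

primrec reads :: "expr \<Rightarrow> string set" where
  "reads (Const c) = {}"
| "reads (Read x e) = insert x (reads e)"
| "reads (Op f e1 e2) = reads e1 \<union> reads e2"

primrec writes :: "prog \<Rightarrow> string set" where
  "writes PSkip = {}"
| "writes (PWrite x i e) = {x}"
| "writes (PSeq p q) = writes p \<union> writes q"
| "writes (PIf e p q) = writes p \<union> writes q"
| "writes (PFor x e p) = insert x (writes p)"

fun limited :: "expr \<Rightarrow> bool" where
  "limited (Const c) \<longleftrightarrow> c \<le> 2"
| "limited (Read x e) \<longleftrightarrow> True"
| "limited (Op Minus a b) \<longleftrightarrow> limited a"
| "limited (Op Div a b) \<longleftrightarrow> limited a"
| "limited (Op Mod a b) \<longleftrightarrow> limited a"
| "limited (Op Less a b) \<longleftrightarrow> True"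
| "limited (Op Equal a b) \<longleftrightarrow> True"
| "limited (Op f a b) \<longleftrightarrow> False"

text \<open>
  A slow assignment raises the largest cell by at most 1, so the cells are bounded by the
  initial maximum plus the running time, and no bound on any table entry has to be verified.
\<close>

definition slow :: "expr \<Rightarrow> bool" where
  "slow e \<longleftrightarrow> limited e \<or> (\<exists>a. e = Op Plus a (Const 1) \<and> limited a)"

primrec small_consts :: "expr \<Rightarrow> bool" where
  "small_consts (Const c) \<longleftrightarrow> c \<le> 2"
| "small_consts (Read x e) \<longleftrightarrow> small_consts e"
| "small_consts (Op f a b) \<longleftrightarrow> small_consts a \<and> small_consts b"

primrec ok :: "prog \<Rightarrow> bool" where
  "ok PSkip \<longleftrightarrow> True"
| "ok (PWrite x i e) \<longleftrightarrow> small_consts i \<and> small_consts e \<and> slow e"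
| "ok (PSeq p q) \<longleftrightarrow> ok p \<and> ok q"
| "ok (PIf e p q) \<longleftrightarrow> small_consts e \<and> ok p \<and> ok q"
| "ok (PFor x e p) \<longleftrightarrow> small_consts e \<and> ok p \<and> x \<notin> writes p \<and> reads e \<inter> insert x (writes p) = {}"

text \<open>If all cells are at most \<open>M\<close>, the value of \<open>e\<close> is at most
  \<open>M ^ cost e\<close>; the largest cost is therefore the exponent of the word size. The
  summand 5 covers the compiled test, of cost \<open>cost e + 3\<close>, and the increment, of cost
  4.\<close>

primrec max_cost :: "prog \<Rightarrow> nat" where
  "max_cost PSkip = 0"
| "max_cost (PWrite x i e) = max (cost i) (cost e)"
| "max_cost (PSeq p q) = max (max_cost p) (max_cost q)"
| "max_cost (PIf e p q) = max (cost e) (max (max_cost p) (max_cost q))"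
| "max_cost (PFor x e p) = max (cost e + 5) (max_cost p)"

section \<open>Bounds on cells and on values of expressions\<close>

definition cells_le :: "nat \<Rightarrow> store \<Rightarrow> bool" where
  "cells_le M s \<longleftrightarrow> (\<forall>x i. s x i \<le> M)"

lemma cells_le_mono: "cells_le M s \<Longrightarrow> M \<le> M' \<Longrightarrow> cells_le M' s"
  unfolding cells_le_def using le_trans by blast

lemma cells_le_upd: "cells_le M s \<Longrightarrow> v \<le> M \<Longrightarrow> cells_le M (upd x i v s)"
  by (simp add: cells_le_def upd_apply)

lemma cost_pos: "0 < cost e"
  by (cases e) auto

text \<open>The additional 1 in the exponent pays for addition: \<open>2 * M ^ (i + j)\<close> is at
  most \<open>M ^ (1 + i + j)\<close>. It matches the unit that \<open>cost\<close> charges for an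
  operation.\<close>

lemma apply_op_le:
  fixes M :: nat
  assumes M: "2 \<le> M" and a: "a \<le> M ^ i" and b: "b \<le> M ^ j" and "0 < i" "0 < j"
  shows "apply_op f a b \<le> M ^ (1 + i + j)"
proof -
  have i: "M ^ i \<le> M ^ (i + j)" and j: "M ^ j \<le> M ^ (i + j)"
    and ij: "M ^ (i + j) \<le> M ^ (1 + i + j)" and one: "1 \<le> M ^ (1 + i + j)"
    using M by (auto intro: power_increasing)
  have ai: "a \<le> M ^ (1 + i + j)" using a i ij by linarith
  have "2 * M ^ (i + j) \<le> M ^ (1 + i + j)" using M by simp
  then have "a + b \<le> M ^ (1 + i + j)" using a b i j by linarith
  moreover have "a * b \<le> M ^ (1 + i + j)"
    using mult_le_mono[OF a b] ij by (metis le_trans power_add)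
  moreover have "a - b \<le> M ^ (1 + i + j)" using ai by linarith
  moreover have "a div b \<le> M ^ (1 + i + j)" using ai div_le_dividend le_trans by blast
  moreover have "a mod b \<le> M ^ (1 + i + j)" using ai mod_less_eq_dividend le_trans by blast
  ultimately show ?thesis using one by (cases f) auto
qed

lemma val_le:
  assumes "cells_le M s" "2 \<le> M" "small_consts e"
  shows "val e s \<le> M ^ cost e"
  using assms(3)
proof (induction e)
  case (Read x e)
  have "s x (val e s) \<le> M" using assms(1) by (simp add: cells_le_def)
  also have "M \<le> M ^ (1 + cost e)" using assms(2) by simp
  finally show ?case by simp
next
  case (Op f a b)
  then show ?case using apply_op_le[OF assms(2), of _ "cost a" _ "cost b"] by (simp add: cost_pos)
qed (use assms(2) in auto)

lemma fits_power:
  assumes "cells_le M s" "2 \<le> M" "small_consts e" "cost e \<le> q"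
  shows "fits (M ^ q) e s"
proof -
  have le: "val e' s \<le> M ^ q" if "small_consts e'" "cost e' \<le> q" for e'
    using val_le[OF assms(1,2) that(1)] power_increasing[OF that(2), of M] assms(2) by linarith
  show ?thesis using assms(3,4)
  proof (induction e)
    case (Const c)
    then show ?case using le[of "Const c"] by simp
  next
    case (Read x e)
    then show ?case using le[of "Read x e"] by simp
  next
    case (Op f a b)
    then show ?case using le[of "Op f a b"] by simp
  qed
qed

lemma limited_le: "cells_le M s \<Longrightarrow> 2 \<le> M \<Longrightarrow> limited e \<Longrightarrow> val e s \<le> M"
proof (induction e rule: limited.induct)
  case (3 a b)
  then show ?case by (auto intro: le_trans[OF diff_le_self])
next
  case (4 a b)
  then show ?case by (auto intro: le_trans[OF div_le_dividend])
next
  case (5 a b)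
  then show ?case by (auto intro: le_trans[OF mod_less_eq_dividend])
qed (auto simp: cells_le_def)

lemma slow_le: "cells_le M s \<Longrightarrow> 2 \<le> M \<Longrightarrow> slow e \<Longrightarrow> val e s \<le> M + 1"
  unfolding slow_def using limited_le by fastforce

lemma sem_frame: "y \<notin> writes p \<Longrightarrow> sem p s y = s y"
proof (induction p arbitrary: s)
  case (PFor x e p)
  have "loop (sem p) x i s y = s y" for i
    by (induction i) (use PFor in \<open>auto simp: upd_apply\<close>)
  then show ?case by simp
qed (auto simp: upd_apply)

lemma loop_frame: "y \<notin> insert x (writes p) \<Longrightarrow> loop (sem p) x i s y = s y"
  by (induction i) (auto simp: upd_apply sem_frame)

lemma loop_counter: "loop f x i s x 0 = i"
  by (cases i) (auto simp: upd_apply)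

lemma val_cong: "(\<And>y. y \<in> reads e \<Longrightarrow> s y = t y) \<Longrightarrow> val e s = val e t"
  by (induction e) auto

lemma val_loop:
  "reads e \<inter> insert x (writes p) = {} \<Longrightarrow> val e (loop (sem p) x i s) = val e s"
  by (rule val_cong) (auto intro: loop_frame)

lemma exec_compile:
  assumes "ok p" "max_cost p \<le> q" "cells_le M s" "2 \<le> M" "M + time p s \<le> M'"
  shows "exec (M' ^ q) (compile p) s (time p s) (sem p s) \<and> cells_le (M + time p s) (sem p s)"
  using assms
proof (induction p arbitrary: M s)
  case PSkip
  then show ?case using exec.Skip[of "M' ^ q" s] by (auto intro: cells_le_mono)
next
  case (PWrite x i e)
  have b': "cells_le M' s" using PWrite cells_le_mono by fastforce
  have "exec (M' ^ q) (Write x i e) s (1 + cost i + cost e) (upd x (val i s) (val e s) s)"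
    unfolding upd_def by (rule exec.Write) (use PWrite b' in \<open>auto intro: fits_power\<close>)
  moreover have "cells_le (M + 1) (upd x (val i s) (val e s) s)"
    using PWrite slow_le[of M s e] by (intro cells_le_upd) (auto intro: cells_le_mono)
  ultimately show ?case by (auto intro: cells_le_mono)
next
  case (PSeq p1 p2)
  have 1: "exec (M' ^ q) (compile p1) s (time p1 s) (sem p1 s) \<and> cells_le (M + time p1 s) (sem p1 s)"
    using PSeq.prems by (intro PSeq.IH(1)) auto
  have 2: "exec (M' ^ q) (compile p2) (sem p1 s) (time p2 (sem p1 s)) (sem p2 (sem p1 s)) \<and>
      cells_le (M + time p1 s + time p2 (sem p1 s)) (sem p2 (sem p1 s))"
    using PSeq.prems 1 by (intro PSeq.IH(2)) auto
  have "exec (M' ^ q) (Seq (compile p1) (compile p2)) s (1 + time p1 s + time p2 (sem p1 s))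
      (sem p2 (sem p1 s))"
    using 1 2 by (intro exec.Seq[where ?s1.0="sem p1 s"]) auto
  then show ?case using 2 by (auto intro: cells_le_mono)
next
  case (PIf e p1 p2)
  have b': "cells_le M' s" using PIf.prems cells_le_mono by fastforce
  have f: "fits (M' ^ q) e s" using PIf.prems b' by (intro fits_power) auto
  show ?case
  proof (cases "val e s = 0")
    case True
    then have "exec (M' ^ q) (compile p2) s (time p2 s) (sem p2 s) \<and> cells_le (M + time p2 s) (sem p2 s)"
      using PIf.prems by (intro PIf.IH(2)) auto
    moreover from this have "exec (M' ^ q) (If e (compile p1) (compile p2)) s (1 + cost e + time p2 s) (sem p2 s)"
      using True f by (intro exec.IfFalse) auto
    ultimately show ?thesis using True by (auto intro: cells_le_mono)
  next
    case False
    then have "exec (M' ^ q) (compile p1) s (time p1 s) (sem p1 s) \<and> cells_le (M + time p1 s) (sem p1 s)"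
      using PIf.prems by (intro PIf.IH(1)) auto
    moreover from this have "exec (M' ^ q) (If e (compile p1) (compile p2)) s (1 + cost e + time p1 s) (sem p1 s)"
      using False f by (intro exec.IfTrue) auto
    ultimately show ?thesis using False by (auto intro: cells_le_mono)
  qed
next
  case (PFor x e p)
  define N where "N = val e s"
  define \<sigma> where "\<sigma> i = loop (sem p) x i s" for i
  define \<tau> where "\<tau> i = 11 + cost e + time p (\<sigma> i)" for i
  define W where "W = (While (Op Less (Var x) e)
         (Seq (compile p) (Write x (Const 0) (Op Plus (Var x) (Const 1)))))"
  have T: "time (PFor x e p) s = 8 + cost e + (\<Sum>i<N. \<tau> i)"
    by (simp add: N_def \<sigma>_def \<tau>_def)
  have e: "val e (\<sigma> i) = N" for i
    unfolding \<sigma>_def N_def using PFor.prems(1) by (intro val_loop) auto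
  have x: "\<sigma> i x 0 = i" for i unfolding \<sigma>_def by (rule loop_counter)
  have sum_le: "(\<Sum>i<j. \<tau> i) \<le> (\<Sum>i<N. \<tau> i)" if "j \<le> N" for j
    using that by (intro sum_mono2) auto
  have S: "M + (\<Sum>i<N. \<tau> i) + 8 \<le> M'" using PFor.prems(5) T by simp
  have body: "exec (M' ^ q) (compile p) (\<sigma> i) (time p (\<sigma> i)) (sem p (\<sigma> i)) \<and>
      cells_le (M + (\<Sum>j<i. \<tau> j) + time p (\<sigma> i)) (sem p (\<sigma> i))"
    if "i < N" "cells_le (M + (\<Sum>j<i. \<tau> j)) (\<sigma> i)" for i
    using PFor.prems that sum_le[of "Suc i"] S
    by (intro PFor.IH) (auto simp: \<tau>_def)
  have bd: "cells_le (M + (\<Sum>j<i. \<tau> j)) (\<sigma> i)" if "i \<le> N" for i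
    using that
  proof (induction i)
    case 0
    then show ?case using PFor.prems by (auto simp: \<sigma>_def intro: cells_le_upd)
  next
    case (Suc i)
    have "\<sigma> (Suc i) = upd x 0 (Suc i) (sem p (\<sigma> i))" by (simp add: \<sigma>_def)
    \<comment> \<open>The counter receives the value \<open>Suc i\<close>, which must obey the bound
      on the cells as well; it does because each pass takes at least one step.\<close>
    moreover have "i \<le> (\<Sum>j<i. \<tau> j)"
      using sum_mono[of "{..<i}" "\<lambda>_. 1" \<tau>] by (simp add: \<tau>_def)
    ultimately show ?case
      using body[of i] Suc by (auto simp: \<tau>_def intro!: cells_le_upd intro: cells_le_mono)
  qed
  have bd': "cells_le M' (\<sigma> i)" if "i \<le> N" for i
    using bd[OF that] sum_le[OF that] S by (auto intro: cells_le_mono)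
  have M': "2 \<le> M'" using PFor.prems by simp
  have guard: "fits (M' ^ q) (Op Less (Var x) e) (\<sigma> i)" if "i \<le> N" for i
    using PFor.prems M' bd'[OF that] by (intro fits_power) auto
  \<comment> \<open>The run is assembled from its end, since the rule for a successful test expects
    the run of the remaining passes.\<close>
  have "exec (M' ^ q) W (\<sigma> i) (4 + cost e + (\<Sum>j\<in>{i..<N}. \<tau> j)) (\<sigma> N)" if "i \<le> N" for i
    using that
  proof (induction rule: inc_induct)
    case base
    have "exec (M' ^ q) W (\<sigma> N) (1 + cost (Op Less (Var x) e)) (\<sigma> N)"
      unfolding W_def by (rule exec.WhileFalse[OF guard]) (auto simp: e x)
    then show ?case by (simp add: numeral_eq_Suc)
  next
    case (step i)
    let ?c = "Write x (Const 0) (Op Plus (Var x) (Const 1))"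
    have b: "cells_le M' (sem p (\<sigma> i))"
      using body[OF step.hyps(2)] bd[of i] step.hyps sum_le[of "Suc i"] S
      by (auto simp: \<tau>_def intro: cells_le_mono)
    have "sem p (\<sigma> i) x = \<sigma> i x" using PFor.prems by (intro sem_frame) auto
    then have *: "\<sigma> (Suc i) = (sem p (\<sigma> i))(x := (sem p (\<sigma> i) x)(val (Const 0) (sem p (\<sigma> i)) := val (Op Plus (Var x) (Const 1)) (sem p (\<sigma> i))))"
      using x[of i] by (simp add: \<sigma>_def upd_def)
    have "exec (M' ^ q) ?c (sem p (\<sigma> i)) (1 + cost (Const 0) + cost (Op Plus (Var x) (Const 1))) (\<sigma> (Suc i))"
      unfolding * by (intro exec.Write fits_power) (use PFor.prems M' b in auto)
    moreover have "1 + cost (Const 0) + cost (Op Plus (Var x) (Const 1)) = 6" by simp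
    ultimately have "exec (M' ^ q) ?c (sem p (\<sigma> i)) 6 (\<sigma> (Suc i))" by metis
    then have "exec (M' ^ q) (Seq (compile p) ?c) (\<sigma> i) (1 + time p (\<sigma> i) + 6) (\<sigma> (Suc i))"
      using body[OF step.hyps(2)] bd[of i] step.hyps by (intro exec.Seq[where ?s1.0="sem p (\<sigma> i)"]) auto
    then have "exec (M' ^ q) W (\<sigma> i) (1 + cost (Op Less (Var x) e) + (1 + time p (\<sigma> i) + 6)
        + (4 + cost e + (\<Sum>j\<in>{Suc i..<N}. \<tau> j))) (\<sigma> N)"
      using step.IH unfolding W_def
      by (intro exec.WhileTrue[where ?s1.0="\<sigma> (Suc i)"] guard) (use step.hyps in \<open>auto simp: e x\<close>)
    moreover have "(\<Sum>j\<in>{i..<N}. \<tau> j) = \<tau> i + (\<Sum>j\<in>{Suc i..<N}. \<tau> j)"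
      using step.hyps by (simp add: sum.atLeast_Suc_lessThan)
    ultimately show ?case by (simp add: \<tau>_def algebra_simps)
  qed
  from this[of 0] have w: "exec (M' ^ q) W (\<sigma> 0) (4 + cost e + (\<Sum>j<N. \<tau> j)) (\<sigma> N)"
    by (simp add: atLeast0LessThan)
  have "exec (M' ^ q) (Write x (Const 0) (Const 0)) s (1 + cost (Const 0) + cost (Const 0))
     (s(x := (s x)(val (Const 0) s := val (Const 0) s)))"
    using M' by (intro exec.Write) auto
  then have "exec (M' ^ q) (Write x (Const 0) (Const 0)) s 3 (\<sigma> 0)"
    by (simp add: \<sigma>_def upd_def numeral_eq_Suc)
  from exec.Seq[OF this w] have "exec (M' ^ q) (compile (PFor x e p)) s (time (PFor x e p) s) (\<sigma> N)"
    unfolding T by (simp add: W_def add.assoc)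
  then show ?case
    using bd[of N] by (auto simp: \<sigma>_def N_def \<tau>_def intro: cells_le_mono)
qed

text \<open>If the bounds of the loops are never overwritten, the running time can be read off the initial store.\<close>

primrec loop_reads :: "prog \<Rightarrow> string set" where
  "loop_reads PSkip = {}"
| "loop_reads (PWrite x i e) = {}"
| "loop_reads (PSeq p q) = loop_reads p \<union> loop_reads q"
| "loop_reads (PIf e p q) = loop_reads p \<union> loop_reads q"
| "loop_reads (PFor x e p) = reads e \<union> loop_reads p"

primrec static_time :: "prog \<Rightarrow> store \<Rightarrow> nat" where
  "static_time PSkip s = 1"
| "static_time (PWrite x i e) s = 1 + cost i + cost e"
| "static_time (PSeq p q) s = 1 + static_time p s + static_time q s"
| "static_time (PIf e p q) s = 1 + cost e + static_time p s + static_time q s"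
| "static_time (PFor x e p) s = 8 + cost e + val e s * (11 + cost e + static_time p s)"

lemma static_time_cong:
  "(\<And>y. y \<in> loop_reads p \<Longrightarrow> s y = t y) \<Longrightarrow> static_time p s = static_time p t"
proof (induction p)
  case (PFor x e p)
  have "val e s = val e t" using PFor.prems by (intro val_cong) auto
  then show ?case using PFor by auto
qed auto

lemma time_le_static_time:
  "loop_reads p \<inter> writes p = {} \<Longrightarrow> time p s \<le> static_time p s"
proof (induction p arbitrary: s)
  case (PSeq p q)
  have "static_time q (sem p s) = static_time q s"
    using PSeq.prems by (intro static_time_cong sem_frame) auto
  moreover have "time p s \<le> static_time p s" "time q (sem p s) \<le> static_time q (sem p s)"
    using PSeq by (auto simp: Int_Un_distrib Int_Un_distrib2)
  ultimately show ?case by simp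
next
  case (PIf e p q)
  then have "time p s \<le> static_time p s" "time q s \<le> static_time q s"
    by (auto simp: Int_Un_distrib Int_Un_distrib2)
  then show ?case by simp
next
  case (PFor x e p)
  have "time p (loop (sem p) x i s) \<le> static_time p s" for i
  proof -
    have "static_time p (loop (sem p) x i s) = static_time p s"
      using PFor.prems by (intro static_time_cong loop_frame) auto
    moreover have "time p (loop (sem p) x i s) \<le> static_time p (loop (sem p) x i s)"
      using PFor by (intro PFor.IH) auto
    ultimately show ?thesis by simp
  qed
  then have "(\<Sum>i<val e s. 11 + cost e + time p (loop (sem p) x i s)) \<le>
      (\<Sum>i<val e s. 11 + cost e + static_time p s)"
    by (intro sum_mono add_left_mono)
  then show ?case by simp
qed auto

text \<open>The frame premise on \<open>t\<close> spares the invariants: they mention only what the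
  body changes, and everything else is known to be as in \<open>s\<close>.\<close>

lemma sem_For:
  assumes "I 0 (upd x 0 0 s)"
    and "\<And>i t. i < val e s \<Longrightarrow> I i t \<Longrightarrow> t x 0 = i \<Longrightarrow>
      (\<And>y. y \<notin> insert x (writes p) \<Longrightarrow> t y = s y) \<Longrightarrow> I (Suc i) (upd x 0 (Suc i) (sem p t))"
  shows "I (val e s) (sem (PFor x e p) s)"
proof -
  have "I i (loop (sem p) x i s)" if "i \<le> val e s" for i
    using that
  proof (induction i)
    case (Suc i)
    then show ?case using assms(2)[of i "loop (sem p) x i s"]
      by (simp add: loop_counter loop_frame)
  qed (use assms(1) in simp)
  then show ?thesis by simp
qed

section \<open>Eliminating vertices of a graph\<close>

text \<open>State elimination as in the algorithms of Kleene and Warshall, for a single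
  vertex.\<close>

definition shortcut :: "'v \<Rightarrow> 'v rel \<Rightarrow> 'v rel" where
  "shortcut v R = {(x, y). x \<noteq> v \<and> y \<noteq> v \<and> ((x, y) \<in> R \<or> (x, v) \<in> R \<and> (v, y) \<in> R)}"

lemma rtrancl_shortcut:
  assumes "x \<noteq> v" "y \<noteq> v"
  shows "(x, y) \<in> (shortcut v R)\<^sup>* \<longleftrightarrow> (x, y) \<in> R\<^sup>*"
proof
  show "(x, y) \<in> R\<^sup>*" if "(x, y) \<in> (shortcut v R)\<^sup>*"
    using that
  proof induction
    case (step y z)
    from step.hyps(2) have "(y, z) \<in> R\<^sup>*" unfolding shortcut_def by auto
    with step.IH show ?case by simp
  qed simp
next
  \<comment> \<open>A walk that currently stands on \<open>v\<close> has no counterpart among the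
    shortcuts. The invariant then remembers the last vertex \<open>w\<close> before
    \<open>v\<close>, from which leaving \<open>v\<close> becomes one shortcut arc; loops at
    \<open>v\<close> keep the same \<open>w\<close>.\<close>
  have "(if z = v then \<exists>w. w \<noteq> v \<and> (x, w) \<in> (shortcut v R)\<^sup>* \<and> (w, v) \<in> R
      else (x, z) \<in> (shortcut v R)\<^sup>*)" if "(x, z) \<in> R\<^sup>*" for z
    using that
  proof induction
    case (step y z)
    show ?case
    proof (cases "y = v")
      case True
      with step.IH obtain w where w: "w \<noteq> v" "(x, w) \<in> (shortcut v R)\<^sup>*" "(w, v) \<in> R" by auto
      have "(w, z) \<in> shortcut v R" if "z \<noteq> v"
        using w step.hyps(2) True that by (auto simp: shortcut_def)
      then show ?thesis using w by (auto intro: rtrancl_into_rtrancl)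
    next
      case False
      then have "(x, y) \<in> (shortcut v R)\<^sup>*" using step.IH by simp
      moreover have "(y, z) \<in> shortcut v R" if "z \<noteq> v"
        using step.hyps(2) False that by (auto simp: shortcut_def)
      ultimately show ?thesis using step.hyps(2) False by (auto intro: rtrancl_into_rtrancl)
    qed
  qed (use assms in auto)
  then show "(x, y) \<in> (shortcut v R)\<^sup>*" if "(x, y) \<in> R\<^sup>*" using that assms by presburger
qed

lemma rtrancl_first_step:
  "(v, s) \<in> R\<^sup>* \<Longrightarrow> s \<noteq> v \<Longrightarrow> \<exists>a. a \<noteq> v \<and> (v, a) \<in> R"
  by (induction rule: rtrancl_induct) auto

lemma rtrancl_last_step:
  "(s, v) \<in> R\<^sup>* \<Longrightarrow> s \<noteq> v \<Longrightarrow> \<exists>a. a \<noteq> v \<and> (a, v) \<in> R"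
  by (induction rule: converse_rtrancl_induct) auto

definition decision ::
  "'v \<Rightarrow> ('v set \<Rightarrow> bool) \<Rightarrow> ('v set \<Rightarrow> 'v rel) \<Rightarrow> 'v set \<Rightarrow> bool" where
  "decision v b r S \<longleftrightarrow> \<not> b (insert v S) \<and>
     (\<exists>a \<in> S - {v}. (v, a) \<in> r (insert v S)) \<and> (\<exists>a \<in> S - {v}. (a, v) \<in> r (insert v S))"

text \<open>Neither \<open>decision\<close> nor \<open>pick\<close> depends on whether
  \<open>S\<close> already contains \<open>v\<close>. The tables need this indifference: a mask may
  have the bit of the colour of \<open>v\<close> set for the sake of another vertex at the
  parent.\<close>

definition pick ::
  "'v \<Rightarrow> ('v set \<Rightarrow> bool) \<Rightarrow> ('v set \<Rightarrow> 'v rel) \<Rightarrow> 'v set \<Rightarrow> 'v set" where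
  "pick v b r S = (if decision v b r S then insert v S else S - {v})"

definition elim_bad ::
  "'v \<Rightarrow> ('v set \<Rightarrow> bool) \<Rightarrow> ('v set \<Rightarrow> 'v rel) \<Rightarrow> 'v set \<Rightarrow> bool" where
  "elim_bad v b r S = b (pick v b r S)"

definition elim_rel ::
  "'v \<Rightarrow> ('v set \<Rightarrow> bool) \<Rightarrow> ('v set \<Rightarrow> 'v rel) \<Rightarrow> 'v set \<Rightarrow> 'v rel" where
  "elim_rel v b r S = shortcut v (r (pick v b r S))"

section \<open>End-components of a relation and their unions\<close>

definition closed_set :: "'v rel \<Rightarrow> 'v set \<Rightarrow> 'v set \<Rightarrow> bool" where
  "closed_set E Rnd Y \<longleftrightarrow> (\<forall>(x, y) \<in> E. x \<in> Rnd \<and> x \<in> Y \<longrightarrow> y \<in> Y)"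

definition res :: "'v rel \<Rightarrow> 'v set \<Rightarrow> 'v rel" where
  "res E Y = E \<inter> Y \<times> Y"

lemma res_mono: "Y \<subseteq> Z \<Longrightarrow> res E Y \<subseteq> res E Z"
  by (auto simp: res_def)

lemma rtrancl_res_mono: "(x, y) \<in> (res E Y)\<^sup>* \<Longrightarrow> Y \<subseteq> Z \<Longrightarrow> (x, y) \<in> (res E Z)\<^sup>*"
  using rtrancl_mono[OF res_mono] by blast

definition ec :: "'v set \<Rightarrow> 'v rel \<Rightarrow> 'v set \<Rightarrow> 'v set \<Rightarrow> bool" where
  "ec V E Rnd Y \<longleftrightarrow> Y \<subseteq> V \<and> Y \<noteq> {} \<and> closed_set E Rnd Y \<and> (\<forall>x \<in> Y. \<forall>y \<in> Y. (x, y) \<in> (res E Y)\<^sup>*)"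

definition mec :: "'v set \<Rightarrow> 'v rel \<Rightarrow> 'v set \<Rightarrow> 'v set \<Rightarrow> bool" where
  "mec V E Rnd M \<longleftrightarrow> ec V E Rnd M \<and> (\<forall>Y. ec V E Rnd Y \<and> M \<subseteq> Y \<longrightarrow> Y = M)"

text \<open>All members are strongly connected through the common vertex \<open>v\<close>.\<close>

lemma ec_Union:
  assumes "\<And>Y. Y \<in> F \<Longrightarrow> ec V E Rnd Y \<and> v \<in> Y" "F \<noteq> {}"
  shows "ec V E Rnd (\<Union>F)"
proof -
  have "(x, v) \<in> (res E (\<Union>F))\<^sup>* \<and> (v, x) \<in> (res E (\<Union>F))\<^sup>*" if "x \<in> \<Union>F" for x
  proof -
    from that obtain Y where Y: "Y \<in> F" "x \<in> Y" by auto
    then have "(x, v) \<in> (res E Y)\<^sup>*" "(v, x) \<in> (res E Y)\<^sup>*"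
      using assms(1)[of Y] by (auto simp: ec_def)
    then show ?thesis using Y by (auto intro: rtrancl_res_mono)
  qed
  then have "(x, y) \<in> (res E (\<Union>F))\<^sup>*" if "x \<in> \<Union>F" "y \<in> \<Union>F" for x y
    using that by (meson rtrancl_trans)
  moreover have "\<Union>F \<subseteq> V" "\<Union>F \<noteq> {}" using assms by (auto simp: ec_def)
  moreover have "closed_set E Rnd (\<Union>F)"
    using assms(1) unfolding ec_def closed_set_def by fastforce
  ultimately show ?thesis by (auto simp: ec_def)
qed

lemma ec_Un: "ec V E Rnd A \<Longrightarrow> ec V E Rnd B \<Longrightarrow> v \<in> A \<Longrightarrow> v \<in> B \<Longrightarrow> ec V E Rnd (A \<union> B)"
  using ec_Union[of "{A, B}" V E Rnd v] by auto

text \<open>The union of all end-components through \<open>v\<close> is an end-component, and no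
  larger one exists.\<close>

lemma ec_imp_mec:
  assumes "ec V E Rnd Y" "v \<in> Y"
  shows "\<exists>M. mec V E Rnd M \<and> v \<in> M"
proof -
  let ?M = "\<Union>{Y. ec V E Rnd Y \<and> v \<in> Y}"
  have "ec V E Rnd ?M" using assms by (intro ec_Union[where v = v]) auto
  then have "mec V E Rnd ?M" using assms by (auto simp: mec_def)
  then show ?thesis using assms by auto
qed

lemma mec_unique: "mec V E Rnd A \<Longrightarrow> mec V E Rnd B \<Longrightarrow> v \<in> A \<Longrightarrow> v \<in> B \<Longrightarrow> A = B"
  using ec_Un[of V E Rnd A B v] unfolding mec_def by (metis Un_upper1 Un_upper2)

text \<open>This is a perfect elimination order of a chordal supergraph: \<open>N v\<close> consists
  of the earlier neighbours of \<open>v\<close> in the supergraph and is a clique there.\<close>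

locale elimination =
  fixes V :: "'v set" and E :: "'v rel" and Rnd :: "'v set"
    and n :: nat and rk :: "'v \<Rightarrow> nat" and vert :: "nat \<Rightarrow> 'v" and N :: "'v \<Rightarrow> 'v set"
  assumes E_sub: "E \<subseteq> V \<times> V"
    and rk_less: "v \<in> V \<Longrightarrow> rk v < n"
    and rk_inj: "u \<in> V \<Longrightarrow> v \<in> V \<Longrightarrow> rk u = rk v \<Longrightarrow> u = v"
    and vert: "i < n \<Longrightarrow> vert i \<in> V" "i < n \<Longrightarrow> rk (vert i) = i"
    and N_sub: "v \<in> V \<Longrightarrow> u \<in> N v \<Longrightarrow> u \<in> V \<and> rk u < rk v"
    and arc_N: "(x, y) \<in> E \<or> (y, x) \<in> E \<Longrightarrow> rk x < rk y \<Longrightarrow> x \<in> N y"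
    and N_clique: "v \<in> V \<Longrightarrow> u \<in> N v \<Longrightarrow> w \<in> N v \<Longrightarrow> rk u < rk w \<Longrightarrow> u \<in> N w"
begin

definition below :: "nat \<Rightarrow> 'v set" where
  "below i = {v \<in> V. rk v < i}"

text \<open>For \<open>i = n\<close> only closure under random arcs is left, which makes the base
  case immediate. Every end-component that meets \<open>below i\<close> is supported at
  \<open>i\<close>; at level \<open>i\<close>, the connections among the vertices of
  \<open>below i\<close> are deliberately left open.\<close>

definition supported :: "nat \<Rightarrow> 'v set \<Rightarrow> bool" where
  "supported i Y \<longleftrightarrow> Y \<subseteq> V \<and> closed_set E Rnd Y \<and>
     (\<forall>y \<in> Y. (\<exists>s \<in> Y \<inter> below i. (s, y) \<in> (res E Y)\<^sup>*) \<and> (\<exists>s \<in> Y \<inter> below i. (y, s) \<in> (res E Y)\<^sup>*))"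

definition largest :: "nat \<Rightarrow> 'v set \<Rightarrow> 'v set" where
  "largest i S = \<Union>{Y. supported i Y \<and> Y \<inter> below i = S}"

text \<open>Two liberties matter: \<open>r S\<close> only has to have the right reachability, so it
  need not be transitive, and for a bad \<open>S\<close> it may be any relation on
  \<open>S\<close>.\<close>

definition summary :: "nat \<Rightarrow> ('v set \<Rightarrow> bool) \<Rightarrow> ('v set \<Rightarrow> 'v rel) \<Rightarrow> bool" where
  "summary i b r \<longleftrightarrow> (\<forall>S \<subseteq> below i. r S \<subseteq> S \<times> S \<and>
     (b S \<longleftrightarrow> \<not> (\<exists>Y. supported i Y \<and> Y \<inter> below i = S)) \<and>
     (\<not> b S \<longrightarrow> (\<forall>x \<in> S. \<forall>y \<in> S. (x, y) \<in> (r S)\<^sup>* \<longleftrightarrow> (x, y) \<in> (res E (largest i S))\<^sup>*)))"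

lemma below_Suc: "v \<in> V \<Longrightarrow> below (Suc (rk v)) = insert v (below (rk v))"
  unfolding below_def using rk_inj less_Suc_eq by auto

lemma not_in_below: "v \<notin> below (rk v)"
  by (simp add: below_def)

lemma supported_Union:
  assumes "\<And>Y. Y \<in> F \<Longrightarrow> supported i Y"
  shows "supported i (\<Union>F)"
proof -
  have "(\<exists>s \<in> \<Union>F \<inter> below i. (s, y) \<in> (res E (\<Union>F))\<^sup>*) \<and>
      (\<exists>s \<in> \<Union>F \<inter> below i. (y, s) \<in> (res E (\<Union>F))\<^sup>*)" if y: "y \<in> \<Union>F" for y
  proof -
    from y obtain Y where Y: "Y \<in> F" "y \<in> Y" by auto
    then obtain s t where "s \<in> Y \<inter> below i" "(s, y) \<in> (res E Y)\<^sup>*" "t \<in> Y \<inter> below i" "(y, t) \<in> (res E Y)\<^sup>*"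
      using assms[OF Y(1)] unfolding supported_def by blast
    then show ?thesis using Y(1) rtrancl_res_mono[of _ _ E Y "\<Union>F"] by blast
  qed
  moreover have "closed_set E Rnd (\<Union>F)" using assms unfolding supported_def closed_set_def by fastforce
  moreover have "\<Union>F \<subseteq> V" using assms unfolding supported_def by blast
  ultimately show ?thesis unfolding supported_def by blast
qed

lemma supported_largest:
  assumes "supported i Y" "Y \<inter> below i = S"
  shows "supported i (largest i S)" "largest i S \<inter> below i = S" "Y \<subseteq> largest i S"
  using assms by (auto simp: largest_def intro!: supported_Union)

lemma supportedE:
  assumes "supported i Y" "Y \<inter> below i = S" "y \<in> Y"
  obtains p q where "p \<in> S" "(p, y) \<in> (res E Y)\<^sup>*" "q \<in> S" "(y, q) \<in> (res E Y)\<^sup>*"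
  using assms unfolding supported_def by auto

lemma supported_Suc:
  assumes "supported i Y"
  shows "supported (Suc i) Y"
proof -
  have "below i \<subseteq> below (Suc i)" by (auto simp: below_def)
  then show ?thesis using assms unfolding supported_def by blast
qed

lemma supported_Suc_iff:
  assumes "v \<in> V" "rk v = i" "v \<notin> Y"
  shows "supported i Y \<longleftrightarrow> supported (Suc i) Y"
proof -
  have "Y \<inter> below (Suc i) = Y \<inter> below i" using below_Suc[OF assms(1)] assms by auto
  then show ?thesis unfolding supported_def by simp
qed

context
  fixes b :: "'v set \<Rightarrow> bool" and r :: "'v set \<Rightarrow> 'v rel" and v :: 'v and i :: nat
  assumes sum: "summary (Suc i) b r" and v: "v \<in> V" "rk v = i"
begin

lemma below_Suc': "below (Suc i) = insert v (below i)" "v \<notin> below i"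
  using below_Suc[of v] not_in_below[of v] v by auto

text \<open>If \<open>v\<close> is attached to \<open>S\<close> in both directions, every vertex
  supported through \<open>v\<close> is also supported through \<open>S\<close>. Conversely, the
  support of \<open>v\<close> itself by \<open>S\<close> is a pair of walks in the summary relation,
  and their steps at \<open>v\<close> contain the required arcs.\<close>

lemma decision_iff:
  assumes S: "S \<subseteq> below i"
  shows "decision v b r S \<longleftrightarrow> (\<exists>Y. supported i Y \<and> Y \<inter> below i = S \<and> v \<in> Y)"
proof
  let ?S = "insert v S"
  let ?Z = "largest (Suc i) ?S"
  have S': "?S \<subseteq> below (Suc i)" and vS: "v \<notin> S" using S below_Suc' by auto
  note s = sum[unfolded summary_def, rule_format, OF S']
  {
    assume d: "decision v b r S"
    then have nb: "\<not> b ?S" by (simp add: decision_def)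
    then obtain Y where "supported (Suc i) Y" "Y \<inter> below (Suc i) = ?S" using s by auto
    note Z = supported_largest[OF this]
    from d obtain a c where a: "a \<in> S" "(v, a) \<in> r ?S" "c \<in> S" "(c, v) \<in> r ?S"
      by (auto simp: decision_def)
    then have ac: "(v, a) \<in> (res E ?Z)\<^sup>*" "(c, v) \<in> (res E ?Z)\<^sup>*" using s nb by auto
    have cut: "?Z \<inter> below i = S" using Z(2) below_Suc' S by auto
    have "(\<exists>s \<in> S. (s, y) \<in> (res E ?Z)\<^sup>*) \<and> (\<exists>s \<in> S. (y, s) \<in> (res E ?Z)\<^sup>*)" if y: "y \<in> ?Z" for y
    proof -
      obtain s t where "s \<in> ?S" "(s, y) \<in> (res E ?Z)\<^sup>*" "t \<in> ?S" "(y, t) \<in> (res E ?Z)\<^sup>*"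
        by (rule supportedE[OF Z(1,2) y])
      then show ?thesis using ac a by (metis insertE rtrancl_trans)
    qed
    then have "supported i ?Z" using Z(1) unfolding supported_def cut by auto
    moreover have "v \<in> ?Z" using Z(2) by auto
    ultimately show "\<exists>Y. supported i Y \<and> Y \<inter> below i = S \<and> v \<in> Y" using cut by blast
  }
  {
    assume "\<exists>Y. supported i Y \<and> Y \<inter> below i = S \<and> v \<in> Y"
    then obtain Y where Y: "supported i Y" "Y \<inter> below i = S" "v \<in> Y" by auto
    then have Y': "supported (Suc i) Y" "Y \<inter> below (Suc i) = ?S"
      using supported_Suc below_Suc' by auto
    note Z = supported_largest[OF this]
    have nb: "\<not> b ?S" using s Y' by auto
    obtain p q where pq: "p \<in> S" "(p, v) \<in> (res E Y)\<^sup>*" "q \<in> S" "(v, q) \<in> (res E Y)\<^sup>*"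
      by (rule supportedE[OF Y])
    then have "(p, v) \<in> (r ?S)\<^sup>*" "(v, q) \<in> (r ?S)\<^sup>*"
      using s nb rtrancl_res_mono[OF _ Z(3)] by auto
    then obtain c a where "c \<noteq> v" "(c, v) \<in> r ?S" "a \<noteq> v" "(v, a) \<in> r ?S"
      using rtrancl_first_step[of v q "r ?S"] rtrancl_last_step[of p v "r ?S"] pq vS by metis
    then show "decision v b r S" using nb s vS unfolding decision_def by blast
  }
qed

text \<open>After a positive decision some supported set with trace \<open>S\<close> contains
  \<open>v\<close>, hence so does the largest one; after a negative decision none does. In both
  cases the largest set stays the same and \<open>pick\<close> is its trace one level higher. Its
  reachability then only has to be restricted to vertices other than \<open>v\<close>.\<close>

lemma elim_summary: "summary i (elim_bad v b r) (elim_rel v b r)"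
  unfolding summary_def
proof (intro allI impI)
  fix S assume S: "S \<subseteq> below i"
  then have vS: "v \<notin> S" using below_Suc' by auto
  let ?T = "pick v b r S"
  have T: "?T \<subseteq> below (Suc i)" using S below_Suc' by (auto simp: pick_def)
  note s = sum[unfolded summary_def, rule_format, OF T]
  have TS: "?T - {v} = S" using vS by (auto simp: pick_def)
  have sub: "elim_rel v b r S \<subseteq> S \<times> S"
    using s TS unfolding elim_rel_def shortcut_def by blast
  have eq: "largest i S = largest (Suc i) ?T \<and>
     ((\<exists>Y. supported i Y \<and> Y \<inter> below i = S) \<longleftrightarrow> (\<exists>Y. supported (Suc i) Y \<and> Y \<inter> below (Suc i) = ?T))"
  proof (cases "decision v b r S")
    case False
    then have noY: "\<not> (\<exists>Y. supported i Y \<and> Y \<inter> below i = S \<and> v \<in> Y)" using decision_iff[OF S] by simp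
    have T': "?T = S" using False vS by (simp add: pick_def)
    have "supported i Y \<and> Y \<inter> below i = S \<longleftrightarrow> supported (Suc i) Y \<and> Y \<inter> below (Suc i) = ?T" for Y
    proof (cases "v \<in> Y")
      case True
      then show ?thesis using noY below_Suc' T' vS by auto
    next
      case False
      then show ?thesis using supported_Suc_iff[OF v False] below_Suc' T' by auto
    qed
    then show ?thesis by (simp add: largest_def)
  next
    case True
    then have T': "?T = insert v S" by (simp add: pick_def)
    from True decision_iff[OF S] obtain Y where Y: "supported i Y" "Y \<inter> below i = S" "v \<in> Y" by auto
    then have Y': "supported (Suc i) Y" "Y \<inter> below (Suc i) = ?T"
      using supported_Suc below_Suc' T' by auto
    note L = supported_largest[OF Y(1,2)] and L' = supported_largest[OF Y']
    have "supported (Suc i) (largest i S)" "largest i S \<inter> below (Suc i) = ?T"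
      using L Y(3) supported_Suc below_Suc' T' by auto
    then have le: "largest i S \<subseteq> largest (Suc i) ?T" by (auto simp: largest_def)
    have "(\<exists>s \<in> S. (s, y) \<in> (res E (largest (Suc i) ?T))\<^sup>*) \<and>
          (\<exists>s \<in> S. (y, s) \<in> (res E (largest (Suc i) ?T))\<^sup>*)"
      if y: "y \<in> largest (Suc i) ?T" for y
    proof -
      have *: "(\<exists>s \<in> S. (s, v) \<in> (res E (largest (Suc i) ?T))\<^sup>*) \<and>
          (\<exists>s \<in> S. (v, s) \<in> (res E (largest (Suc i) ?T))\<^sup>*)"
        using supportedE[OF Y] rtrancl_res_mono[OF _ L'(3)] by metis
      obtain s t where "s \<in> insert v S" "(s, y) \<in> (res E (largest (Suc i) ?T))\<^sup>*"
          "t \<in> insert v S" "(y, t) \<in> (res E (largest (Suc i) ?T))\<^sup>*"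
        using supportedE[OF L'(1,2) y] unfolding T' by metis
      then show ?thesis using * by (metis insertE rtrancl_trans)
    qed
    moreover have cut: "largest (Suc i) ?T \<inter> below i = S" using L'(2) below_Suc' T' S by auto
    ultimately have "supported i (largest (Suc i) ?T)" using L'(1) unfolding supported_def by auto
    then have "largest (Suc i) ?T \<subseteq> largest i S" using cut by (auto simp: largest_def)
    then show ?thesis using le Y Y' by auto
  qed
  have "(x, y) \<in> (elim_rel v b r S)\<^sup>* \<longleftrightarrow> (x, y) \<in> (res E (largest i S))\<^sup>*"
    if "\<not> elim_bad v b r S" "x \<in> S" "y \<in> S" for x y
  proof -
    have "x \<noteq> v" "y \<noteq> v" "x \<in> ?T" "y \<in> ?T" using that TS vS by auto
    then show ?thesis using that s eq unfolding elim_rel_def elim_bad_def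
      by (simp add: rtrancl_shortcut)
  qed
  then show "elim_rel v b r S \<subseteq> S \<times> S \<and>
     (elim_bad v b r S \<longleftrightarrow> \<not> (\<exists>Y. supported i Y \<and> Y \<inter> below i = S)) \<and>
     (\<not> elim_bad v b r S \<longrightarrow> (\<forall>x \<in> S. \<forall>y \<in> S. (x, y) \<in> (elim_rel v b r S)\<^sup>* \<longleftrightarrow> (x, y) \<in> (res E (largest i S))\<^sup>*))"
    using sub eq s unfolding elim_bad_def by auto
qed

text \<open>\<open>M\<close> is the largest supported set with its own trace: if \<open>Y\<close>
  has the same trace, all vertices of \<open>M \<union> Y\<close> are supported through
  \<open>M\<close>, which is strongly connected, so \<open>M \<union> Y\<close> is an end-component
  and maximality applies.\<close>

lemma mec_decision:
  assumes M: "mec V E Rnd M" and ne: "M \<inter> below i \<noteq> {}"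
  shows "v \<in> M \<longleftrightarrow> decision v b r (M \<inter> below i)"
proof -
  have ec: "ec V E Rnd M" using M by (simp add: mec_def)
  then have sM: "supported i M" using ne unfolding ec_def supported_def by blast
  have "Y \<subseteq> M" if Y: "supported i Y" "Y \<inter> below i = M \<inter> below i" for Y
  proof -
    obtain s where s: "s \<in> M \<inter> below i" using ne by auto
    have U: "supported i (M \<union> Y)" using supported_Union[of "{M, Y}" i] sM Y by auto
    have cut: "(M \<union> Y) \<inter> below i = M \<inter> below i" using Y by auto
    have "(x, s) \<in> (res E (M \<union> Y))\<^sup>* \<and> (s, x) \<in> (res E (M \<union> Y))\<^sup>*" if x: "x \<in> M \<union> Y" for x
    proof -
      obtain p q where pq: "p \<in> M" "(p, x) \<in> (res E (M \<union> Y))\<^sup>*" "q \<in> M" "(x, q) \<in> (res E (M \<union> Y))\<^sup>*"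
        using supportedE[OF U cut x] by (metis IntD1)
      then have "(q, s) \<in> (res E (M \<union> Y))\<^sup>*" "(s, p) \<in> (res E (M \<union> Y))\<^sup>*"
        using ec s rtrancl_res_mono[of _ _ E M "M \<union> Y"] unfolding ec_def by blast+
      then show ?thesis using pq by (meson rtrancl_trans)
    qed
    then have "(x, y) \<in> (res E (M \<union> Y))\<^sup>*" if "x \<in> M \<union> Y" "y \<in> M \<union> Y" for x y
      using that by (meson rtrancl_trans)
    then have "ec V E Rnd (M \<union> Y)" using U ne unfolding ec_def supported_def by blast
    then show ?thesis using M unfolding mec_def by blast
  qed
  then show ?thesis using decision_iff[of "M \<inter> below i"] sM by blast
qed

text \<open>If \<open>v\<close> comes first in its component, the trace at \<open>Suc i\<close> is
  \<open>{v}\<close>, and being supported by a single vertex amounts to strong connectivity.\<close>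

lemma mec_start:
  assumes new: "\<And>M. mec V E Rnd M \<Longrightarrow> v \<in> M \<Longrightarrow> M \<inter> below i = {}"
  shows "(\<exists>M. mec V E Rnd M \<and> v \<in> M) \<longleftrightarrow> \<not> b {v}"
proof -
  have "{v} \<subseteq> below (Suc i)" using below_Suc' by auto
  then have b: "b {v} \<longleftrightarrow> \<not> (\<exists>Y. supported (Suc i) Y \<and> Y \<inter> below (Suc i) = {v})"
    using sum unfolding summary_def by blast
  show ?thesis
  proof
    assume "\<exists>M. mec V E Rnd M \<and> v \<in> M"
    then obtain M where M: "mec V E Rnd M" "v \<in> M" by auto
    then have *: "M \<inter> below (Suc i) = {v}" using new[OF M] below_Suc' by auto
    then have "supported (Suc i) M" using M unfolding mec_def ec_def supported_def by blast
    then show "\<not> b {v}" using b * by auto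
  next
    assume "\<not> b {v}"
    then obtain Y where Y: "supported (Suc i) Y" "Y \<inter> below (Suc i) = {v}" using b by auto
    then have "(x, v) \<in> (res E Y)\<^sup>* \<and> (v, x) \<in> (res E Y)\<^sup>*" if "x \<in> Y" for x
      using that unfolding supported_def by auto
    then have "(x, y) \<in> (res E Y)\<^sup>*" if "x \<in> Y" "y \<in> Y" for x y
      using that by (meson rtrancl_trans)
    then have "ec V E Rnd Y" "v \<in> Y" using Y unfolding ec_def supported_def by auto
    then show "\<exists>M. mec V E Rnd M \<and> v \<in> M" by (rule ec_imp_mec)
  qed
qed

end

end

section \<open>Elimination with local tables\<close>

type_synonym 'v tables = "('v \<Rightarrow> 'v set \<Rightarrow> bool) \<times> ('v \<Rightarrow> 'v set \<Rightarrow> 'v rel)"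

context elimination
begin

text \<open>The arcs whose later end is \<open>v\<close>, loops included: every arc enters exactly
  one table, and its ends lie in \<open>insert v (N v)\<close>.\<close>

definition own_arcs :: "'v \<Rightarrow> 'v rel" where
  "own_arcs v = {(x, y) \<in> E. x = v \<and> rk y \<le> rk v \<or> y = v \<and> rk x \<le> rk v}"

definition base :: "'v tables" where
  "base = (\<lambda>v S. \<exists>(x, y) \<in> own_arcs v. x \<in> Rnd \<and> x \<in> S \<and> y \<notin> S, \<lambda>v S. own_arcs v \<inter> S \<times> S)"

definition is_parent :: "'v \<Rightarrow> 'v \<Rightarrow> bool" where
  "is_parent p v \<longleftrightarrow> p \<in> N v \<and> (\<forall>u \<in> N v. rk u \<le> rk p)"

definition push :: "'v \<Rightarrow> 'v tables \<Rightarrow> 'v tables" where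
  "push v \<sigma> =
     (\<lambda>p S. fst \<sigma> p S \<or> is_parent p v \<and> elim_bad v (fst \<sigma> v) (snd \<sigma> v) S,
      \<lambda>p S. snd \<sigma> p S \<union> (if is_parent p v then elim_rel v (fst \<sigma> v) (snd \<sigma> v) S else {}))"

text \<open>In \<open>pushed j\<close> the \<open>j\<close> vertices of largest rank have been
  eliminated. Vertex \<open>v\<close> is eliminated in step \<open>n - 1 - rk v\<close>, which
  explains this index in all later statements.\<close>

primrec pushed :: "nat \<Rightarrow> 'v tables" where
  "pushed 0 = base"
| "pushed (Suc j) = push (vert (n - 1 - j)) (pushed j)"

text \<open>The last conjunct takes care of vertices without a parent: if \<open>N v\<close> is
  empty, every trace looks empty at \<open>v\<close>, so nothing is bad, no arc remains, and no
  information is lost by pushing nothing.\<close>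

definition local_tables :: "'v tables \<Rightarrow> bool" where
  "local_tables \<sigma> \<longleftrightarrow> (\<forall>v \<in> V. \<forall>S.
     fst \<sigma> v S = fst \<sigma> v (S \<inter> insert v (N v)) \<and> snd \<sigma> v S = snd \<sigma> v (S \<inter> insert v (N v)) \<and>
     snd \<sigma> v S \<subseteq> (S \<inter> insert v (N v)) \<times> (S \<inter> insert v (N v)) \<and> \<not> fst \<sigma> v {})"

lemma local_tablesD:
  assumes "local_tables \<sigma>" "v \<in> V"
  shows "S \<inter> insert v (N v) = S' \<inter> insert v (N v) \<Longrightarrow> fst \<sigma> v S = fst \<sigma> v S'"
    and "S \<inter> insert v (N v) = S' \<inter> insert v (N v) \<Longrightarrow> snd \<sigma> v S = snd \<sigma> v S'"
    and "snd \<sigma> v S \<subseteq> (S \<inter> insert v (N v)) \<times> (S \<inter> insert v (N v))"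
    and "\<not> fst \<sigma> v {}"
  using assms unfolding local_tables_def by metis+

lemma own_arcs_sub: "own_arcs v \<subseteq> insert v (N v) \<times> insert v (N v)"
proof
  fix e assume "e \<in> own_arcs v"
  then obtain x y where e: "e = (x, y)" "(x, y) \<in> E" "x = v \<and> rk y \<le> rk v \<or> y = v \<and> rk x \<le> rk v"
    by (auto simp: own_arcs_def)
  then have "x \<in> V" "y \<in> V" using E_sub by auto
  then show "e \<in> insert v (N v) \<times> insert v (N v)"
    using e arc_N[of x y] arc_N[of y x] rk_inj[of x y] by (auto simp: le_less)
qed

lemma local_base: "local_tables base"
  unfolding local_tables_def
proof (intro ballI allI)
  fix v S
  let ?X = "insert v (N v)"
  have "x \<in> ?X" "y \<in> ?X" if "(x, y) \<in> own_arcs v" for x y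
    using own_arcs_sub that by blast+
  then show "fst base v S = fst base v (S \<inter> ?X) \<and> snd base v S = snd base v (S \<inter> ?X) \<and>
      snd base v S \<subseteq> (S \<inter> ?X) \<times> (S \<inter> ?X) \<and> \<not> fst base v {}"
    unfolding base_def fst_conv snd_conv by (intro conjI) blast+
qed

lemma decision_local:
  assumes "local_tables \<sigma>" "v \<in> V" "S \<inter> N v = S' \<inter> N v"
  shows "decision v (fst \<sigma> v) (snd \<sigma> v) S = decision v (fst \<sigma> v) (snd \<sigma> v) S'"
proof -
  have vN: "v \<notin> N v" using N_sub[OF assms(2)] by blast
  have eq: "insert v S \<inter> insert v (N v) = insert v S' \<inter> insert v (N v)" using assms(3) by blast
  note b = local_tablesD(1)[OF assms(1,2) eq] and r = local_tablesD(2)[OF assms(1,2) eq]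
    and sub = local_tablesD(3)[OF assms(1,2)]
  have "a \<in> S - {v} \<longleftrightarrow> a \<in> S' - {v}" if "a \<in> insert v (N v)" for a
    using that assms(3) by blast
  then show ?thesis using sub[of "insert v S'"] unfolding decision_def b r by blast
qed

lemma pick_local:
  assumes "local_tables \<sigma>" "v \<in> V" "S \<inter> N v = S' \<inter> N v"
  shows "pick v (fst \<sigma> v) (snd \<sigma> v) S \<inter> insert v (N v) = pick v (fst \<sigma> v) (snd \<sigma> v) S' \<inter> insert v (N v)"
  using decision_local[OF assms] assms(3) unfolding pick_def by auto

lemma elim_local:
  assumes "local_tables \<sigma>" "v \<in> V" "S \<inter> N v = S' \<inter> N v"
  shows "elim_bad v (fst \<sigma> v) (snd \<sigma> v) S = elim_bad v (fst \<sigma> v) (snd \<sigma> v) S'"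
    and "elim_rel v (fst \<sigma> v) (snd \<sigma> v) S = elim_rel v (fst \<sigma> v) (snd \<sigma> v) S'"
  unfolding elim_bad_def elim_rel_def
  using pick_local[OF assms] local_tablesD(1,2)[OF assms(1,2)] by metis+

lemma elim_rel_sub:
  assumes "local_tables \<sigma>" "v \<in> V"
  shows "elim_rel v (fst \<sigma> v) (snd \<sigma> v) S \<subseteq> (S \<inter> N v) \<times> (S \<inter> N v)"
  using local_tablesD(3)[OF assms, of "pick v (fst \<sigma> v) (snd \<sigma> v) S"]
  unfolding elim_rel_def shortcut_def pick_def by (auto split: if_splits)

lemma elim_bad_empty:
  assumes "local_tables \<sigma>" "v \<in> V"
  shows "\<not> elim_bad v (fst \<sigma> v) (snd \<sigma> v) {}"
  using local_tablesD(4)[OF assms] unfolding elim_bad_def pick_def decision_def by simp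

lemma parent_N_sub:
  assumes "v \<in> V" "is_parent p v"
  shows "p \<in> V" "rk p < rk v" "N v \<subseteq> insert p (N p)"
proof -
  show p: "p \<in> V" "rk p < rk v" using assms N_sub[OF assms(1)] by (auto simp: is_parent_def)
  show "N v \<subseteq> insert p (N p)"
  proof
    fix u assume u: "u \<in> N v"
    then have "u \<in> V" "rk u \<le> rk p" using assms N_sub[OF assms(1)] by (auto simp: is_parent_def)
    then show "u \<in> insert p (N p)"
      using N_clique[OF assms(1) u, of p] assms(2) rk_inj[of u p] p by (auto simp: is_parent_def le_less)
  qed
qed

lemma local_push:
  assumes "local_tables \<sigma>" "v \<in> V"
  shows "local_tables (push v \<sigma>)"
  unfolding local_tables_def
proof (intro ballI allI)
  fix p S assume p: "p \<in> V"
  let ?X = "insert p (N p)"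
  let ?eb = "elim_bad v (fst \<sigma> v) (snd \<sigma> v)" and ?er = "elim_rel v (fst \<sigma> v) (snd \<sigma> v)"
  have X: "S \<inter> ?X = (S \<inter> ?X) \<inter> ?X" by simp
  note b = local_tablesD(1)[OF assms(1) p X] and r = local_tablesD(2)[OF assms(1) p X]
    and sub = local_tablesD(3)[OF assms(1) p, of S] and empty = local_tablesD(4)[OF assms(1) p]
  have e: "?eb S = ?eb (S \<inter> ?X)" "?er S = ?er (S \<inter> ?X)" "?er S \<subseteq> (S \<inter> ?X) \<times> (S \<inter> ?X)"
    if "is_parent p v"
  proof -
    have NX: "N v \<subseteq> ?X" using parent_N_sub assms(2) that by blast
    then have "S \<inter> N v = (S \<inter> ?X) \<inter> N v" by auto
    from elim_local[OF assms this] show "?eb S = ?eb (S \<inter> ?X)" "?er S = ?er (S \<inter> ?X)" .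
    show "?er S \<subseteq> (S \<inter> ?X) \<times> (S \<inter> ?X)" using elim_rel_sub[OF assms, of S] NX by blast
  qed
  have "fst (push v \<sigma>) p S = fst (push v \<sigma>) p (S \<inter> ?X)"
    using b e(1) unfolding push_def fst_conv by blast
  moreover have "snd (push v \<sigma>) p S = snd (push v \<sigma>) p (S \<inter> ?X)"
    using r e(2) unfolding push_def snd_conv by presburger
  moreover have "snd (push v \<sigma>) p S \<subseteq> (S \<inter> ?X) \<times> (S \<inter> ?X)"
    using sub e(3) unfolding push_def snd_conv by (cases "is_parent p v") auto
  moreover have "\<not> fst (push v \<sigma>) p {}"
    using empty elim_bad_empty[OF assms] unfolding push_def fst_conv by blast
  ultimately show "fst (push v \<sigma>) p S = fst (push v \<sigma>) p (S \<inter> ?X) \<and>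
      snd (push v \<sigma>) p S = snd (push v \<sigma>) p (S \<inter> ?X) \<and>
      snd (push v \<sigma>) p S \<subseteq> (S \<inter> ?X) \<times> (S \<inter> ?X) \<and> \<not> fst (push v \<sigma>) p {}"
    by blast
qed

lemma local_pushed: "j \<le> n \<Longrightarrow> local_tables (pushed j)"
  by (induction j) (auto intro!: local_base local_push vert(1))

text \<open>The join of all remaining tables exists only in the proof. It is the global information
  to which the elimination theorem applies, while the algorithm keeps it distributed.\<close>

definition joined_bad :: "nat \<Rightarrow> 'v tables \<Rightarrow> 'v set \<Rightarrow> bool" where
  "joined_bad i \<sigma> S \<longleftrightarrow> (\<exists>u \<in> below i. fst \<sigma> u S)"

definition joined_rel :: "nat \<Rightarrow> 'v tables \<Rightarrow> 'v set \<Rightarrow> 'v rel" where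
  "joined_rel i \<sigma> S = (\<Union>u \<in> below i. snd \<sigma> u S)"

lemma summary_base: "summary n (joined_bad n base) (joined_rel n base)"
  unfolding summary_def
proof (intro allI impI)
  fix S assume "S \<subseteq> below n"
  have V: "below n = V" using rk_less by (auto simp: below_def)
  with \<open>S \<subseteq> below n\<close> have S: "S \<subseteq> V" by simp
  have cover: "\<exists>u \<in> V. (x, y) \<in> own_arcs u" if "(x, y) \<in> E" for x y
    using that E_sub by (cases "rk x \<le> rk y") (auto simp: own_arcs_def)
  have b: "joined_bad n base S \<longleftrightarrow> \<not> closed_set E Rnd S"
    unfolding joined_bad_def base_def closed_set_def V fst_conv
    using cover by (fastforce simp: own_arcs_def)
  have r: "joined_rel n base S = res E S"
    unfolding joined_rel_def base_def V snd_conv res_def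
    using cover by (fastforce simp: own_arcs_def)
  have sup: "supported n Y \<longleftrightarrow> Y \<subseteq> V \<and> closed_set E Rnd Y" for Y
    unfolding supported_def V by blast
  have "largest n S = S" if "closed_set E Rnd S"
    using that S unfolding largest_def sup V by blast
  moreover have "(\<exists>Y. supported n Y \<and> Y \<inter> below n = S) \<longleftrightarrow> closed_set E Rnd S"
    using S unfolding sup V by (metis inf.orderE)
  ultimately show "joined_rel n base S \<subseteq> S \<times> S \<and>
      (joined_bad n base S \<longleftrightarrow> \<not> (\<exists>Y. supported n Y \<and> Y \<inter> below n = S)) \<and>
      (\<not> joined_bad n base S \<longrightarrow>
        (\<forall>x \<in> S. \<forall>y \<in> S. (x, y) \<in> (joined_rel n base S)\<^sup>* \<longleftrightarrow> (x, y) \<in> (res E (largest n S))\<^sup>*))"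
    unfolding b r by (auto simp: res_def)
qed

text \<open>Only the tables of \<open>v\<close> mention \<open>v\<close>, so eliminating \<open>v\<close> from the join amounts to
  eliminating it from these tables.\<close>

lemma joined_Suc:
  assumes loc: "local_tables \<sigma>" and v: "v \<in> V" "rk v = i" and vS: "v \<notin> S"
  shows "joined_bad (Suc i) \<sigma> (insert v S) \<longleftrightarrow> joined_bad i \<sigma> S \<or> fst \<sigma> v (insert v S)"
    and "joined_bad (Suc i) \<sigma> S \<longleftrightarrow> joined_bad i \<sigma> S \<or> fst \<sigma> v S"
    and "joined_rel (Suc i) \<sigma> (insert v S) = joined_rel i \<sigma> S \<union> snd \<sigma> v (insert v S)"
    and "joined_rel (Suc i) \<sigma> S = joined_rel i \<sigma> S \<union> snd \<sigma> v S"
    and "joined_rel i \<sigma> S \<subseteq> S \<times> S"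
proof -
  have eq: "insert v S \<inter> insert u (N u) = S \<inter> insert u (N u)" and u: "u \<in> V" if "u \<in> below i" for u
  proof -
    show "u \<in> V" using that by (simp add: below_def)
    then show "insert v S \<inter> insert u (N u) = S \<inter> insert u (N u)"
      using N_sub[of u v] that v by (auto simp: below_def)
  qed
  have B: "below (Suc i) = insert v (below i)" using below_Suc[of v] v by simp
  have fu: "fst \<sigma> u (insert v S) = fst \<sigma> u S" "snd \<sigma> u (insert v S) = snd \<sigma> u S" if "u \<in> below i" for u
    using local_tablesD(1,2)[OF loc u[OF that] eq[OF that]] by auto
  show "joined_bad (Suc i) \<sigma> (insert v S) \<longleftrightarrow> joined_bad i \<sigma> S \<or> fst \<sigma> v (insert v S)"
    and "joined_bad (Suc i) \<sigma> S \<longleftrightarrow> joined_bad i \<sigma> S \<or> fst \<sigma> v S"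
    and "joined_rel (Suc i) \<sigma> (insert v S) = joined_rel i \<sigma> S \<union> snd \<sigma> v (insert v S)"
    and "joined_rel (Suc i) \<sigma> S = joined_rel i \<sigma> S \<union> snd \<sigma> v S"
    unfolding joined_bad_def joined_rel_def B using fu by auto
  show "joined_rel i \<sigma> S \<subseteq> S \<times> S"
    unfolding joined_rel_def using local_tablesD(3)[OF loc u] by blast
qed

text \<open>The other tables cannot veto, by assumption, and contribute no arc at \<open>v\<close>,
  because their arcs stay inside \<open>S\<close>.\<close>

lemma decision_joined:
  assumes loc: "local_tables \<sigma>" and v: "v \<in> V" "rk v = i" and S: "S \<subseteq> below i"
    and nb: "\<not> joined_bad i \<sigma> S"
  shows "decision v (joined_bad (Suc i) \<sigma>) (joined_rel (Suc i) \<sigma>) S = decision v (fst \<sigma> v) (snd \<sigma> v) S"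
proof -
  have vS: "v \<notin> S" using S v by (auto simp: below_def)
  note j = joined_Suc[OF loc v vS]
  show ?thesis unfolding decision_def j(1,3) using nb j(5) vS by blast
qed

lemma summary_push:
  assumes loc: "local_tables \<sigma>" and v: "v \<in> V" "rk v = i"
    and sum: "summary (Suc i) (joined_bad (Suc i) \<sigma>) (joined_rel (Suc i) \<sigma>)"
  shows "summary i (joined_bad i (push v \<sigma>)) (joined_rel i (push v \<sigma>))"
proof -
  let ?B = "joined_bad (Suc i) \<sigma>" and ?R = "joined_rel (Suc i) \<sigma>"
  have main: "joined_bad i (push v \<sigma>) S = elim_bad v ?B ?R S \<and> joined_rel i (push v \<sigma>) S \<subseteq> S \<times> S \<and>
     (\<not> elim_bad v ?B ?R S \<longrightarrow> joined_rel i (push v \<sigma>) S = elim_rel v ?B ?R S)"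
    if S: "S \<subseteq> below i" for S
  proof -
    have vS: "v \<notin> S" using S v by (auto simp: below_def)
    note j = joined_Suc[OF loc v vS]
    let ?eb = "elim_bad v (fst \<sigma> v) (snd \<sigma> v) S" and ?er = "elim_rel v (fst \<sigma> v) (snd \<sigma> v) S"
    have par: "(\<exists>p \<in> below i. is_parent p v) \<or> N v = {}"
    proof (cases "N v = {}")
      case False
      have "rk ` N v \<subseteq> {..<rk v}" using N_sub[OF v(1)] by auto
      then have "finite (rk ` N v)" by (rule finite_subset) simp
      then have "Max (rk ` N v) \<in> rk ` N v" using False by (intro Max_in) auto
      then obtain p where p: "p \<in> N v" "rk p = Max (rk ` N v)" by auto
      then have "is_parent p v" using \<open>finite (rk ` N v)\<close> by (auto simp: is_parent_def)
      then show ?thesis using p N_sub[OF v(1)] v by (auto simp: below_def)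
    qed simp
    have root: "\<not> ?eb" "?er = {}" if "N v = {}"
      using elim_local(1)[OF loc v(1), of S "{}"] elim_bad_empty[OF loc v(1)] elim_rel_sub[OF loc v(1), of S] that
      by auto
    have pb: "joined_bad i (push v \<sigma>) S \<longleftrightarrow> joined_bad i \<sigma> S \<or> ?eb"
      using par root unfolding joined_bad_def push_def by auto
    have pr: "joined_rel i (push v \<sigma>) S = joined_rel i \<sigma> S \<union> ?er"
      using par root unfolding joined_rel_def push_def by (auto split: if_splits)
    have "?er \<subseteq> S \<times> S" using elim_rel_sub[OF loc v(1), of S] by auto
    then have sub: "joined_rel i (push v \<sigma>) S \<subseteq> S \<times> S" using pr j(5) by auto
    show ?thesis
    proof (cases "joined_bad i \<sigma> S")
      case True
      \<comment> \<open>A trace rejected by another table stays rejected whatever is decided at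
        \<open>v\<close>. The relation may then differ from \<open>elim_rel\<close>, which a summary
        permits.\<close>
      then have "elim_bad v ?B ?R S" using j vS by (simp add: elim_bad_def pick_def)
      then show ?thesis using pb True sub by simp
    next
      case False
      have d: "decision v ?B ?R S = decision v (fst \<sigma> v) (snd \<sigma> v) S"
        by (rule decision_joined[OF loc v S False])
      have e: "elim_bad v ?B ?R S = ?eb"
        using False vS j d unfolding elim_bad_def pick_def by simp
      moreover have "elim_rel v ?B ?R S = joined_rel i \<sigma> S \<union> ?er"
      proof (cases "decision v (fst \<sigma> v) (snd \<sigma> v) S")
        case True
        then show ?thesis using d j(3,5) vS unfolding elim_rel_def pick_def shortcut_def by auto
      next
        case False
        then show ?thesis using d j(4,5) vS unfolding elim_rel_def pick_def shortcut_def by auto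
      qed
      ultimately show ?thesis using pb pr False sub by simp
    qed
  qed
  show ?thesis
    using elim_summary[OF sum v] main unfolding summary_def by simp
qed

lemma summary_pushed:
  "j \<le> n \<Longrightarrow> summary (n - j) (joined_bad (n - j) (pushed j)) (joined_rel (n - j) (pushed j))"
proof (induction j)
  case (Suc j)
  then have "Suc (n - Suc j) = n - j" "n - 1 - j = n - Suc j" by auto
  then show ?case
    using Suc vert[of "n - Suc j"] summary_push[of "pushed j" "vert (n - Suc j)" "n - Suc j"] local_pushed[of j]
    by simp
qed (use summary_base in simp)

text \<open>Here \<open>\<sigma>\<close> is the state just before the elimination of
  \<open>v\<close>, when the tables of \<open>v\<close> have received the contributions of all its
  children. The two claims are the rules for labelling: joining a component that has begun earlier,
  and starting a new one.\<close>

theorem mec_step: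
  assumes v: "v \<in> V" and j: "j = n - 1 - rk v"
  defines "\<sigma> \<equiv> pushed j"
  shows "mec V E Rnd M \<Longrightarrow> M \<inter> below (rk v) \<noteq> {} \<Longrightarrow>
      v \<in> M \<longleftrightarrow> decision v (fst \<sigma> v) (snd \<sigma> v) (M \<inter> below (rk v))"
    and "(\<And>M. mec V E Rnd M \<Longrightarrow> v \<in> M \<Longrightarrow> M \<inter> below (rk v) = {}) \<Longrightarrow>
      (\<exists>M. mec V E Rnd M \<and> v \<in> M) \<longleftrightarrow> \<not> fst \<sigma> v {v}"
proof -
  have jn: "n - j = Suc (rk v)" "j \<le> n" using j rk_less[OF v] by auto
  have sum: "summary (Suc (rk v)) (joined_bad (Suc (rk v)) \<sigma>) (joined_rel (Suc (rk v)) \<sigma>)"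
    using summary_pushed[OF jn(2)] unfolding jn \<sigma>_def .
  have loc: "local_tables \<sigma>" using local_pushed[OF jn(2)] by (simp add: \<sigma>_def)
  {
    assume M: "mec V E Rnd M" and ne: "M \<inter> below (rk v) \<noteq> {}"
    let ?S = "M \<inter> below (rk v)"
    have sup: "supported (Suc (rk v)) M"
      using M ne unfolding mec_def ec_def supported_def below_Suc[OF v] by blast
    have "M \<inter> below (Suc (rk v)) \<subseteq> below (Suc (rk v))" by auto
    then have "\<not> joined_bad (Suc (rk v)) \<sigma> (M \<inter> below (Suc (rk v)))"
      using sum sup unfolding summary_def by blast
    moreover have "v \<notin> ?S" by (simp add: not_in_below)
    moreover have "M \<inter> below (Suc (rk v)) = ?S \<or> M \<inter> below (Suc (rk v)) = insert v ?S"
      using below_Suc[OF v] by auto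
    \<comment> \<open>The trace of an end-component is not bad one level higher, so no table other
      than that of \<open>v\<close> rejects it; only then is the global decision the local
      one.\<close>
    ultimately have "\<not> joined_bad (rk v) \<sigma> ?S" using joined_Suc(1,2)[OF loc v refl, of ?S] by metis
    then show "v \<in> M \<longleftrightarrow> decision v (fst \<sigma> v) (snd \<sigma> v) ?S"
      using mec_decision[OF sum v refl M ne] decision_joined[OF loc v refl, of ?S] by simp
  }
  {
    assume new: "\<And>M. mec V E Rnd M \<Longrightarrow> v \<in> M \<Longrightarrow> M \<inter> below (rk v) = {}"
    have "fst \<sigma> u {} = False" if "u \<in> below (rk v)" for u
      using that local_tablesD(4)[OF loc] by (auto simp: below_def)
    then have "\<not> joined_bad (rk v) \<sigma> {}" by (simp add: joined_bad_def)
    then have "joined_bad (Suc (rk v)) \<sigma> {v} = fst \<sigma> v {v}"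
      using joined_Suc(1)[OF loc v refl, of "{}"] by simp
    then show "(\<exists>M. mec V E Rnd M \<and> v \<in> M) \<longleftrightarrow> \<not> fst \<sigma> v {v}"
      using mec_start[OF sum v refl new] by simp
  }
qed

end

section \<open>Orders of the nodes of a tree\<close>

lemma pawalk_verts_conv: "pcas u p v \<Longrightarrow> pawalk_verts u p = u # map snd p"
  by (induction p arbitrary: u) auto

lemma pawalk_suffix:
  assumes "pcas c p b" "a \<in> set (pawalk_verts c p)" "distinct (pawalk_verts c p)"
  shows "\<exists>q. pcas a q b \<and> set q \<subseteq> set p \<and> distinct (pawalk_verts a q)"
  using assms
proof (induction p arbitrary: c)
  case (Cons e p)
  show ?case
  proof (cases "a = c")
    case True
    then show ?thesis using Cons.prems by (intro exI[of _ "e # p"]) auto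
  next
    case False
    then have "a \<in> set (pawalk_verts (snd e) p)" using Cons.prems by auto
    then show ?thesis using Cons.IH[of "snd e"] Cons.prems by auto
  qed
qed auto

text \<open>A walk is extended at its front; whenever the new vertex already occurs, the walk is cut
  back to the suffix that starts there.\<close>

lemma rtrancl_simple_walk:
  assumes "(a, b) \<in> R\<^sup>*"
  shows "\<exists>p. pcas a p b \<and> set p \<subseteq> R \<and> distinct (pawalk_verts a p)"
  using assms
proof (induction rule: converse_rtrancl_induct)
  case base
  show ?case by (intro exI[of _ "[]"]) auto
next
  case (step a c)
  then obtain p where p: "pcas c p b" "set p \<subseteq> R" "distinct (pawalk_verts c p)" by auto
  show ?case
  proof (cases "a \<in> set (pawalk_verts c p)")
    case True
    then show ?thesis using pawalk_suffix[OF p(1) True p(3)] p(2) by blast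
  next
    case False
    then show ?thesis using p step.hyps by (intro exI[of _ "(a, c) # p"]) auto
  qed
qed

lemma pawalk_verts_sub:
  "pcas u p v \<Longrightarrow> u \<in> S \<Longrightarrow> set p \<subseteq> S \<times> S \<Longrightarrow> set (pawalk_verts u p) \<subseteq> S"
  by (auto simp: pawalk_verts_conv)

lemma reachable_rtrancl:
  "reachable H u v \<Longrightarrow> (u, v) \<in> (arcs_ends H \<inter> verts H \<times> verts H)\<^sup>*"
  unfolding reachable_def
  by (induction rule: rtrancl_on_induct) (auto intro: rtrancl_into_rtrancl)

lemma rtrancl_reachable:
  assumes "(u, v) \<in> (arcs_ends H \<inter> verts H \<times> verts H)\<^sup>*" "u \<in> verts H"
  shows "reachable H u v"
  using assms unfolding reachable_def
  by (induction rule: rtrancl_induct) (auto intro: rtrancl_on_into_rtrancl_on)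

text \<open>The outcome of any graph search on the tree: each node but the first has an earlier
  neighbour, which turns out to be unique and serves as its parent.\<close>

locale tree_order =
  fixes T :: "'a pair_pre_digraph" and f :: "nat \<Rightarrow> 'a" and b :: nat
  assumes tree: "undirected_tree T"
    and bij: "bij_betw f {..<b} (pverts T)"
    and earlier: "x < b \<Longrightarrow> 0 < x \<Longrightarrow> \<exists>y < x. (f y, f x) \<in> parcs T"
begin

lemma graph: "pair_graph T"
  using tree by (simp add: undirected_tree_def)

lemma arcs_sym: "(u, v) \<in> parcs T \<Longrightarrow> (v, u) \<in> parcs T"
proof -
  interpret pair_graph T by (rule graph)
  show "(u, v) \<in> parcs T \<Longrightarrow> (v, u) \<in> parcs T"
    using pair_sym_arcs unfolding symmetric_def by (auto dest: symD)
qed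

lemma arcs_verts: "(u, v) \<in> parcs T \<Longrightarrow> u \<in> pverts T \<and> v \<in> pverts T \<and> u \<noteq> v"
proof -
  interpret pair_graph T by (rule graph)
  show "(u, v) \<in> parcs T \<Longrightarrow> u \<in> pverts T \<and> v \<in> pverts T \<and> u \<noteq> v"
    using in_arcsD1 in_arcsD2 pair_no_loops by fastforce
qed

lemma f_inj: "x < b \<Longrightarrow> y < b \<Longrightarrow> f x = f y \<Longrightarrow> x = y"
  using bij by (auto simp: bij_betw_def inj_on_def)

lemma f_verts: "x < b \<Longrightarrow> f x \<in> pverts T"
  using bij by (auto simp: bij_betw_def)

lemma f_surj: "X \<in> pverts T \<Longrightarrow> \<exists>x < b. X = f x"
  using bij by (auto simp: bij_betw_def)

lemma reachable_earlier:
  assumes "x \<le> b" "z < x"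
  shows "(f 0, f z) \<in> (parcs T \<inter> f ` {..<x} \<times> f ` {..<x})\<^sup>* \<and> (f z, f 0) \<in> (parcs T \<inter> f ` {..<x} \<times> f ` {..<x})\<^sup>*"
  using assms(2)
proof (induction z rule: less_induct)
  case (less z)
  show ?case
  proof (cases "z = 0")
    case False
    then obtain y where y: "y < z" "(f y, f z) \<in> parcs T" using earlier[of z] less.prems assms(1) by auto
    let ?R = "parcs T \<inter> f ` {..<x} \<times> f ` {..<x}"
    have "(f y, f z) \<in> ?R" "(f z, f y) \<in> ?R" using y less.prems arcs_sym by auto
    moreover have "(f 0, f y) \<in> ?R\<^sup>*" "(f y, f 0) \<in> ?R\<^sup>*" using less.IH[OF y(1)] y less.prems by auto
    ultimately show ?thesis by (meson rtrancl_into_rtrancl converse_rtrancl_into_rtrancl)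
  qed simp
qed

text \<open>The earlier nodes are connected among themselves, so two earlier neighbours of
  \<open>f x\<close> are joined by a simple walk that avoids \<open>f x\<close> and closes a cycle
  through it.\<close>

lemma earlier_unique:
  assumes x: "x < b" and y: "y < x" "(f y, f x) \<in> parcs T" and z: "z < x" "(f z, f x) \<in> parcs T"
  shows "y = z"
proof (rule ccontr)
  assume ne: "y \<noteq> z"
  let ?S = "f ` {..<x}"
  let ?R = "parcs T \<inter> ?S \<times> ?S"
  have "(f y, f z) \<in> ?R\<^sup>*"
    using reachable_earlier[of x y] reachable_earlier[of x z] x y z by (meson less_imp_le rtrancl_trans)
  then obtain p where p: "pcas (f y) p (f z)" "set p \<subseteq> ?R" "distinct (pawalk_verts (f y) p)"
    using rtrancl_simple_walk[of "f y" "f z" ?R] by auto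
  let ?q = "(f x, f y) # p @ [(f z, f x)]"
  have app: "pcas u p v \<Longrightarrow> pcas u (p @ [(v, w)]) w" for u v w :: 'a and p
    by (induction p arbitrary: u) auto
  have "pcas (f x) ?q (f x)" using app[OF p(1)] by simp
  moreover have "set ?q \<subseteq> parcs T" using p(2) y z arcs_sym by auto
  ultimately have walk: "pre_digraph.awalk (with_proj T) (f x) ?q (f x)"
    using f_verts[OF x] by (auto simp: pre_digraph.awalk_def cas_with_proj_eq)
  have "tl (pawalk_verts (f x) ?q) = pawalk_verts (f y) p @ [f x]"
    using pawalk_verts_conv[OF \<open>pcas (f x) ?q (f x)\<close>] pawalk_verts_conv[OF p(1)] by simp
  moreover have "f x \<notin> ?S"
  proof
    assume "f x \<in> ?S"
    then obtain c where "c < x" "f x = f c" by auto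
    then show False using f_inj[of x c] x by simp
  qed
  moreover have "set (pawalk_verts (f y) p) \<subseteq> ?S"
    by (rule pawalk_verts_sub[OF p(1)]) (use y(1) p(2) in blast)+
  ultimately have "distinct (tl (pawalk_verts (f x) ?q))" using p(3) by auto
  then have "pre_digraph.cycle (with_proj T) ?q"
    unfolding pre_digraph.cycle_def awalk_verts_with_proj_eq using walk by blast
  \<comment> \<open>As \<open>y\<close> and \<open>z\<close> differ, the walk has an arc. Together
    with the two arcs at \<open>f x\<close> the cycle reaches length 3 and is not one of the
    back-and-forth cycles that a tree admits.\<close>
  moreover have "p \<noteq> []" using p(1) f_inj[of y z] ne x y z by (cases p) auto
  then have "length ?q \<ge> 3" by (cases p) auto
  ultimately show False using tree unfolding undirected_tree_def by blast
qed

text \<open>Every arc joins a node with its parent, in one of two directions. This bounds the list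
  of links in terms of the number of bags.\<close>

lemma card_arcs: "card (parcs T) \<le> 2 * b"
proof -
  \<comment> \<open>At the first node the value is arbitrary; it merely adds pairs to a set that has
    to cover the arcs.\<close>
  define P where "P x = (SOME y. y < x \<and> (f y, f x) \<in> parcs T)" for x
  have P: "P x = y" if "x < b" "y < x" "(f y, f x) \<in> parcs T" for x y
  proof -
    have "P x < x \<and> (f (P x), f x) \<in> parcs T" unfolding P_def by (rule someI[of _ y]) (use that in auto)
    then show ?thesis using earlier_unique that by blast
  qed
  have "parcs T \<subseteq> (\<lambda>x. (f (P x), f x)) ` {..<b} \<union> (\<lambda>x. (f x, f (P x))) ` {..<b}"
  proof
    fix e assume e: "e \<in> parcs T"
    then obtain x y where xy: "e = (f x, f y)" "x < b" "y < b"
      using arcs_verts f_surj by (cases e) blast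
    then have "x \<noteq> y" using e arcs_verts by auto
    then consider "x < y" | "y < x" by linarith
    then show "e \<in> (\<lambda>x. (f (P x), f x)) ` {..<b} \<union> (\<lambda>x. (f x, f (P x))) ` {..<b}"
    proof cases
      case 1
      then show ?thesis using P[of y x] e xy by auto
    next
      case 2
      then show ?thesis using P[of x y] e xy arcs_sym by auto
    qed
  qed
  then have "card (parcs T) \<le> card ((\<lambda>x. (f (P x), f x)) ` {..<b} \<union> (\<lambda>x. (f x, f (P x))) ` {..<b})"
    by (intro card_mono) auto
  also have "\<dots> \<le> card ((\<lambda>x. (f (P x), f x)) ` {..<b}) + card ((\<lambda>x. (f x, f (P x))) ` {..<b})"
    by (rule card_Un_le)
  also have "\<dots> \<le> b + b" by (intro add_mono) (metis card_image_le card_lessThan finite_lessThan)+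
  finally show ?thesis by simp
qed

text \<open>
  If \<open>f x \<in> Q\<close> but its parent is not in \<open>Q\<close>, then the descendants of \<open>f x\<close> within \<open>Q\<close> are
  closed under steps inside \<open>Q\<close>, so \<open>Q\<close> has no node before \<open>f x\<close>.
\<close>

lemma connected_earlier:
  assumes Q: "Q \<subseteq> pverts T" and con: "Digraph_Component.connected (with_proj T \<restriction> Q)"
    and x: "x < b" "f x \<in> Q" and w: "w < x" "f w \<in> Q" and y: "y < x" "(f y, f x) \<in> parcs T"
  shows "f y \<in> Q"
proof (rule ccontr)
  assume out: "f y \<notin> Q"
  define R where "R = {(c, d). c < d \<and> d < b \<and> (f c, f d) \<in> parcs T \<and> f d \<in> Q}"
  define D where "D = {z. (x, z) \<in> R\<^sup>*}"
  have D: "x \<le> z \<and> z < b \<and> f z \<in> Q \<and> (z \<noteq> x \<longrightarrow> (\<exists>c \<in> D. c < z \<and> (f c, f z) \<in> parcs T))" if "z \<in> D" for z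
    using that unfolding D_def mem_Collect_eq
  proof (induction rule: rtrancl_induct)
    case (step c d)
    have "c < d" "d < b" "(f c, f d) \<in> parcs T" "f d \<in> Q"
      using step.hyps by (auto simp: R_def)
    then show ?case using step by (intro conjI impI bexI[of _ c]) auto
  qed (use x in auto)
  have "reachable (with_proj (mk_symmetric (with_proj T \<restriction> Q))) (f x) (f w)"
    using con x w unfolding Digraph_Component.connected_def strongly_connected_def
    by (auto simp: mk_symmetric_def)
  from reachable_rtrancl[OF this] have "(f x, f w) \<in> (parcs T \<inter> Q \<times> Q)\<^sup>*"
    by (rule rtrancl_mono[THEN subsetD, rotated]) (auto simp: mk_symmetric_def intro: arcs_sym)
  then have "\<exists>z \<in> D. f w = f z"
  proof (induction rule: rtrancl_induct)
    case base
    show ?case by (auto simp: D_def)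
  next
    case (step c d)
    then obtain z where z: "z \<in> D" "c = f z" by auto
    obtain u where u: "d = f u" "u < b" using step.hyps Q f_surj by blast
    have arc: "(f z, f u) \<in> parcs T" "f u \<in> Q" using step.hyps z u by auto
    then have "z \<noteq> u" using arcs_verts by blast
    show ?case
    proof (cases "z < u")
      case True
      then have "(z, u) \<in> R" using arc u by (simp add: R_def)
      then have "u \<in> D" using z by (auto simp: D_def)
      then show ?thesis using u by auto
    next
      case False
      then have u': "u < z" "(f u, f z) \<in> parcs T" using \<open>z \<noteq> u\<close> arc arcs_sym by auto
      show ?thesis
      proof (cases "z = x")
        case True
        then have "u = y" using earlier_unique[OF x(1) _ _ y] u' by blast
        then show ?thesis using out arc by simp
      next
        case False
        then obtain c where "c \<in> D" "c < z" "(f c, f z) \<in> parcs T" using D[OF z(1)] by blast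
        then show ?thesis using earlier_unique[of z c u] u' D[OF z(1)] u by blast
      qed
    qed
  qed
  then obtain z where "z \<in> D" "f w = f z" by auto
  then show False using D[of z] f_inj[of w z] w x by auto
qed

end

section \<open>The algorithm\<close>

abbreviation plus_e (infixl "[+]" 65) where "a [+] b \<equiv> Op Plus a b"
abbreviation minus_e (infixl "[-]" 65) where "a [-] b \<equiv> Op Minus a b"
abbreviation times_e (infixl "[*]" 70) where "a [*] b \<equiv> Op Times a b"
abbreviation div_e (infixl "[div]" 70) where "a [div] b \<equiv> Op Div a b"
abbreviation mod_e (infixl "[mod]" 70) where "a [mod] b \<equiv> Op Mod a b"
abbreviation less_e (infix "[<]" 50) where "a [<] b \<equiv> Op Less a b"
abbreviation equal_e (infix "[=]" 50) where "a [=] b \<equiv> Op Equal a b"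
abbreviation assign (infix "::=" 45) where "x ::= e \<equiv> PWrite x (Const 0) e"
abbreviation seq (infixr ";;" 40) where "p ;; q \<equiv> PSeq p q"
abbreviation "when e p \<equiv> PIf e p PSkip"

definition "bag_size i = Read ''bag_start'' (i [+] Const 1) [-] Read ''bag_start'' i"
definition "bit_e m a = (m [div] Read ''pw'' a) [mod] Const 2"
text \<open>Row-major addresses: \<open>cell2\<close> numbers the rows of all tables, with
  \<open>P\<close> masks per vertex. In \<open>cell4\<close> such a row number takes the place of
  the vertex in \<open>cell3\<close>.\<close>

definition "cell2 v m = v [*] Var ''P'' [+] m"
definition "cell3 v a b = (v [*] Var ''D'' [+] a) [*] Var ''D'' [+] b"
definition "cell4 v m a b = cell3 (cell2 v m) a b"
definition "nbr v a = Read ''nbr'' (v [*] Var ''D'' [+] a)"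

definition max_bag :: prog where
  "max_bag = PFor ''i'' (Var ''num_bags'')
     (when (Var ''D'' [<] bag_size (Var ''i'')) (''D'' ::= bag_size (Var ''i'')))"

text \<open>Only slow assignments are available, hence a number is doubled by counting.\<close>

definition powers :: prog where
  "powers = (PWrite ''pw'' (Const 0) (Const 1) ;; ''P'' ::= Const 1 ;;
     PFor ''i'' (Var ''D'')
      (''Q'' ::= Const 0 ;;
       PFor ''j'' (Var ''P'') (''Q'' ::= Var ''Q'' [+] Const 1 ;; ''Q'' ::= Var ''Q'' [+] Const 1) ;;
       ''P'' ::= Var ''Q'' ;;
       PWrite ''pw'' (Var ''i'' [+] Const 1) (Var ''P'')))"

definition adjacency :: prog where
  "adjacency = PFor ''i'' (Var ''num_links'')
     (PWrite ''next'' (Var ''i'') (Read ''first'' (Read ''link_fst'' (Var ''i''))) ;;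
      PWrite ''first'' (Read ''link_fst'' (Var ''i'')) (Var ''i'' [+] Const 1))"

text \<open>
  The breadth-first search is a single loop: each iteration either inspects one link or advances
  \<open>cur\<close> to the next bag of the queue \<open>order\<close>. Pointers into lists of links are shifted by 1,
  with 0 for the end of the list.
\<close>

definition traversal :: prog where
  "traversal = (PWrite ''seen'' (Const 0) (Const 1) ;; ''tail'' ::= Const 1 ;;
     ''e'' ::= Read ''first'' (Const 0) ;;
     PFor ''i'' (Var ''num_links'' [+] Var ''num_bags'')
      (PIf (Var ''e'')
        (''t'' ::= Read ''link_snd'' (Var ''e'' [-] Const 1) ;;
         when (Read ''seen'' (Var ''t'') [=] Const 0)
          (PWrite ''seen'' (Var ''t'') (Const 1) ;;
           PWrite ''order'' (Var ''tail'') (Var ''t'') ;;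
           ''tail'' ::= Var ''tail'' [+] Const 1) ;;
         ''e'' ::= Read ''next'' (Var ''e'' [-] Const 1))
        (when (Var ''cur'' [+] Const 1 [<] Var ''tail'')
          (''cur'' ::= Var ''cur'' [+] Const 1 ;;
           ''e'' ::= Read ''first'' (Read ''order'' (Var ''cur''))))))"

text \<open>
  The vertices of \<open>insert v (N v)\<close> receive different colours below \<open>D\<close>, the largest size of a bag. A set
  of them is represented by its mask, the sum of the powers of 2 of its colours; \<open>nbr\<close> maps a
  colour back to the vertex, shifted by 1.
\<close>

definition scan_bag :: prog where
  "scan_bag = (''best'' ::= Const 0 ;;
     PFor ''l'' (Var ''D'') (when (Var ''l'' [<] Var ''len'')
      (''u'' ::= Read ''bag'' (Var ''lo'' [+] Var ''l'') ;;
       when (Read ''rank'' (Var ''u''))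
        (PWrite ''nbr'' (Var ''v'' [*] Var ''D'' [+] Read ''col'' (Var ''u'')) (Var ''u'' [+] Const 1) ;;
         when (Var ''best'' [<] Read ''rank'' (Var ''u''))
          (''best'' ::= Read ''rank'' (Var ''u'') ;;
           PWrite ''par'' (Var ''v'') (Var ''u'' [+] Const 1))))))"

definition choose_colour :: prog where
  "choose_colour = PFor ''l'' (Var ''D'')
     (when (nbr (Var ''v'') (Var ''l'') [=] Const 0) (PWrite ''col'' (Var ''v'') (Var ''l'')))"

definition rank_vertex :: prog where
  "rank_vertex = (scan_bag ;; choose_colour ;;
     PWrite ''vert'' (Var ''r'') (Var ''v'') ;;
     ''r'' ::= Var ''r'' [+] Const 1 ;;
     PWrite ''rank'' (Var ''v'') (Var ''r''))"

text \<open>The loop runs up to \<open>D\<close> under a guard instead of up to \<open>len\<close>: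
  the time of this part is computed from loop bounds that the program does not overwrite.\<close>

definition rank_bag :: prog where
  "rank_bag = (''B'' ::= Read ''order'' (Var ''i'') ;;
     ''lo'' ::= Read ''bag_start'' (Var ''B'') ;;
     ''len'' ::= bag_size (Var ''B'') ;;
     PFor ''j'' (Var ''D'') (when (Var ''j'' [<] Var ''len'')
      (''v'' ::= Read ''bag'' (Var ''lo'' [+] Var ''j'') ;;
       when (Read ''rank'' (Var ''v'') [=] Const 0) rank_vertex)))"

definition ranking :: prog where
  "ranking = PFor ''i'' (Var ''num_bags'') rank_bag"

definition own_arcs_table :: prog where
  "own_arcs_table = PFor ''i'' (Var ''num_arcs'')
     (''x'' ::= Read ''arc_tail'' (Var ''i'') ;; ''y'' ::= Read ''arc_head'' (Var ''i'') ;;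
      PIf (Read ''rank'' (Var ''x'') [<] Read ''rank'' (Var ''y'')) (''v'' ::= Var ''y'') (''v'' ::= Var ''x'') ;;
      PWrite ''adj'' (cell3 (Var ''v'') (Read ''col'' (Var ''x'')) (Read ''col'' (Var ''y''))) (Const 1) ;;
      when (Read ''is_random'' (Var ''x''))
       (PWrite ''ran'' (cell3 (Var ''v'') (Read ''col'' (Var ''x'')) (Read ''col'' (Var ''y''))) (Const 1)))"

definition base_cell :: prog where
  "base_cell = PFor ''a'' (Var ''D'') (when (bit_e (Var ''m'') (Var ''a''))
     (PFor ''b'' (Var ''D'')
       (PIf (bit_e (Var ''m'') (Var ''b''))
         (when (Read ''adj'' (cell3 (Var ''v'') (Var ''a'') (Var ''b'')))
           (PWrite ''rel'' (cell4 (Var ''v'') (Var ''m'') (Var ''a'') (Var ''b'')) (Const 1)))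
         (when (Read ''ran'' (cell3 (Var ''v'') (Var ''a'') (Var ''b'')))
           (PWrite ''bad'' (cell2 (Var ''v'') (Var ''m'')) (Const 1))))))"

definition base_tables :: prog where
  "base_tables = PFor ''v'' (Var ''n'') (PFor ''m'' (Var ''P'') base_cell)"

text \<open>\<open>P - (P - x)\<close> is \<open>x\<close> for masks \<open>x\<close>; written in this way, the assignment is slow.\<close>

definition decide :: prog where
  "decide = (''m0'' ::= Var ''m'' [-] bit_e (Var ''m'') (Var ''c'') [*] Read ''pw'' (Var ''c'') ;;
     ''m1'' ::= Var ''P'' [-] (Var ''P'' [-] (Var ''m0'' [+] Read ''pw'' (Var ''c''))) ;;
     ''out'' ::= Const 0 ;; ''inn'' ::= Const 0 ;;
     PFor ''a'' (Var ''D'') (when (bit_e (Var ''m0'') (Var ''a''))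
      (when (Read ''rel'' (cell4 (Var ''v'') (Var ''m1'') (Var ''c'') (Var ''a''))) (''out'' ::= Const 1) ;;
       when (Read ''rel'' (cell4 (Var ''v'') (Var ''m1'') (Var ''a'') (Var ''c''))) (''inn'' ::= Const 1))) ;;
     ''mm'' ::= Var ''m0'' ;;
     when (Read ''bad'' (cell2 (Var ''v'') (Var ''m1'')) [=] Const 0) (when (Var ''out'') (when (Var ''inn'')
      (''mm'' ::= Var ''m1'' ;; PWrite ''dec'' (cell2 (Var ''v'') (Var ''m'')) (Const 1)))))"

definition push_rel :: prog where
  "push_rel = PFor ''a'' (Var ''D'') (PFor ''b'' (Var ''D'')
     (PIf (Var ''a'' [=] Var ''c'') PSkip (PIf (Var ''b'' [=] Var ''c'') PSkip
       (PIf (Read ''rel'' (cell4 (Var ''v'') (Var ''mm'') (Var ''a'') (Var ''b'')))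
         (PWrite ''rel'' (cell4 (Var ''p'') (Var ''m'') (Var ''a'') (Var ''b'')) (Const 1))
         (when (Read ''rel'' (cell4 (Var ''v'') (Var ''mm'') (Var ''a'') (Var ''c'')))
           (when (Read ''rel'' (cell4 (Var ''v'') (Var ''mm'') (Var ''c'') (Var ''b'')))
             (PWrite ''rel'' (cell4 (Var ''p'') (Var ''m'') (Var ''a'') (Var ''b'')) (Const 1))))))))"

definition push_mask :: prog where
  "push_mask = (decide ;;
     when (Read ''par'' (Var ''v''))
      (''p'' ::= Read ''par'' (Var ''v'') [-] Const 1 ;;
       when (Read ''bad'' (cell2 (Var ''v'') (Var ''mm''))) (PWrite ''bad'' (cell2 (Var ''p'') (Var ''m'')) (Const 1)) ;;
       push_rel))"

definition push_vertex :: prog where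
  "push_vertex = (''v'' ::= Read ''vert'' (Var ''n'' [-] Const 1 [-] Var ''i'') ;;
     ''c'' ::= Read ''col'' (Var ''v'') ;;
     PWrite ''alone'' (Var ''v'') (Read ''bad'' (cell2 (Var ''v'') (Read ''pw'' (Var ''c''))) [=] Const 0) ;;
     PFor ''m'' (Var ''P'') push_mask)"

definition pushing :: prog where
  "pushing = PFor ''i'' (Var ''n'') push_vertex"

definition label_mask :: prog where
  "label_mask = (''m'' ::= Const 0 ;;
     PFor ''b'' (Var ''D'') (when (nbr (Var ''v'') (Var ''b''))
      (when (Read ''mec'' (nbr (Var ''v'') (Var ''b'') [-] Const 1) [=] Var ''x'')
        (''m'' ::= Var ''P'' [-] (Var ''P'' [-] (Var ''m'' [+] Read ''pw'' (Var ''b'')))))))"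

text \<open>The entry \<open>mec[v]\<close> may be written during the loop because \<open>v\<close>
  does not occur in its own row of \<open>nbr\<close>, so that the masks computed afterwards are not
  affected. Building one mask per neighbour costs \<open>O(D^2)\<close> in total.\<close>

definition label_vertex :: prog where
  "label_vertex = (''v'' ::= Read ''vert'' (Var ''i'') ;;
     PFor ''a'' (Var ''D'') (when (nbr (Var ''v'') (Var ''a''))
      (''x'' ::= Read ''mec'' (nbr (Var ''v'') (Var ''a'') [-] Const 1) ;;
       when (Var ''x'')
        (label_mask ;; when (Read ''dec'' (cell2 (Var ''v'') (Var ''m''))) (PWrite ''mec'' (Var ''v'') (Var ''x''))))) ;;
     when (Read ''mec'' (Var ''v'') [=] Const 0)
      (when (Read ''alone'' (Var ''v'')) (PWrite ''mec'' (Var ''v'') (Var ''v'' [+] Const 1))))"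

definition labelling :: prog where
  "labelling = PFor ''i'' (Var ''n'') label_vertex"

definition main_part :: prog where
  "main_part = (adjacency ;; traversal ;; ranking ;; own_arcs_table ;; base_tables ;; pushing ;; labelling)"

definition mec_prog :: prog where
  "mec_prog = (max_bag ;; powers ;; main_part)"

lemmas expr_defs = bag_size_def bit_e_def cell2_def cell3_def cell4_def nbr_def

lemmas prog_defs = max_bag_def powers_def adjacency_def traversal_def scan_bag_def choose_colour_def
  rank_vertex_def rank_bag_def ranking_def own_arcs_table_def base_cell_def base_tables_def decide_def
  push_rel_def push_mask_def push_vertex_def pushing_def label_mask_def label_vertex_def labelling_def
  main_part_def mec_prog_def

section \<open>Traversal of the tree\<close>

lemma max_bag_spec:
  fixes s :: store
  defines "sz \<equiv> \<lambda>i. s ''bag_start'' (Suc i) - s ''bag_start'' i"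
  assumes "s ''D'' 0 = 0"
  shows "(\<forall>i < s ''num_bags'' 0. sz i \<le> sem max_bag s ''D'' 0) \<and>
    (sem max_bag s ''D'' 0 = 0 \<or> (\<exists>i < s ''num_bags'' 0. sem max_bag s ''D'' 0 = sz i))"
proof -
  let ?I = "\<lambda>i (t :: store). (\<forall>j < i. sz j \<le> t ''D'' 0) \<and> (t ''D'' 0 = 0 \<or> (\<exists>j < i. t ''D'' 0 = sz j))"
  have "?I (val (Var ''num_bags'') s) (sem max_bag s)"
    unfolding max_bag_def
  proof (rule sem_For[where I = ?I], goal_cases)
    case 1
    show ?case using assms by (simp add: upd_apply)
  next
    case (2 i t)
    have "t ''bag_start'' = s ''bag_start''" by (rule 2(4)) simp
    then have v: "val (bag_size (Var ''i'')) t = sz i" by (simp add: bag_size_def sz_def 2(3))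
    show ?case
    proof (cases "t ''D'' 0 < sz i")
      case True
      then show ?thesis using 2(2) by (auto simp: upd_apply v less_Suc_eq)
    next
      case False
      then show ?thesis using 2(2) by (auto simp: upd_apply v less_Suc_eq)
    qed
  qed
  then show ?thesis by simp
qed

lemma double_loop:
  "t ''Q'' 0 = 0 \<Longrightarrow>
    sem (PFor ''j'' (Var ''P'') (''Q'' ::= Var ''Q'' [+] Const 1 ;; ''Q'' ::= Var ''Q'' [+] Const 1)) t ''Q'' 0 = 2 * t ''P'' 0"
  using sem_For[of "\<lambda>i t. t ''Q'' 0 = 2 * i" "''j''" t "Var ''P''"
      "''Q'' ::= Var ''Q'' [+] Const 1 ;; ''Q'' ::= Var ''Q'' [+] Const 1"]
  by (simp add: upd_apply)

definition power_step :: prog where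
  "power_step = (''Q'' ::= Const 0 ;;
       PFor ''j'' (Var ''P'') (''Q'' ::= Var ''Q'' [+] Const 1 ;; ''Q'' ::= Var ''Q'' [+] Const 1) ;;
       ''P'' ::= Var ''Q'' ;;
       PWrite ''pw'' (Var ''i'' [+] Const 1) (Var ''P''))"

lemma powers_eq:
  "powers = (PWrite ''pw'' (Const 0) (Const 1) ;; ''P'' ::= Const 1 ;; PFor ''i'' (Var ''D'') power_step)"
  by (simp add: powers_def power_step_def)

lemma power_step_spec:
  "sem power_step t ''P'' 0 = 2 * t ''P'' 0"
  "sem power_step t ''pw'' = (t ''pw'')(Suc (t ''i'' 0) := 2 * t ''P'' 0)"
proof -
  let ?p = "PFor ''j'' (Var ''P'') (''Q'' ::= Var ''Q'' [+] Const 1 ;; ''Q'' ::= Var ''Q'' [+] Const 1)"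
  have "sem ?p (upd ''Q'' 0 0 t) ''Q'' 0 = 2 * t ''P'' 0"
    by (subst double_loop) (simp_all add: upd_apply)
  moreover have "sem ?p (upd ''Q'' 0 0 t) y = t y" if "y \<notin> {''j'', ''Q''}" for y
    using that by (subst sem_frame) (auto simp: upd_apply)
  ultimately show "sem power_step t ''P'' 0 = 2 * t ''P'' 0"
    "sem power_step t ''pw'' = (t ''pw'')(Suc (t ''i'' 0) := 2 * t ''P'' 0)"
    by (simp_all add: power_step_def upd_apply del: sem.simps(5))
qed

lemma power_loop_invariant:
  defines "s' \<equiv> \<lambda>s. upd ''P'' 0 1 (upd ''pw'' 0 1 s)"
  assumes "i \<le> D"
  shows "loop (sem power_step) ''i'' i (s' s) ''P'' 0 = 2 ^ i \<and>
    (\<forall>j \<le> i. loop (sem power_step) ''i'' i (s' s) ''pw'' j = 2 ^ j)"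
  using assms(2)
proof (induction i)
  case 0
  then show ?case by (simp add: upd_apply s'_def)
next
  case (Suc i)
  then show ?case
    using loop_counter[of "sem power_step" "''i''" i "s' s"]
    by (auto simp: upd_apply power_step_spec le_Suc_eq)
qed

lemma powers_spec:
  "sem powers s ''P'' 0 = 2 ^ s ''D'' 0" "j \<le> s ''D'' 0 \<Longrightarrow> sem powers s ''pw'' j = 2 ^ j"
  using power_loop_invariant[of "s ''D'' 0" "s ''D'' 0" s]
  by (simp_all add: powers_eq upd_apply)

lemma time_double_loop:
  "time (PFor ''j'' (Var ''P'') (''Q'' ::= Var ''Q'' [+] Const 1 ;; ''Q'' ::= Var ''Q'' [+] Const 1)) t
    = 10 + 26 * t ''P'' 0"
  by simp

text \<open>The bound \<open>P\<close> of the inner loop changes during the program, so the static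
  estimate does not apply. The exact time is a geometric sum, of the order of the last
  power.\<close>

lemma time_powers: "time powers s \<le> 100 * 2 ^ s ''D'' 0"
proof -
  let ?D = "s ''D'' 0"
  let ?s = "upd ''P'' 0 1 (upd ''pw'' 0 1 s)"
  have step: "time power_step t = 26 * t ''P'' 0 + 27" for t
    unfolding power_step_def time.simps(3) time_double_loop by (simp add: upd_apply)
  have "time powers s = 18 + (\<Sum>i<?D. 13 + time power_step (loop (sem power_step) ''i'' i ?s))"
    by (simp add: powers_eq upd_apply)
  also have "(\<Sum>i<?D. 13 + time power_step (loop (sem power_step) ''i'' i ?s)) = (\<Sum>i<?D. 40 + 26 * 2 ^ i)"
    using power_loop_invariant[of _ ?D s] by (intro sum.cong) (auto simp: step)
  also have "\<dots> \<le> (\<Sum>i<?D. 66 * 2 ^ i)" by (intro sum_mono) simp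
  also have "\<dots> = 66 * (2 ^ ?D - 1)"
    by (simp add: sum_distrib_left[symmetric] lessThan_atLeast0 sum_power2)
  finally have "time powers s \<le> 18 + 66 * (2 ^ ?D - 1)" by simp
  moreover have "1 \<le> (2 :: nat) ^ ?D" by simp
  ultimately show ?thesis by linarith
qed

section \<open>Adjacency lists and the search through the tree\<close>

primrec chain :: "(nat \<Rightarrow> nat) \<Rightarrow> nat \<Rightarrow> nat list \<Rightarrow> bool" where
  "chain next h [] \<longleftrightarrow> h = 0"
| "chain next h (e # es) \<longleftrightarrow> h = Suc e \<and> chain next (next e) es"

lemma chain_upd: "e \<notin> set es \<Longrightarrow> chain (next(e := x)) h es = chain next h es"
  by (induction es arbitrary: h) auto

lemma chain_zero: "chain next h es \<Longrightarrow> h = 0 \<longleftrightarrow> es = []"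
  by (cases es) auto

text \<open>Reversed because \<open>adjacency\<close> inserts each link at the head of its
  list.\<close>

definition links_from :: "(nat \<Rightarrow> nat) \<Rightarrow> nat \<Rightarrow> nat \<Rightarrow> nat list" where
  "links_from src L b = rev (filter (\<lambda>e. src e = b) [0..<L])"

lemma links_from_Suc:
  "links_from src (Suc L) b = (if src L = b then L # links_from src L b else links_from src L b)"
  by (simp add: links_from_def)

lemma set_links_from: "set (links_from src L b) = {e. e < L \<and> src e = b}"
  by (auto simp: links_from_def)

lemma adjacency_spec:
  assumes "s ''first'' = (\<lambda>_. 0)"
  shows "chain (sem adjacency s ''next'') (sem adjacency s ''first'' b)
    (links_from (s ''link_fst'') (s ''num_links'' 0) b)"
proof -
  let ?I = "\<lambda>i (t :: store). \<forall>b. chain (t ''next'') (t ''first'' b) (links_from (s ''link_fst'') i b)"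
  have "?I (val (Var ''num_links'') s) (sem adjacency s)"
    unfolding adjacency_def
  proof (rule sem_For[where I = ?I], goal_cases)
    case 1
    show ?case using assms by (simp add: upd_apply links_from_def)
  next
    case (2 i t)
    have "t ''link_fst'' = s ''link_fst''" by (rule 2(4)) simp
    then show ?case using 2(2,3)
      by (auto simp: upd_apply links_from_Suc chain_upd chain_upd[unfolded fun_upd_def] set_links_from)
  qed
  then show ?thesis by simp
qed

lemma sum_length_links_from:
  assumes "\<And>e. e < L \<Longrightarrow> src e < b"
  shows "(\<Sum>x<b. length (links_from src L x)) = L"
proof -
  have "length (links_from src L x) = card {e. e < L \<and> src e = x}" for x
    using distinct_card[of "links_from src L x"] by (simp add: set_links_from) (simp add: links_from_def)
  then have "(\<Sum>x<b. length (links_from src L x)) = (\<Sum>x<b. card {e. e < L \<and> src e = x})" by simp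
  also have "\<dots> = card (\<Union>x<b. {e. e < L \<and> src e = x})"
    by (rule card_UN_disjoint[symmetric]) auto
  also have "(\<Union>x<b. {e. e < L \<and> src e = x}) = {..<L}" using assms by auto
  finally show ?thesis by simp
qed

definition traversal_step :: prog where
  "traversal_step = PIf (Var ''e'')
        (''t'' ::= Read ''link_snd'' (Var ''e'' [-] Const 1) ;;
         when (Read ''seen'' (Var ''t'') [=] Const 0)
          (PWrite ''seen'' (Var ''t'') (Const 1) ;;
           PWrite ''order'' (Var ''tail'') (Var ''t'') ;;
           ''tail'' ::= Var ''tail'' [+] Const 1) ;;
         ''e'' ::= Read ''next'' (Var ''e'' [-] Const 1))
        (when (Var ''cur'' [+] Const 1 [<] Var ''tail'')
          (''cur'' ::= Var ''cur'' [+] Const 1 ;;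
           ''e'' ::= Read ''first'' (Read ''order'' (Var ''cur''))))"

lemma traversal_eq:
  "traversal = (PWrite ''seen'' (Const 0) (Const 1) ;; ''tail'' ::= Const 1 ;;
     ''e'' ::= Read ''first'' (Const 0) ;;
     PFor ''i'' (Var ''num_links'' [+] Var ''num_bags'') traversal_step)"
  by (simp add: traversal_def traversal_step_def)

locale link_lists =
  fixes L nb :: nat and src dst nx fs :: "nat \<Rightarrow> nat"
  assumes chains: "chain nx (fs b) (links_from src L b)"
    and src: "l < L \<Longrightarrow> src l < nb" and dst: "l < L \<Longrightarrow> dst l < nb"
begin

definition links :: "nat rel" where
  "links = {(src l, dst l) | l. l < L}"

text \<open>The last line is a clock: unless the search is exhausted, the iteration number equals
  the number of advances of \<open>cur\<close> plus the number of inspected links. It shows that a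
  fixed number of iterations suffices.\<close>

definition traversal_inv ::
  "nat \<Rightarrow> (nat \<Rightarrow> nat) \<Rightarrow> (nat \<Rightarrow> nat) \<Rightarrow> nat \<Rightarrow> nat \<Rightarrow> nat \<Rightarrow> bool" where
  "traversal_inv i seen qu len cur e \<longleftrightarrow> (\<exists>pre es.
     links_from src L (qu cur) = pre @ es \<and> chain nx e es \<and> (\<forall>l \<in> set pre. seen (dst l) \<noteq> 0) \<and>
     (\<forall>x < cur. \<forall>l < L. src l = qu x \<longrightarrow> seen (dst l) \<noteq> 0) \<and> cur < len \<and>
     inj_on qu {..<len} \<and> qu ` {..<len} \<subseteq> {..<nb} \<and> qu 0 = 0 \<and>
     (\<forall>b. seen b \<noteq> 0 \<longleftrightarrow> b \<in> qu ` {..<len}) \<and>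
     (\<forall>x < len. 0 < x \<longrightarrow> (\<exists>y < x. (qu y, qu x) \<in> links)) \<and>
     (e = 0 \<and> Suc cur = len \<or> i = cur + (\<Sum>x<cur. length (links_from src L (qu x))) + length pre))"

lemma inv_init:
  assumes "0 < nb"
  shows "traversal_inv 0 ((\<lambda>_. 0)(0 := 1)) (\<lambda>_. 0) 1 0 (fs 0)"
  unfolding traversal_inv_def
  by (rule exI[of _ "[]"], rule exI[of _ "links_from src L 0"]) (use assms chains in \<open>auto simp: inj_on_def\<close>)

lemma inv_old:
  assumes "traversal_inv i seen qu len cur (Suc l)" "seen (dst l) \<noteq> 0"
  shows "traversal_inv (Suc i) seen qu len cur (nx l)"
proof -
  obtain pre es where *: "links_from src L (qu cur) = pre @ es" "chain nx (Suc l) es"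
    "\<forall>l \<in> set pre. seen (dst l) \<noteq> 0"
    "\<forall>x < cur. \<forall>l < L. src l = qu x \<longrightarrow> seen (dst l) \<noteq> 0" "cur < len"
    "inj_on qu {..<len}" "qu ` {..<len} \<subseteq> {..<nb}" "qu 0 = 0"
    "\<forall>b. seen b \<noteq> 0 \<longleftrightarrow> b \<in> qu ` {..<len}"
    "\<forall>x < len. 0 < x \<longrightarrow> (\<exists>y < x. (qu y, qu x) \<in> links)"
    "i = cur + (\<Sum>x<cur. length (links_from src L (qu x))) + length pre"
    using assms(1) unfolding traversal_inv_def by auto
  then obtain es' where es: "es = l # es'" "chain nx (nx l) es'" by (cases es) auto
  show ?thesis unfolding traversal_inv_def
    by (rule exI[of _ "pre @ [l]"], rule exI[of _ es']) (use * es assms(2) in auto)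
qed

lemma inv_new:
  assumes "traversal_inv i seen qu len cur (Suc l)" "seen (dst l) = 0"
  shows "traversal_inv (Suc i) (seen(dst l := 1)) (qu(len := dst l)) (Suc len) cur (nx l)"
proof -
  obtain pre es where *: "links_from src L (qu cur) = pre @ es" "chain nx (Suc l) es"
    "\<forall>l \<in> set pre. seen (dst l) \<noteq> 0"
    "\<forall>x < cur. \<forall>l < L. src l = qu x \<longrightarrow> seen (dst l) \<noteq> 0" "cur < len"
    "inj_on qu {..<len}" "qu ` {..<len} \<subseteq> {..<nb}" "qu 0 = 0"
    "\<forall>b. seen b \<noteq> 0 \<longleftrightarrow> b \<in> qu ` {..<len}"
    "\<forall>x < len. 0 < x \<longrightarrow> (\<exists>y < x. (qu y, qu x) \<in> links)"
    "i = cur + (\<Sum>x<cur. length (links_from src L (qu x))) + length pre"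
    using assms(1) unfolding traversal_inv_def by auto
  then obtain es' where es: "es = l # es'" "chain nx (nx l) es'" by (cases es) auto
  let ?o = "qu(len := dst l)"
  have "l \<in> set (links_from src L (qu cur))" using *(1) es by simp
  then have l: "l < L" "src l = qu cur" by (auto simp: set_links_from)
  have img: "?o ` {..<Suc len} = insert (dst l) (qu ` {..<len})"
    by (auto simp: less_Suc_eq)
  have old: "?o x = qu x" if "x < len" for x using that by simp
  have "dst l \<notin> qu ` {..<len}" using *(9) assms(2) by metis
  then have "inj_on ?o {..<Suc len}"
    using *(6) by (auto simp: lessThan_Suc intro: inj_on_fun_updI)
  moreover have "?o ` {..<Suc len} \<subseteq> {..<nb}" using img *(7) dst l by auto
  moreover have "\<forall>b. (seen(dst l := 1)) b \<noteq> 0 \<longleftrightarrow> b \<in> ?o ` {..<Suc len}"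
    using *(9) unfolding img by auto
  moreover have "\<exists>y < x. (?o y, ?o x) \<in> links" if x: "x < Suc len" "0 < x" for x
  proof (cases "x = len")
    case True
    have "(qu cur, dst l) \<in> links"
      unfolding links_def by (rule CollectI, rule exI[of _ l]) (use l in auto)
    then show ?thesis using *(5) True by (intro exI[of _ cur]) auto
  next
    case False
    then have "x < len" using x(1) by simp
    then obtain y where "y < x" "(qu y, qu x) \<in> links" using *(10) x(2) by blast
    then show ?thesis using False x by (intro exI[of _ y]) auto
  qed
  moreover have "(\<Sum>x<cur. length (links_from src L (?o x))) = (\<Sum>x<cur. length (links_from src L (qu x)))"
    using *(5) by (intro sum.cong) auto
  moreover have "?o 0 = 0" "?o cur = qu cur" using *(5,8) by auto
  moreover have "\<forall>x < cur. \<forall>l' < L. src l' = ?o x \<longrightarrow> (seen(dst l := 1)) (dst l') \<noteq> 0"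
    using *(4,5) by auto
  ultimately show ?thesis unfolding traversal_inv_def
    by - (rule exI[of _ "pre @ [l]"], rule exI[of _ es'], use * es in auto)
qed

lemma inv_next:
  assumes "traversal_inv i seen qu len cur 0" "Suc cur < len"
  shows "traversal_inv (Suc i) seen qu len (Suc cur) (fs (qu (Suc cur)))"
proof -
  obtain pre es where *: "links_from src L (qu cur) = pre @ es" "chain nx 0 es"
    "\<forall>l \<in> set pre. seen (dst l) \<noteq> 0"
    "\<forall>x < cur. \<forall>l < L. src l = qu x \<longrightarrow> seen (dst l) \<noteq> 0" "cur < len"
    "inj_on qu {..<len}" "qu ` {..<len} \<subseteq> {..<nb}" "qu 0 = 0"
    "\<forall>b. seen b \<noteq> 0 \<longleftrightarrow> b \<in> qu ` {..<len}"
    "\<forall>x < len. 0 < x \<longrightarrow> (\<exists>y < x. (qu y, qu x) \<in> links)"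
    "i = cur + (\<Sum>x<cur. length (links_from src L (qu x))) + length pre"
    using assms unfolding traversal_inv_def by auto
  have pre: "pre = links_from src L (qu cur)" using *(1,2) chain_zero[of nx 0 es] by simp
  have "\<forall>x < Suc cur. \<forall>l < L. src l = qu x \<longrightarrow> seen (dst l) \<noteq> 0"
    using *(3,4) unfolding pre set_links_from by (auto simp: less_Suc_eq)
  then show ?thesis unfolding traversal_inv_def
    by - (rule exI[of _ "[]"], rule exI[of _ "links_from src L (qu (Suc cur))"],
       use *(5-11) assms(2) chains pre in simp)
qed

lemma inv_done:
  assumes "traversal_inv i seen qu len cur 0" "\<not> Suc cur < len"
  shows "traversal_inv j seen qu len cur 0"
proof -
  have "cur < len" using assms(1) unfolding traversal_inv_def by auto
  then have "Suc cur = len" using assms(2) by simp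
  then show ?thesis using assms(1) unfolding traversal_inv_def by simp
qed

lemma inv_final:
  assumes inv: "traversal_inv (L + nb) seen qu len cur e"
    and con: "\<And>b. b < nb \<Longrightarrow> (0, b) \<in> links\<^sup>*"
  shows "bij_betw qu {..<nb} {..<nb}" "\<And>x. x < nb \<Longrightarrow> 0 < x \<Longrightarrow> \<exists>y < x. (qu y, qu x) \<in> links"
proof -
  obtain pre es where *: "links_from src L (qu cur) = pre @ es" "chain nx e es"
    "\<forall>l \<in> set pre. seen (dst l) \<noteq> 0"
    "\<forall>x < cur. \<forall>l < L. src l = qu x \<longrightarrow> seen (dst l) \<noteq> 0" "cur < len"
    "inj_on qu {..<len}" "qu ` {..<len} \<subseteq> {..<nb}" "qu 0 = 0"
    "\<forall>b. seen b \<noteq> 0 \<longleftrightarrow> b \<in> qu ` {..<len}"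
    "\<forall>x < len. 0 < x \<longrightarrow> (\<exists>y < x. (qu y, qu x) \<in> links)"
    "e = 0 \<and> Suc cur = len \<or> L + nb = cur + (\<Sum>x<cur. length (links_from src L (qu x))) + length pre"
    using inv unfolding traversal_inv_def by auto
  have "len \<le> nb" using card_inj_on_le[OF *(6,7)] by simp
  have "qu ` {..<Suc cur} \<subseteq> qu ` {..<len}" using *(5) by (intro image_mono) auto
  then have sub: "qu ` {..<Suc cur} \<subseteq> {..<nb}" using *(7) by (rule subset_trans)
  have inj: "inj_on qu {..<Suc cur}" by (rule inj_on_subset[OF *(6)]) (use *(5) in auto)
  have "(\<Sum>x<cur. length (links_from src L (qu x))) + length pre \<le>
      (\<Sum>x<Suc cur. length (links_from src L (qu x)))" using *(1) by simp
  also have "\<dots> = (\<Sum>b\<in>qu ` {..<Suc cur}. length (links_from src L b))"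
    unfolding sum.reindex[OF inj] by (simp add: o_def)
  also have "\<dots> \<le> (\<Sum>b<nb. length (links_from src L b))"
    using sub by (intro sum_mono2) auto
  also have "\<dots> = L" by (rule sum_length_links_from) (rule src)
  \<comment> \<open>Since \<open>cur < len \<le> nb\<close> and the inspected links number at most
    \<open>L\<close>, the clock cannot show \<open>L + nb\<close>; hence the search is
    exhausted.\<close>
  finally have fin: "e = 0" "Suc cur = len" using *(5,11) \<open>len \<le> nb\<close> by auto
  then have pre: "pre = links_from src L (qu cur)" using *(1,2) chain_zero[of nx e es] by simp
  have closed: "dst l \<in> qu ` {..<len}" if "l < L" "src l \<in> qu ` {..<len}" for l
  proof -
    from that(2) obtain x where x: "x < len" "src l = qu x" by auto
    then have "x < cur \<or> x = cur" using fin by auto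
    then have "seen (dst l) \<noteq> 0" using *(3,4) that(1) x unfolding pre set_links_from by auto
    then show ?thesis using *(9) by blast
  qed
  have "b \<in> qu ` {..<len}" if "(0, b) \<in> links\<^sup>*" for b
    using that
  proof (induction rule: rtrancl_induct)
    case base
    show ?case using *(5,8) by (metis imageI lessThan_iff less_nat_zero_code not_gr_zero)
  next
    case (step c d)
    then obtain l where "l < L" "c = src l" "d = dst l" by (auto simp: links_def)
    then show ?case using closed step.IH by simp
  qed
  then have "{..<nb} \<subseteq> qu ` {..<len}" using con by auto
  then have img: "qu ` {..<len} = {..<nb}" using *(7) by auto
  then have "len = nb" using card_image[OF *(6)] by simp
  then show "bij_betw qu {..<nb} {..<nb}" "\<And>x. x < nb \<Longrightarrow> 0 < x \<Longrightarrow> \<exists>y < x. (qu y, qu x) \<in> links"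
    using *(6,10) img by (auto simp: bij_betw_def)
qed

end

lemma traversal_spec:
  fixes s :: store
  assumes ll: "link_lists (s ''num_links'' 0) (s ''num_bags'' 0) (s ''link_fst'') (s ''link_snd'') (s ''next'') (s ''first'')"
    and con: "\<And>b. b < s ''num_bags'' 0 \<Longrightarrow>
      (0, b) \<in> (link_lists.links (s ''num_links'' 0) (s ''link_fst'') (s ''link_snd''))\<^sup>*"
    and nb: "0 < s ''num_bags'' 0"
    and init: "s ''seen'' = (\<lambda>_. 0)" "s ''order'' = (\<lambda>_. 0)" "s ''cur'' 0 = 0"
  shows "bij_betw (sem traversal s ''order'') {..<s ''num_bags'' 0} {..<s ''num_bags'' 0}"
    and "\<And>x. x < s ''num_bags'' 0 \<Longrightarrow> 0 < x \<Longrightarrow> \<exists>y < x. (sem traversal s ''order'' y, sem traversal s ''order'' x)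
       \<in> link_lists.links (s ''num_links'' 0) (s ''link_fst'') (s ''link_snd'')"
proof -
  interpret link_lists "s ''num_links'' 0" "s ''num_bags'' 0" "s ''link_fst''" "s ''link_snd''" "s ''next''" "s ''first''"
    by (rule ll)
  let ?I = "\<lambda>i (t :: store). traversal_inv i (t ''seen'') (t ''order'') (t ''tail'' 0) (t ''cur'' 0) (t ''e'' 0)"
  define s0 where "s0 = upd ''e'' 0 (s ''first'' 0) (upd ''tail'' 0 1 (upd ''seen'' 0 1 s))"
  let ?e = "Var ''num_links'' [+] Var ''num_bags''"
  have "?I (val ?e s0) (sem (PFor ''i'' ?e traversal_step) s0)"
  proof (rule sem_For[where I = ?I], goal_cases)
    case 1
    \<comment> \<open>Bag 0 is the first entry of the queue because the array \<open>order\<close>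
      is initially 0.\<close>
    show ?case using inv_init[OF nb] init by (simp add: upd_apply s0_def)
  next
    case (2 i t)
    have fr: "t ''next'' = s ''next''" "t ''first'' = s ''first''" "t ''link_snd'' = s ''link_snd''"
      using 2(4)[of "''next''"] 2(4)[of "''first''"] 2(4)[of "''link_snd''"]
      by (simp_all add: traversal_step_def s0_def upd_apply)
    show ?case
    proof (cases "t ''e'' 0")
      case 0
      then show ?thesis
      proof (cases "Suc (t ''cur'' 0) < t ''tail'' 0")
        case True
        then show ?thesis using 0 2(2) inv_next by (simp add: traversal_step_def upd_apply fr)
      next
        case False
        have "traversal_inv (Suc i) (t ''seen'') (t ''order'') (t ''tail'' 0) (t ''cur'' 0) 0"
          using 2(2) False unfolding 0 by (rule inv_done)
        then show ?thesis using 0 False by (simp add: traversal_step_def upd_apply)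
      qed
    next
      case (Suc l)
      then show ?thesis
      proof (cases "t ''seen'' (s ''link_snd'' l) = 0")
        case True
        then show ?thesis using Suc 2(2) inv_new[of i "t ''seen''" _ _ _ l]
          by (simp add: traversal_step_def upd_apply fr)
      next
        case False
        then show ?thesis using Suc 2(2) inv_old[of i "t ''seen''" _ _ _ l]
          by (simp add: traversal_step_def upd_apply fr)
      qed
    qed
  qed
  moreover have "val ?e s0 = s ''num_links'' 0 + s ''num_bags'' 0" by (simp add: s0_def upd_apply)
  moreover have "sem (PFor ''i'' ?e traversal_step) s0 = sem traversal s"
    by (simp add: traversal_eq s0_def upd_apply)
  ultimately have "?I (s ''num_links'' 0 + s ''num_bags'' 0) (sem traversal s)" by simp
  from inv_final[OF this con]
  show "bij_betw (sem traversal s ''order'') {..<s ''num_bags'' 0} {..<s ''num_bags'' 0}"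
    and "\<And>x. x < s ''num_bags'' 0 \<Longrightarrow> 0 < x \<Longrightarrow> \<exists>y < x. (sem traversal s ''order'' y, sem traversal s ''order'' x) \<in> links"
    by auto
qed

section \<open>Ranking and colouring of the vertices\<close>

definition nb_set :: "nat \<Rightarrow> (nat \<Rightarrow> nat) \<Rightarrow> nat \<Rightarrow> nat set" where
  "nb_set D nt v = {u. \<exists>a < D. nt (v * D + a) = Suc u}"

text \<open>Rank 0 marks a vertex not yet ranked, hence ranks are positions plus 1. The third and
  fourth conjuncts make the colouring proper: the neighbours of \<open>v\<close> sit in the cells of
  their colours, and the cell of the colour of \<open>v\<close> remains empty.\<close>

definition ranked :: "nat \<Rightarrow> nat \<Rightarrow> store \<Rightarrow> bool" where
  "ranked D n t \<longleftrightarrow>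
     (\<forall>v. t ''rank'' v \<noteq> 0 \<longrightarrow> v < n \<and> t ''rank'' v \<le> t ''r'' 0 \<and> t ''vert'' (t ''rank'' v - 1) = v) \<and>
     (\<forall>i < t ''r'' 0. t ''rank'' (t ''vert'' i) = Suc i) \<and>
     (\<forall>v. \<forall>a < D. \<forall>u. t ''nbr'' (v * D + a) = Suc u \<longrightarrow>
       t ''rank'' u \<noteq> 0 \<and> t ''rank'' u < t ''rank'' v \<and> t ''col'' u = a) \<and>
     (\<forall>v. t ''rank'' v \<noteq> 0 \<longrightarrow> t ''col'' v < D \<and> t ''nbr'' (v * D + t ''col'' v) = 0) \<and>
     (\<forall>v. nb_set D (t ''nbr'') v = {} \<and> t ''par'' v = 0 \<or>
       (\<exists>p \<in> nb_set D (t ''nbr'') v. t ''par'' v = Suc p \<and>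
         (\<forall>u \<in> nb_set D (t ''nbr'') v. t ''rank'' u \<le> t ''rank'' p)))"

text \<open>The ranked vertices of a bag form a clique of the chordal supergraph. It is kept bag by
  bag during the ranking.\<close>

definition pairs :: "nat \<Rightarrow> store \<Rightarrow> nat set \<Rightarrow> bool" where
  "pairs D t X \<longleftrightarrow> (\<forall>u \<in> X. \<forall>w \<in> X. t ''rank'' u \<noteq> 0 \<longrightarrow> t ''rank'' u < t ''rank'' w \<longrightarrow>
     u \<in> nb_set D (t ''nbr'') w)"

lemma row_inj:
  fixes a b :: nat
  assumes "a < D" "b < D"
  shows "v * D + a = w * D + b \<longleftrightarrow> v = w \<and> a = b"
proof -
  have "(v * D + a) div D = v" "(v * D + a) mod D = a" "(w * D + b) div D = w" "(w * D + b) mod D = b"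
    using assms by simp_all
  then show ?thesis by metis
qed

definition segment :: "store \<Rightarrow> nat \<Rightarrow> nat set" where
  "segment t i = {t ''bag'' (t ''lo'' 0 + l) | l. l < i \<and> l < t ''len'' 0}"

lemma segment_Suc:
  "segment t (Suc i) = (if i < t ''len'' 0 then insert (t ''bag'' (t ''lo'' 0 + i)) (segment t i) else segment t i)"
  by (auto simp: segment_def less_Suc_eq)

definition scan_step :: prog where
  "scan_step = when (Var ''l'' [<] Var ''len'')
      (''u'' ::= Read ''bag'' (Var ''lo'' [+] Var ''l'') ;;
       when (Read ''rank'' (Var ''u''))
        (PWrite ''nbr'' (Var ''v'' [*] Var ''D'' [+] Read ''col'' (Var ''u'')) (Var ''u'' [+] Const 1) ;;
         when (Var ''best'' [<] Read ''rank'' (Var ''u''))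
          (''best'' ::= Read ''rank'' (Var ''u'') ;;
           PWrite ''par'' (Var ''v'') (Var ''u'' [+] Const 1))))"

lemma scan_bag_eq: "scan_bag = (''best'' ::= Const 0 ;; PFor ''l'' (Var ''D'') scan_step)"
  by (simp add: scan_bag_def scan_step_def)

lemma scan_bag_spec:
  fixes t :: store
  defines "D \<equiv> t ''D'' 0" and "v \<equiv> t ''v'' 0"
  defines "W \<equiv> {u \<in> segment t D. t ''rank'' u \<noteq> 0}"
  defines "t' \<equiv> sem scan_bag t"
  assumes row: "\<And>a. a < D \<Longrightarrow> t ''nbr'' (v * D + a) = 0" and par: "t ''par'' v = 0"
    and col: "\<And>u. u \<in> W \<Longrightarrow> t ''col'' u < D" and inj: "inj_on (t ''col'') W"
  shows "a < D \<Longrightarrow> t' ''nbr'' (v * D + a) = Suc u \<longleftrightarrow> u \<in> W \<and> t ''col'' u = a"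
    and "(\<And>a. a < D \<Longrightarrow> j \<noteq> v * D + a) \<Longrightarrow> t' ''nbr'' j = t ''nbr'' j"
    and "W = {} \<and> t' ''par'' v = 0 \<or>
      (\<exists>p \<in> W. t' ''par'' v = Suc p \<and> (\<forall>u \<in> W. t ''rank'' u \<le> t ''rank'' p))"
    and "w \<noteq> v \<Longrightarrow> t' ''par'' w = t ''par'' w"
proof -
  define Wi where "Wi i = {u \<in> segment t i. t ''rank'' u \<noteq> 0}" for i
  let ?I = "\<lambda>i (s :: store).
     (\<forall>a < D. \<forall>u. s ''nbr'' (v * D + a) = Suc u \<longleftrightarrow> u \<in> Wi i \<and> t ''col'' u = a) \<and>
     (\<forall>j. (\<forall>a < D. j \<noteq> v * D + a) \<longrightarrow> s ''nbr'' j = t ''nbr'' j) \<and>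
     (Wi i = {} \<and> s ''best'' 0 = 0 \<and> s ''par'' v = 0 \<or>
      (\<exists>p \<in> Wi i. s ''par'' v = Suc p \<and> s ''best'' 0 = t ''rank'' p \<and> (\<forall>u \<in> Wi i. t ''rank'' u \<le> t ''rank'' p))) \<and>
     (\<forall>w. w \<noteq> v \<longrightarrow> s ''par'' w = t ''par'' w)"
  let ?t = "upd ''best'' 0 0 t"
  have "?I (val (Var ''D'') ?t) (sem (PFor ''l'' (Var ''D'') scan_step) ?t)"
  proof (rule sem_For[where I = ?I], goal_cases)
    case 1
    have "Wi 0 = {}" by (simp add: Wi_def segment_def)
    then show ?case using row par by (simp add: upd_apply)
  next
    case (2 i s)
    have fr: "s y = t y" if "y \<in> {''bag'', ''rank'', ''col'', ''v'', ''D'', ''lo'', ''len''}" for y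
      using 2(4)[of y] that by (auto simp: scan_step_def upd_apply)
    have i: "i < D" "s ''l'' 0 = i" using 2(1,3) by (simp_all add: D_def upd_apply)
    note I = 2(2)
    let ?u = "t ''bag'' (t ''lo'' 0 + i)"
    show ?case
    proof (cases "i < t ''len'' 0 \<and> t ''rank'' ?u \<noteq> 0")
      case False
      then have "Wi (Suc i) = Wi i" by (auto simp: Wi_def segment_Suc)
      then show ?thesis using I False by (auto simp: scan_step_def upd_apply fr i)
    next
      case True
      then have W: "Wi (Suc i) = insert ?u (Wi i)" by (auto simp: Wi_def segment_Suc)
      have sub: "Wi (Suc i) \<subseteq> W" using i by (auto simp: Wi_def W_def segment_def)
      then have cu: "t ''col'' ?u < D" using col W by auto
      have eq: "u = ?u" if "u \<in> Wi i" "t ''col'' u = t ''col'' ?u" for u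
      proof -
        have uW: "u \<in> W" by (rule subsetD[OF sub]) (simp add: W that(1))
        have u'W: "?u \<in> W" by (rule subsetD[OF sub]) (simp add: W)
        show ?thesis using inj_on_eq_iff[OF inj uW u'W] that(2) by simp
      qed
      let ?s = "upd ''l'' 0 (Suc i) (sem scan_step s)"
      have n: "?s ''nbr'' = (s ''nbr'')(v * D + t ''col'' ?u := Suc ?u)"
        and p: "?s ''par'' = (if s ''best'' 0 < t ''rank'' ?u then (s ''par'')(v := Suc ?u) else s ''par'')"
        and b: "?s ''best'' 0 = max (s ''best'' 0) (t ''rank'' ?u)"
        using True by (simp_all add: scan_step_def upd_apply fr i v_def D_def)
      have 1: "?s ''nbr'' (v * D + a) = Suc u \<longleftrightarrow> u \<in> Wi (Suc i) \<and> t ''col'' u = a" if "a < D" for a u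
        using I that eq unfolding n W by (auto simp: fun_upd_def)
      have 2: "?s ''nbr'' j = t ''nbr'' j" if "\<forall>a < D. j \<noteq> v * D + a" for j
        using I that cu unfolding n by auto
      have 3: "\<exists>p \<in> Wi (Suc i). ?s ''par'' v = Suc p \<and> ?s ''best'' 0 = t ''rank'' p \<and>
           (\<forall>u \<in> Wi (Suc i). t ''rank'' u \<le> t ''rank'' p)"
      proof (cases "s ''best'' 0 < t ''rank'' ?u")
        case True
        then show ?thesis using I unfolding p b W by (intro bexI[of _ ?u]) auto
      next
        case False
        then show ?thesis using I \<open>i < t ''len'' 0 \<and> t ''rank'' ?u \<noteq> 0\<close> unfolding p b W by (auto simp: max_def)
      qed
      have 4: "?s ''par'' w = t ''par'' w" if "w \<noteq> v" for w
        using I that unfolding p by auto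
      show ?thesis using 1 2 3 4 by blast
    qed
  qed
  moreover have "Wi D = W" by (simp add: Wi_def W_def)
  ultimately have *: "?I D t'"
    by (simp add: t'_def scan_bag_eq upd_apply D_def del: sem.simps(5))
  show "a < D \<Longrightarrow> t' ''nbr'' (v * D + a) = Suc u \<longleftrightarrow> u \<in> W \<and> t ''col'' u = a"
    and "(\<And>a. a < D \<Longrightarrow> j \<noteq> v * D + a) \<Longrightarrow> t' ''nbr'' j = t ''nbr'' j"
    and "W = {} \<and> t' ''par'' v = 0 \<or>
      (\<exists>p \<in> W. t' ''par'' v = Suc p \<and> (\<forall>u \<in> W. t ''rank'' u \<le> t ''rank'' p))"
    and "w \<noteq> v \<Longrightarrow> t' ''par'' w = t ''par'' w"
    using * \<open>Wi D = W\<close> by auto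
qed

lemma choose_colour_spec:
  fixes t :: store
  defines "D \<equiv> t ''D'' 0" and "v \<equiv> t ''v'' 0"
  defines "t' \<equiv> sem choose_colour t"
  assumes "\<exists>a < D. t ''nbr'' (v * D + a) = 0"
  shows "t' ''col'' v < D \<and> t ''nbr'' (v * D + t' ''col'' v) = 0"
    and "w \<noteq> v \<Longrightarrow> t' ''col'' w = t ''col'' w"
proof -
  let ?I = "\<lambda>i (s :: store). (\<forall>w. w \<noteq> v \<longrightarrow> s ''col'' w = t ''col'' w) \<and>
     ((\<exists>a < i. t ''nbr'' (v * D + a) = 0) \<longrightarrow> s ''col'' v < D \<and> t ''nbr'' (v * D + s ''col'' v) = 0)"
  have "?I (val (Var ''D'') t) (sem choose_colour t)"
    unfolding choose_colour_def
  proof (rule sem_For[where I = ?I], goal_cases)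
    case (2 i s)
    have fr: "s y = t y" if "y \<in> {''nbr'', ''v'', ''D''}" for y
      using 2(4)[of y] that by (auto simp: nbr_def)
    have i: "i < D" "s ''l'' 0 = i" using 2(1,3) by (simp_all add: D_def)
    show ?case using 2(2) i
      by (auto simp: nbr_def upd_apply fr v_def D_def less_Suc_eq)
  qed (simp add: upd_apply)
  then show "t' ''col'' v < D \<and> t ''nbr'' (v * D + t' ''col'' v) = 0"
    and "w \<noteq> v \<Longrightarrow> t' ''col'' w = t ''col'' w"
    using assms(4) by (auto simp: t'_def D_def)
qed

lemma writes_scan_bag: "writes scan_bag = {''best'', ''l'', ''u'', ''nbr'', ''par''}"
  by (auto simp: scan_bag_def)

lemma writes_choose_colour: "writes choose_colour = {''l'', ''col''}"
  by (auto simp: choose_colour_def)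

lemma card_segment: "finite (segment t i)" "card (segment t i) \<le> i"
proof -
  have sub: "segment t i \<subseteq> (\<lambda>l. t ''bag'' (t ''lo'' 0 + l)) ` {..<i}" by (auto simp: segment_def)
  then show "finite (segment t i)" by (rule finite_subset) simp
  have "card (segment t i) \<le> card ((\<lambda>l. t ''bag'' (t ''lo'' 0 + l)) ` {..<i})"
    by (rule card_mono[OF _ sub]) simp
  also have "\<dots> \<le> card {..<i}" by (rule card_image_le) simp
  finally show "card (segment t i) \<le> i" by simp
qed

lemma rank_vertex_spec:
  fixes t :: store
  defines "D \<equiv> t ''D'' 0" and "v \<equiv> t ''v'' 0"
  defines "B \<equiv> segment t D"
  defines "t' \<equiv> sem rank_vertex t"
  assumes rk: "ranked D n t" and prs: "pairs D t B" and v: "v < n" "v \<in> B" "t ''rank'' v = 0"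
  shows "ranked D n t'" and "t' ''rank'' = (t ''rank'')(v := Suc (t ''r'' 0))"
    and "nb_set D (t' ''nbr'') = (nb_set D (t ''nbr''))(v := {u \<in> B. t ''rank'' u \<noteq> 0})"
proof -
  note r1 = rk[unfolded ranked_def, THEN conjunct1, rule_format]
    and r2 = rk[unfolded ranked_def, THEN conjunct2, THEN conjunct1, rule_format]
    and r3 = rk[unfolded ranked_def, THEN conjunct2, THEN conjunct2, THEN conjunct1, rule_format]
    and r4 = rk[unfolded ranked_def, THEN conjunct2, THEN conjunct2, THEN conjunct2, THEN conjunct1, rule_format]
    and r5 = rk[unfolded ranked_def, THEN conjunct2, THEN conjunct2, THEN conjunct2, THEN conjunct2, rule_format]
  let ?W = "{u \<in> segment t D. t ''rank'' u \<noteq> 0}"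
  define s1 where "s1 = sem scan_bag t"
  define s2 where "s2 = sem choose_colour s1"
  \<comment> \<open>An entry in the row of \<open>v\<close> would have a rank below that of
    \<open>v\<close>, which is 0.\<close>
  have row: "t ''nbr'' (v * D + a) = 0" if "a < D" for a
    using r3[OF that, of v] v(3) by (cases "t ''nbr'' (v * D + a)") auto
  then have "nb_set D (t ''nbr'') v = {}" by (simp add: nb_set_def)
  then have par: "t ''par'' v = 0" using r5[of v] by auto
  have col: "t ''col'' u < D" if "u \<in> ?W" for u using that r4 by auto
  \<comment> \<open>Of two ranked vertices in the bag, the earlier one is entered in the row of the
    later one at its colour, whereas the cell of the colour of the later one is empty.\<close>
  have inj: "inj_on (t ''col'') ?W"
  proof (rule inj_onI, rule ccontr)
    fix u w assume uw: "u \<in> ?W" "w \<in> ?W" "t ''col'' u = t ''col'' w" "u \<noteq> w"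
    have ord: False if "x \<in> ?W" "y \<in> ?W" "t ''col'' x = t ''col'' y" "t ''rank'' x < t ''rank'' y" for x y
    proof -
      have "x \<in> nb_set D (t ''nbr'') y" using prs that unfolding pairs_def B_def by auto
      then obtain a where "a < D" "t ''nbr'' (y * D + a) = Suc x" by (auto simp: nb_set_def)
      then show False using r3[of a y x] r4[of y] that by auto
    qed
    have "t ''rank'' u \<noteq> t ''rank'' w" using r1[of u] r1[of w] uw by auto
    then show False
      using ord[OF uw(1,2,3)] ord[OF uw(2,1) uw(3)[symmetric]] by (meson nat_neq_iff)
  qed
  note raw = scan_bag_spec[of t, folded D_def v_def s1_def]
  have scan: "a < D \<Longrightarrow> s1 ''nbr'' (v * D + a) = Suc u \<longleftrightarrow> u \<in> ?W \<and> t ''col'' u = a"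
    "(\<And>a. a < D \<Longrightarrow> j \<noteq> v * D + a) \<Longrightarrow> s1 ''nbr'' j = t ''nbr'' j"
    "?W = {} \<and> s1 ''par'' v = 0 \<or>
      (\<exists>p \<in> ?W. s1 ''par'' v = Suc p \<and> (\<forall>u \<in> ?W. t ''rank'' u \<le> t ''rank'' p))"
    "w \<noteq> v \<Longrightarrow> s1 ''par'' w = t ''par'' w" for a u j w
    by (rule raw[OF row par col inj]; assumption)+
  have fr1: "s1 y = t y" if "y \<notin> {''best'', ''l'', ''u'', ''nbr'', ''par''}" for y
    unfolding s1_def using that by (intro sem_frame) (simp add: writes_scan_bag)
  have fr2: "s2 y = s1 y" if "y \<notin> {''l'', ''col''}" for y
    unfolding s2_def using that by (intro sem_frame) (simp add: writes_choose_colour)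
  have "?W \<subset> B" using v unfolding B_def by blast
  then have "card ?W < D"
    using psubset_card_mono[of B ?W] card_segment[of t D] by (simp add: B_def)
  have "finite ?W" using card_segment(1)[of t D] by simp
  \<comment> \<open>The bag has at most \<open>D\<close> elements and \<open>v\<close> is one of
    them without a rank, so its ranked vertices leave a colour free.\<close>
  have "\<exists>a < D. s1 ''nbr'' (v * D + a) = 0"
  proof (rule ccontr)
    assume "\<not> ?thesis"
    then have "{..<D} \<subseteq> t ''col'' ` ?W"
      using scan(1) by (auto simp: gr0_conv_Suc)
    then have "D \<le> card (t ''col'' ` ?W)"
      using card_mono[of "t ''col'' ` ?W" "{..<D}"] \<open>finite ?W\<close> by simp
    also have "\<dots> \<le> card ?W" by (rule card_image_le[OF \<open>finite ?W\<close>])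
    finally show False using \<open>card ?W < D\<close> by simp
  qed
  then have "\<exists>a < s1 ''D'' 0. s1 ''nbr'' (s1 ''v'' 0 * s1 ''D'' 0 + a) = 0"
    by (simp add: fr1 D_def v_def)
  note choose = choose_colour_spec[OF this, folded s2_def]
  have Dv: "s1 ''D'' 0 = D" "s1 ''v'' 0 = v" by (simp_all add: fr1 D_def v_def)
  note choose = choose[unfolded Dv]
  have t': "t' = upd ''rank'' v (Suc (t ''r'' 0)) (upd ''r'' 0 (Suc (t ''r'' 0)) (upd ''vert'' (t ''r'' 0) v s2))"
    by (simp add: t'_def rank_vertex_def s1_def[symmetric] s2_def[symmetric] upd_apply fr1 fr2 v_def)
  have rank': "t' ''rank'' = (t ''rank'')(v := Suc (t ''r'' 0))"
    and vert': "t' ''vert'' = (t ''vert'')(t ''r'' 0 := v)" and r': "t' ''r'' 0 = Suc (t ''r'' 0)"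
    and nbr': "t' ''nbr'' = s1 ''nbr''" and par': "t' ''par'' = s1 ''par''" and col': "t' ''col'' = s2 ''col''"
    unfolding t' by (simp_all add: upd_apply fr1 fr2)
  have other: "s1 ''nbr'' (w * D + a) = t ''nbr'' (w * D + a)" if "a < D" "w \<noteq> v" for a w
    using scan(2)[of "w * D + a"] row_inj[OF that(1)] that(2) by blast
  show nb: "nb_set D (t' ''nbr'') = (nb_set D (t ''nbr''))(v := {u \<in> B. t ''rank'' u \<noteq> 0})"
  proof (rule ext)
    fix w
    show "nb_set D (t' ''nbr'') w = ((nb_set D (t ''nbr''))(v := {u \<in> B. t ''rank'' u \<noteq> 0})) w"
    proof (cases "w = v")
      case True
      then show ?thesis using scan(1) col unfolding nb_set_def nbr' B_def by auto
    next
      case False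
      then show ?thesis using other unfolding nb_set_def nbr' by auto
    qed
  qed
  show rank'': "t' ''rank'' = (t ''rank'')(v := Suc (t ''r'' 0))" by (rule rank')
  have le: "t ''rank'' w \<le> t ''r'' 0" for w using r1[of w] by (cases "t ''rank'' w = 0") auto
  have A: "w < n \<and> t' ''rank'' w \<le> t' ''r'' 0 \<and> t' ''vert'' (t' ''rank'' w - 1) = w"
    if "t' ''rank'' w \<noteq> 0" for w
    using r1[of w] v that le[of w] unfolding rank' vert' r' by (auto split: if_splits)
  have B': "t' ''rank'' (t' ''vert'' i) = Suc i" if "i < t' ''r'' 0" for i
    using r2[of i] v that unfolding rank' vert' r' by (auto simp: less_Suc_eq)
  have old_ne: "u \<noteq> v" if "t ''rank'' u \<noteq> 0" for u using v that by auto
  have C: "t' ''rank'' u \<noteq> 0 \<and> t' ''rank'' u < t' ''rank'' w \<and> t' ''col'' u = a"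
    if a: "a < D" and u: "t' ''nbr'' (w * D + a) = Suc u" for w a u
  proof (cases "w = v")
    case True
    then have "u \<in> ?W" "t ''col'' u = a" using u scan(1)[OF a, of u] unfolding nbr' by auto
    moreover have "u \<noteq> v" using old_ne \<open>u \<in> ?W\<close> by auto
    ultimately show ?thesis
      using True le[of u] choose(2)[of u] unfolding rank' col' by (auto simp: fr1)
  next
    case False
    then have *: "t ''rank'' u \<noteq> 0 \<and> t ''rank'' u < t ''rank'' w \<and> t ''col'' u = a"
      using u other[OF a False] r3[OF a, of w u] unfolding nbr' by auto
    then have "u \<noteq> v" using old_ne by auto
    then show ?thesis using * False choose(2)[of u] unfolding rank' col' by (auto simp: fr1)
  qed
  have D': "t' ''col'' w < D \<and> t' ''nbr'' (w * D + t' ''col'' w) = 0" if "t' ''rank'' w \<noteq> 0" for w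
  proof (cases "w = v")
    case True
    then show ?thesis using choose(1) unfolding col' nbr' by auto
  next
    case False
    then have *: "t ''col'' w < D \<and> t ''nbr'' (w * D + t ''col'' w) = 0"
      using r4[of w] that unfolding rank' by auto
    then show ?thesis using other[of "t ''col'' w" w] False choose(2)[of w] unfolding col' nbr' by (auto simp: fr1)
  qed
  have E: "nb_set D (t' ''nbr'') w = {} \<and> t' ''par'' w = 0 \<or>
       (\<exists>p \<in> nb_set D (t' ''nbr'') w. t' ''par'' w = Suc p \<and>
         (\<forall>u \<in> nb_set D (t' ''nbr'') w. t' ''rank'' u \<le> t' ''rank'' p))" for w
  proof (cases "w = v")
    case True
    have "?W = {} \<and> t' ''par'' v = 0 \<or>
      (\<exists>p \<in> ?W. t' ''par'' v = Suc p \<and> (\<forall>u \<in> ?W. t ''rank'' u \<le> t ''rank'' p))"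
      using scan(3) unfolding par' .
    moreover have "t' ''rank'' u = t ''rank'' u" if "u \<in> ?W" for u
      using that old_ne unfolding rank' by auto
    moreover have "nb_set D (t' ''nbr'') w = ?W" unfolding nb B_def True by simp
    ultimately show ?thesis unfolding True by auto
  next
    case False
    have "t' ''rank'' u = t ''rank'' u" if u: "u \<in> nb_set D (t ''nbr'') w" for u
    proof -
      from u obtain a where "a < D" "t ''nbr'' (w * D + a) = Suc u" by (auto simp: nb_set_def)
      then have "u \<noteq> v" using r3[of a w u] old_ne by blast
      then show ?thesis unfolding rank' by simp
    qed
    moreover have "nb_set D (t' ''nbr'') w = nb_set D (t ''nbr'') w" unfolding nb using False by simp
    moreover have "t' ''par'' w = t ''par'' w" unfolding par' by (rule scan(4)[OF False])
    ultimately show ?thesis using r5[of w] by auto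
  qed
  show "ranked D n t'" unfolding ranked_def using A B' C D' E by blast
qed

text \<open>The last conjunct is kept for the end: since
  \<open>insert v (nb_set D (t ''nbr'') v)\<close> lies inside one bag, it bounds the number of
  neighbours by the width and yields the clique property.\<close>

definition ranking_inv :: "nat \<Rightarrow> nat \<Rightarrow> store \<Rightarrow> nat set \<Rightarrow> nat set set \<Rightarrow> bool" where
  "ranking_inv D n t Vs F \<longleftrightarrow> ranked D n t \<and> (\<forall>u. t ''rank'' u \<noteq> 0 \<longleftrightarrow> u \<in> Vs) \<and> (\<forall>X \<in> F. pairs D t X) \<and>
     (\<forall>v \<in> Vs. \<exists>X \<in> F. insert v (nb_set D (t ''nbr'') v) \<subseteq> X)"

lemma ranking_inv_cong:
  assumes "\<And>y. y \<in> {''rank'', ''vert'', ''r'', ''nbr'', ''col'', ''par''} \<Longrightarrow> t y = t' y"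
  shows "ranking_inv D n t Vs F = ranking_inv D n t' Vs F"
  using assms unfolding ranking_inv_def ranked_def pairs_def by simp

text \<open>Among the bags treated so far only the current one contains \<open>v\<close>, so ranking
  \<open>v\<close> creates no new pair in any other bag.\<close>

lemma ranking_inv_vertex:
  fixes t :: store
  defines "D \<equiv> t ''D'' 0" and "v \<equiv> t ''v'' 0"
  defines "B \<equiv> segment t D"
  assumes inv: "ranking_inv D n t Vs F" and B: "B \<in> F" and v: "v < n" "v \<in> B" "v \<notin> Vs"
    and only: "\<And>X. X \<in> F \<Longrightarrow> v \<in> X \<Longrightarrow> X = B"
  shows "ranking_inv D n (sem rank_vertex t) (insert v Vs) F"
proof -
  have rk: "ranked D n t" and Vs: "\<And>u. t ''rank'' u \<noteq> 0 \<longleftrightarrow> u \<in> Vs"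
    and prs: "\<And>X. X \<in> F \<Longrightarrow> pairs D t X"
    and cov: "\<And>v. v \<in> Vs \<Longrightarrow> \<exists>X \<in> F. insert v (nb_set D (t ''nbr'') v) \<subseteq> X"
    using inv unfolding ranking_inv_def by auto
  have v0: "t ''rank'' v = 0" using v(3) Vs by auto
  note spec = rank_vertex_spec[of t n, folded D_def v_def B_def, OF rk prs[OF B] v(1,2) v0]
  let ?t = "sem rank_vertex t"
  have le: "t ''rank'' w \<le> t ''r'' 0" for w
    using rk unfolding ranked_def by (cases "t ''rank'' w = 0") auto
  have 1: "?t ''rank'' u \<noteq> 0 \<longleftrightarrow> u \<in> insert v Vs" for u
    using spec(2) Vs[of u] by auto
  have 2: "pairs D ?t X" if X: "X \<in> F" for X
    unfolding pairs_def
  proof (intro ballI impI)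
    fix u w assume uw: "u \<in> X" "w \<in> X" "?t ''rank'' u \<noteq> 0" "?t ''rank'' u < ?t ''rank'' w"
    have "u \<noteq> v" using uw(4) le[of w] unfolding spec(2) by (auto split: if_splits)
    then have u: "t ''rank'' u \<noteq> 0" using uw(3) unfolding spec(2) by simp
    show "u \<in> nb_set D (?t ''nbr'') w"
    proof (cases "w = v")
      case True
      then have "X = B" using only[OF X] uw(2) by simp
      then show ?thesis using True uw(1) u unfolding spec(3) by simp
    next
      case False
      then have "t ''rank'' u < t ''rank'' w" using uw(4) \<open>u \<noteq> v\<close> unfolding spec(2) by simp
      then show ?thesis using prs[OF X] uw(1,2) u False unfolding pairs_def spec(3) by simp
    qed
  qed
  have 3: "\<exists>X \<in> F. insert w (nb_set D (?t ''nbr'') w) \<subseteq> X" if "w \<in> insert v Vs" for w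
  proof (cases "w = v")
    case True
    then show ?thesis using B v(2) unfolding spec(3) by (intro bexI[of _ B]) auto
  next
    case False
    then show ?thesis using cov[of w] that unfolding spec(3) by auto
  qed
  show ?thesis unfolding ranking_inv_def using spec(1) 1 2 3 by blast
qed

definition bag_set :: "store \<Rightarrow> nat \<Rightarrow> nat set" where
  "bag_set s b = {s ''bag'' (s ''bag_start'' b + l) | l. l < s ''bag_start'' (Suc b) - s ''bag_start'' b}"

lemma bag_set_cong:
  "s ''bag'' = t ''bag'' \<Longrightarrow> s ''bag_start'' = t ''bag_start'' \<Longrightarrow> bag_set s = bag_set t"
  by (simp add: bag_set_def fun_eq_iff)

definition rank_next :: prog where
  "rank_next = when (Var ''j'' [<] Var ''len'')
      (''v'' ::= Read ''bag'' (Var ''lo'' [+] Var ''j'') ;;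
       when (Read ''rank'' (Var ''v'') [=] Const 0) rank_vertex)"

lemma rank_bag_eq: "rank_bag = (''B'' ::= Read ''order'' (Var ''i'') ;;
     ''lo'' ::= Read ''bag_start'' (Var ''B'') ;;
     ''len'' ::= bag_size (Var ''B'') ;; PFor ''j'' (Var ''D'') rank_next)"
  by (simp add: rank_bag_def rank_next_def)

lemma writes_rank_vertex:
  "writes rank_vertex = {''best'', ''l'', ''u'', ''nbr'', ''par'', ''col'', ''vert'', ''r'', ''rank''}"
  by (auto simp: rank_vertex_def writes_scan_bag writes_choose_colour)

lemma rank_bag_spec:
  fixes t :: store
  defines "D \<equiv> t ''D'' 0" and "B \<equiv> bag_set t (t ''order'' (t ''i'' 0))"
  assumes inv: "ranking_inv D n t Vs F" and B: "B \<in> F" "B \<subseteq> {..<n}"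
    and old: "\<And>X. X \<in> F \<Longrightarrow> X \<noteq> B \<Longrightarrow> X \<subseteq> Vs"
    and size: "t ''bag_start'' (Suc (t ''order'' (t ''i'' 0))) - t ''bag_start'' (t ''order'' (t ''i'' 0)) \<le> D"
  shows "ranking_inv D n (sem rank_bag t) (Vs \<union> B) F"
proof -
  define b where "b = t ''order'' (t ''i'' 0)"
  define s where "s = upd ''len'' 0 (t ''bag_start'' (Suc b) - t ''bag_start'' b)
    (upd ''lo'' 0 (t ''bag_start'' b) (upd ''B'' 0 b t))"
  have seg: "segment s D = B"
    using size by (auto simp: segment_def s_def upd_apply B_def bag_set_def b_def)
  let ?I = "\<lambda>j u. ranking_inv D n u (Vs \<union> segment s j) F"
  have "?I (val (Var ''D'') s) (sem (PFor ''j'' (Var ''D'') rank_next) s)"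
  proof (rule sem_For[where I = ?I], goal_cases)
    case 1
    have "ranking_inv D n (upd ''j'' 0 0 s) Vs F = ranking_inv D n t Vs F"
      by (rule ranking_inv_cong) (auto simp: s_def upd_apply)
    then show ?case using inv by (simp add: segment_def)
  next
    case (2 j u)
    have fr: "u y = s y" if "y \<in> {''bag'', ''lo'', ''len'', ''D''}" for y
      using that by (intro 2(4)) (auto simp: rank_next_def writes_rank_vertex)
    have j: "j < D" "u ''j'' 0 = j" using 2(1,3) by (simp_all add: s_def upd_apply D_def)
    have segu: "segment (upd ''v'' 0 x u) = segment s" for x
      by (simp add: fun_eq_iff segment_def upd_apply fr)
    let ?v = "s ''bag'' (s ''lo'' 0 + j)"
    have Du: "u ''D'' 0 = D" by (simp add: fr s_def upd_apply D_def)
    show ?case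
    proof (cases "j < s ''len'' 0")
      case False
      have "ranking_inv D n (upd ''j'' 0 (Suc j) u) (Vs \<union> segment s j) F = ranking_inv D n u (Vs \<union> segment s j) F"
        by (rule ranking_inv_cong) (auto simp: upd_apply)
      then show ?thesis using 2(2) False by (simp add: rank_next_def fr j segment_Suc)
    next
      case True
      let ?u = "upd ''v'' 0 ?v u"
      have inv_u: "ranking_inv D n ?u (Vs \<union> segment s j) F"
        using 2(2) by (subst ranking_inv_cong[where t' = u]) (auto simp: upd_apply)
      have vB: "?v \<in> B" unfolding seg[symmetric] segment_def using True j by auto
      have Vs': "Vs \<union> segment s (Suc j) = insert ?v (Vs \<union> segment s j)"
        using True by (simp add: segment_Suc)
      have zero: "u ''rank'' ?v = 0 \<longleftrightarrow> ?v \<notin> Vs \<union> segment s j"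
        using 2(2) unfolding ranking_inv_def by blast
      have "ranking_inv D n (sem rank_next u) (Vs \<union> segment s (Suc j)) F"
      proof (cases "?v \<in> Vs \<union> segment s j")
        case True
        then have "sem rank_next u = ?u" using \<open>j < s ''len'' 0\<close> zero
          by (simp add: rank_next_def fr j upd_apply)
        moreover have "Vs \<union> segment s (Suc j) = Vs \<union> segment s j" using True Vs' by auto
        ultimately show ?thesis using inv_u by simp
      next
        case False
        then have "sem rank_next u = sem rank_vertex ?u" using \<open>j < s ''len'' 0\<close> zero
          by (simp add: rank_next_def fr j upd_apply)
        moreover have "ranking_inv (?u ''D'' 0) n (sem rank_vertex ?u)
            (insert (?u ''v'' 0) (Vs \<union> segment s j)) F"
        proof (rule ranking_inv_vertex)
          have seg': "segment ?u (?u ''D'' 0) = B" unfolding segu seg[symmetric] by (simp add: upd_apply Du)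
          show "ranking_inv (?u ''D'' 0) n ?u (Vs \<union> segment s j) F" using inv_u by (simp add: upd_apply Du)
          show "segment ?u (?u ''D'' 0) \<in> F" unfolding seg' by (rule B(1))
          show "?u ''v'' 0 < n" using vB B(2) by (auto simp: upd_apply)
          show "?u ''v'' 0 \<in> segment ?u (?u ''D'' 0)" unfolding seg' using vB by (simp add: upd_apply)
          show "?u ''v'' 0 \<notin> Vs \<union> segment s j" using False by (simp add: upd_apply)
          show "X = segment ?u (?u ''D'' 0)" if "X \<in> F" "?u ''v'' 0 \<in> X" for X
            unfolding seg' using old[OF that(1)] that(2) False by (auto simp: upd_apply)
        qed
        ultimately show ?thesis unfolding Vs' by (simp add: upd_apply Du)
      qed
      moreover have "ranking_inv D n (upd ''j'' 0 (Suc j) (sem rank_next u)) (Vs \<union> segment s (Suc j)) F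
          = ranking_inv D n (sem rank_next u) (Vs \<union> segment s (Suc j)) F"
        by (rule ranking_inv_cong) (auto simp: upd_apply)
      ultimately show ?thesis by simp
    qed
  qed
  moreover have "val (Var ''D'') s = D" by (simp add: s_def upd_apply D_def)
  moreover have "sem rank_bag t = sem (PFor ''j'' (Var ''D'') rank_next) s"
    by (simp add: rank_bag_eq s_def b_def bag_size_def upd_apply)
  ultimately show ?thesis using seg by simp
qed

text \<open>The premise \<open>rip\<close> is the running intersection property of the bags in
  search order.\<close>

lemma ranking_spec:
  fixes s :: store
  defines "D \<equiv> s ''D'' 0" and "nb \<equiv> s ''num_bags'' 0" and "Bs \<equiv> \<lambda>x. bag_set s (s ''order'' x)"
  assumes init: "s ''rank'' = (\<lambda>_. 0)" "s ''nbr'' = (\<lambda>_. 0)" "s ''par'' = (\<lambda>_. 0)" "s ''r'' 0 = 0"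
    and size: "\<And>x. x < nb \<Longrightarrow> s ''bag_start'' (Suc (s ''order'' x)) - s ''bag_start'' (s ''order'' x) \<le> D"
    and Bs: "\<And>x. x < nb \<Longrightarrow> Bs x \<subseteq> {..<n}"
    and rip: "\<And>x. x < nb \<Longrightarrow> 0 < x \<Longrightarrow> \<exists>y < x. \<forall>z < x. Bs z \<inter> Bs x \<subseteq> Bs y"
  shows "ranking_inv D n (sem ranking s) (\<Union>x<nb. Bs x) (Bs ` {..<nb})"
proof -
  let ?I = "\<lambda>i t. ranking_inv D n t (\<Union>x<i. Bs x) (Bs ` {..<i})"
  have "?I (val (Var ''num_bags'') s) (sem ranking s)"
    unfolding ranking_def
  proof (rule sem_For[where I = ?I], goal_cases)
    case 1
    show ?case
      by (simp add: ranking_inv_def ranked_def nb_set_def upd_apply init)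
  next
    case (2 i t)
    have fr: "t y = s y" if "y \<in> {''bag'', ''bag_start'', ''order'', ''D'', ''num_bags''}" for y
      using that by (intro 2(4)) (auto simp: rank_bag_def writes_rank_vertex)
    have i: "i < nb" "t ''i'' 0 = i" using 2(1,3) by (simp_all add: nb_def)
    have Bi: "bag_set t (t ''order'' (t ''i'' 0)) = Bs i"
      unfolding Bs_def i(2) using bag_set_cong[of t s] by (simp add: fr)
    have F: "Bs ` {..<Suc i} = insert (Bs i) (Bs ` {..<i})" by (auto simp: lessThan_Suc)
    have inv: "ranking_inv D n t (\<Union>x<i. Bs x) (Bs ` {..<Suc i})"
    proof -
      have rk: "\<And>u. t ''rank'' u \<noteq> 0 \<longleftrightarrow> u \<in> (\<Union>x<i. Bs x)" and prs: "\<And>X. X \<in> Bs ` {..<i} \<Longrightarrow> pairs D t X"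
        using 2(2) unfolding ranking_inv_def by auto
      \<comment> \<open>Two vertices of the new bag that have ranks already both belong to the
        parent bag \<open>Bs y\<close>, where they are paired.\<close>
      have "pairs D t (Bs i)"
        unfolding pairs_def
      proof (intro ballI impI)
        fix u w assume uw: "u \<in> Bs i" "w \<in> Bs i" "t ''rank'' u \<noteq> 0" "t ''rank'' u < t ''rank'' w"
        then obtain x z where xz: "x < i" "u \<in> Bs x" "z < i" "w \<in> Bs z"
          using rk[of u] rk[of w] by auto
        then obtain y where y: "y < i" "\<And>z. z < i \<Longrightarrow> Bs z \<inter> Bs i \<subseteq> Bs y"
          using rip[of i] i(1) by auto
        then have "u \<in> Bs y" "w \<in> Bs y" using xz uw by blast+
        then show "u \<in> nb_set D (t ''nbr'') w" using prs[of "Bs y"] y(1) uw unfolding pairs_def by auto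
      qed
      then show ?thesis using 2(2) unfolding F ranking_inv_def by auto
    qed
    have "ranking_inv (t ''D'' 0) n (sem rank_bag t)
        ((\<Union>x<i. Bs x) \<union> bag_set t (t ''order'' (t ''i'' 0))) (Bs ` {..<Suc i})"
    proof (rule rank_bag_spec, unfold Bi)
      show "ranking_inv (t ''D'' 0) n t (\<Union>x<i. Bs x) (Bs ` {..<Suc i})"
        using inv by (simp add: fr D_def)
      show "Bs i \<in> Bs ` {..<Suc i}" by simp
      show "Bs i \<subseteq> {..<n}" by (rule Bs[OF i(1)])
      show "X \<subseteq> (\<Union>x<i. Bs x)" if "X \<in> Bs ` {..<Suc i}" "X \<noteq> Bs i" for X
        using that by (auto simp: less_Suc_eq)
      show "t ''bag_start'' (Suc (t ''order'' (t ''i'' 0))) - t ''bag_start'' (t ''order'' (t ''i'' 0)) \<le> t ''D'' 0"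
        using size[OF i(1)] by (simp add: fr i D_def)
    qed
    moreover have "(\<Union>x<i. Bs x) \<union> Bs i = (\<Union>x<Suc i. Bs x)" by (auto simp: less_Suc_eq)
    moreover have "ranking_inv D n (upd ''i'' 0 (Suc i) (sem rank_bag t)) (\<Union>x<Suc i. Bs x) (Bs ` {..<Suc i})
        = ranking_inv D n (sem rank_bag t) (\<Union>x<Suc i. Bs x) (Bs ` {..<Suc i})"
      by (rule ranking_inv_cong) (auto simp: upd_apply)
    ultimately show ?case unfolding Bi by (simp add: fr D_def)
  qed
  then show ?thesis by (simp add: nb_def)
qed

section \<open>Tables and their masks\<close>

text \<open>For loops that only set flags, the result is a disjunction over the passes. The body may
  use the description of the flags set so far; this shows that the rows it reads are still
  unchanged.\<close>

lemma accumulate_For: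
  fixes obs :: "store \<Rightarrow> 'z \<Rightarrow> bool"
  assumes counter: "\<And>k t. obs (upd x 0 k t) = obs t"
    and body: "\<And>i t z. i < val e s \<Longrightarrow> t x 0 = i \<Longrightarrow> (\<And>y. y \<notin> insert x (writes p) \<Longrightarrow> t y = s y) \<Longrightarrow>
      (\<And>z. obs t z \<longleftrightarrow> obs s z \<or> (\<exists>j < i. A j z)) \<Longrightarrow> obs (sem p t) z \<longleftrightarrow> obs t z \<or> A i z"
  shows "obs (sem (PFor x e p) s) z \<longleftrightarrow> obs s z \<or> (\<exists>i < val e s. A i z)"
proof -
  let ?I = "\<lambda>i t. \<forall>z. obs t z \<longleftrightarrow> obs s z \<or> (\<exists>j < i. A j z)"
  have "?I (val e s) (sem (PFor x e p) s)"
  proof (rule sem_For[where I = ?I], goal_cases)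
    case 1
    show ?case by (simp add: counter)
  next
    case (2 i t)
    show ?case using body[OF 2(1) 2(3) 2(4)] 2(2) by (auto simp: counter less_Suc_eq)
  qed
  then show ?thesis by simp
qed

lemma cell_inj:
  fixes a b :: nat
  assumes "a < D" "b < D" "a' < D" "b' < D"
  shows "(v * D + a) * D + b = (v' * D + a') * D + b' \<longleftrightarrow> v = v' \<and> a = a' \<and> b = b'"
  using row_inj[OF assms(2,4)] row_inj[OF assms(1,3)] by auto

lemma bit_value: "(m div 2 ^ a) mod 2 = (of_bool (bit m a) :: nat)"
  by (simp add: bit_iff_odd mod_2_eq_odd)

lemma set_unset_bit: "set_bit c m = unset_bit c m + 2 ^ c" for m :: nat
proof -
  have "set_bit c (unset_bit c m) = set_bit c m"
    by (rule bit_eqI) (auto simp: bit_set_bit_iff bit_unset_bit_iff)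
  then show ?thesis using set_bit_eq[of c "unset_bit c m"] by (simp add: bit_unset_bit_iff)
qed

lemma unset_bit_nat: "unset_bit c m = m - of_bool (bit m c) * 2 ^ c" for m :: nat
proof (cases "bit m c")
  case True
  have "set_bit c m = m" by (rule bit_eqI) (use True in \<open>auto simp: bit_set_bit_iff\<close>)
  then show ?thesis using set_unset_bit[of c m] True by simp
next
  case False
  have "unset_bit c m = m" by (rule bit_eqI) (use False in \<open>auto simp: bit_unset_bit_iff\<close>)
  then show ?thesis using False by simp
qed

lemma set_bit_less: "m < 2 ^ D \<Longrightarrow> c < D \<Longrightarrow> set_bit c m < 2 ^ D" for m :: nat
  by (metis leD take_bit_nat_eq_self_iff take_bit_set_bit_eq)

lemma unset_bit_less: "m < 2 ^ D \<Longrightarrow> unset_bit c m < 2 ^ D" for m :: nat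
  by (simp add: unset_bit_nat)

lemma single_cell:
  fixes f :: "nat \<Rightarrow> nat"
  assumes "a < D" "b < D"
  shows "a' < D \<and> b' < D \<and> (f((v * D + a) * D + b := 1)) ((v' * D + a') * D + b') \<noteq> 0 \<longleftrightarrow>
    a' < D \<and> b' < D \<and> f ((v' * D + a') * D + b') \<noteq> 0 \<or> v' = v \<and> a' = a \<and> b' = b"
  using assms by (auto simp: cell_inj)

section \<open>The arrays of a complete ranking as an elimination order\<close>

locale ranking_arrays =
  fixes n D :: nat and rank col nt par vert :: "nat \<Rightarrow> nat" and E :: "nat rel" and VP :: "nat set"
  assumes E_sub: "E \<subseteq> {..<n} \<times> {..<n}"
    and rank: "v < n \<Longrightarrow> 0 < rank v \<and> rank v \<le> n \<and> vert (rank v - 1) = v"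
    and vert: "i < n \<Longrightarrow> vert i < n \<and> rank (vert i) = Suc i"
    and nt: "a < D \<Longrightarrow> nt (v * D + a) = Suc u \<Longrightarrow> u < n \<and> rank u < rank v \<and> col u = a"
    and col: "v < n \<Longrightarrow> col v < D \<and> nt (v * D + col v) = 0"
    and par: "nb_set D nt v = {} \<and> par v = 0 \<or>
      (\<exists>p \<in> nb_set D nt v. par v = Suc p \<and> (\<forall>u \<in> nb_set D nt v. rank u \<le> rank p))"
    and arc_nb: "(x, y) \<in> E \<or> (y, x) \<in> E \<Longrightarrow> rank x < rank y \<Longrightarrow> x \<in> nb_set D nt y"
    and nb_clique: "v < n \<Longrightarrow> u \<in> nb_set D nt v \<Longrightarrow> w \<in> nb_set D nt v \<Longrightarrow> rank u < rank w \<Longrightarrow> u \<in> nb_set D nt w"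
begin

abbreviation "nb \<equiv> nb_set D nt"

lemma nb_D: "u \<in> nb v \<Longrightarrow> u < n \<and> rank u < rank v"
  using nt by (auto simp: nb_set_def)

lemma nt_iff:
  assumes "a < D"
  shows "nt (v * D + a) = Suc u \<longleftrightarrow> u \<in> nb v \<and> col u = a"
  using assms nt unfolding nb_set_def by blast

lemma rank_inj: "u < n \<Longrightarrow> v < n \<Longrightarrow> rank u = rank v \<Longrightarrow> u = v"
  using rank by metis

definition pos :: "nat \<Rightarrow> nat" where
  "pos v = rank v - 1"

sublocale elimination "{..<n}" E VP n pos vert nb
proof (unfold_locales, unfold pos_def, goal_cases)
  case 1 show ?case by (rule E_sub)
next
  case (2 v) then show ?case using rank[of v] by auto
next
  case (3 u v) then show ?case using rank[of v] rank[of u] rank_inj[of u v] by auto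
next
  case (4 i) then show ?case using vert by auto
next
  case (5 i) then show ?case using vert by auto
next
  case (6 v u) then show ?case using nb_D[of u v] rank[of u] by auto
next
  case (7 x y) then show ?case using arc_nb[of x y] by auto
next
  case (8 v u w) then show ?case using nb_clique[of v u w] by auto
qed

abbreviation "X v \<equiv> insert v (nb v)"

lemma X_sub: "v < n \<Longrightarrow> u \<in> X v \<Longrightarrow> u < n"
  using nb_D by blast

text \<open>By the clique property the earlier of two vertices in \<open>X v\<close> is a neighbour
  of the later one and is stored under its colour there, but the later vertex keeps the cell of its
  own colour empty.\<close>

lemma col_inj:
  assumes v: "v < n" and u: "u \<in> X v" and w: "w \<in> X v" and eq: "col u = col w"
  shows "u = w"
proof (rule ccontr)
  assume ne: "u \<noteq> w"
  have *: False if "x \<in> X v" "y \<in> X v" "col x = col y" "rank x < rank y" for x y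
  proof -
    have y: "y < n" using X_sub[OF v that(2)] .
    have "x \<noteq> v" using that nb_D by fastforce
    then have "x \<in> nb y" using that nb_clique[OF v, of x y] by auto
    then show False using nt_iff[of "col y" y x] that(3) col[OF y] by auto
  qed
  have "rank u \<noteq> rank w" using rank_inj[of u w] X_sub[OF v] u w ne by blast
  then show False using *[OF u w eq] *[OF w u eq[symmetric]] by linarith
qed

text \<open>A mask denotes all vertices of its colours in the whole graph, not only those of some
  \<open>X v\<close>. Hence the same number \<open>m\<close> serves at \<open>v\<close> and at its
  parent without translation; the tables only look at the part of \<open>S m\<close> inside
  \<open>X v\<close>, where colours are unambiguous.\<close>

definition S :: "nat \<Rightarrow> nat set" where
  "S m = {u. u < n \<and> bit m (col u)}"

text \<open>The values on which all passes after the ranking rely and which none of them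
  overwrites.\<close>

definition fixed :: "store \<Rightarrow> bool" where
  "fixed t \<longleftrightarrow> t ''D'' 0 = D \<and> t ''P'' 0 = 2 ^ D \<and> (\<forall>a \<le> D. t ''pw'' a = 2 ^ a) \<and> t ''n'' 0 = n \<and>
     t ''rank'' = rank \<and> t ''col'' = col \<and> t ''nbr'' = nt \<and> t ''par'' = par \<and> t ''vert'' = vert"

lemma fixedD:
  assumes "fixed t"
  shows "t ''D'' 0 = D" "t ''P'' 0 = 2 ^ D" "a < D \<Longrightarrow> t ''pw'' a = 2 ^ a" "t ''n'' 0 = n"
    "t ''rank'' = rank" "t ''col'' = col" "t ''nbr'' = nt" "t ''par'' = par" "t ''vert'' = vert"
  using assms by (auto simp: fixed_def)

lemma fixed_cong:
  assumes "\<And>y. y \<in> {''D'', ''P'', ''pw'', ''n'', ''rank'', ''col'', ''nbr'', ''par'', ''vert''} \<Longrightarrow> t y = s y"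
  shows "fixed t = fixed s"
  using assms by (simp add: fixed_def)

lemma pos_le_iff: "x < n \<Longrightarrow> y < n \<Longrightarrow> pos x \<le> pos y \<longleftrightarrow> rank x \<le> rank y"
  using rank[of x] rank[of y] by (auto simp: pos_def)

lemma own_arcs_iff:
  assumes "(x, y) \<in> E"
  shows "(x, y) \<in> own_arcs v \<longleftrightarrow> v = (if rank x < rank y then y else x)"
proof -
  have "x < n" "y < n" using assms E_sub by auto
  then show ?thesis using assms rank_inj[of x y]
    by (auto simp: own_arcs_def pos_le_iff)
qed

text \<open>The image of a relation under \<open>col\<close>. For relations on \<open>X v\<close>
  nothing is lost, as \<open>col\<close> is injective there.\<close>

definition coloured :: "nat rel \<Rightarrow> nat \<Rightarrow> nat \<Rightarrow> bool" where
  "coloured R a b \<longleftrightarrow> (\<exists>(x, y) \<in> R. col x = a \<and> col y = b)"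

definition arc_step :: prog where
  "arc_step = (''x'' ::= Read ''arc_tail'' (Var ''i'') ;; ''y'' ::= Read ''arc_head'' (Var ''i'') ;;
      PIf (Read ''rank'' (Var ''x'') [<] Read ''rank'' (Var ''y'')) (''v'' ::= Var ''y'') (''v'' ::= Var ''x'') ;;
      PWrite ''adj'' (cell3 (Var ''v'') (Read ''col'' (Var ''x'')) (Read ''col'' (Var ''y''))) (Const 1) ;;
      when (Read ''is_random'' (Var ''x''))
       (PWrite ''ran'' (cell3 (Var ''v'') (Read ''col'' (Var ''x'')) (Read ''col'' (Var ''y''))) (Const 1)))"

lemma own_arcs_table_eq: "own_arcs_table = PFor ''i'' (Var ''num_arcs'') arc_step"
  by (simp add: own_arcs_table_def arc_step_def)

lemma own_arcs_table_spec:
  assumes c: "fixed s" and init: "s ''adj'' = (\<lambda>_. 0)" "s ''ran'' = (\<lambda>_. 0)"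
    and arcs: "E = (\<lambda>e. (s ''arc_tail'' e, s ''arc_head'' e)) ` {..<s ''num_arcs'' 0}"
    and random: "\<And>x. x < n \<Longrightarrow> s ''is_random'' x \<noteq> 0 \<longleftrightarrow> x \<in> VP"
    and ab: "a < D" "b < D"
  shows "sem own_arcs_table s ''adj'' ((v * D + a) * D + b) \<noteq> 0 \<longleftrightarrow> coloured (own_arcs v) a b"
    and "sem own_arcs_table s ''ran'' ((v * D + a) * D + b) \<noteq> 0 \<longleftrightarrow>
      coloured {(x, y) \<in> own_arcs v. x \<in> VP} a b"
proof -
  let ?x = "\<lambda>e. s ''arc_tail'' e" and ?y = "\<lambda>e. s ''arc_head'' e"
  let ?own = "\<lambda>e. if rank (?x e) < rank (?y e) then ?y e else ?x e"
  \<comment> \<open>The bounds on \<open>a\<close> and \<open>b\<close> belong to the observation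
    because addresses determine the cell only for colours below \<open>D\<close>.\<close>
  let ?obs = "\<lambda>nm (t :: store) (v, a, b). a < D \<and> b < D \<and> t nm ((v * D + a) * D + b) \<noteq> 0"
  let ?A = "\<lambda>e (v, a, b). v = ?own e \<and> a = col (?x e) \<and> b = col (?y e)"
  have E: "(?x e, ?y e) \<in> E" if "e < s ''num_arcs'' 0" for e using that unfolding arcs by auto
  have step: "sem arc_step t ''adj'' = (t ''adj'')((?own i * D + col (?x i)) * D + col (?y i) := 1)"
    "sem arc_step t ''ran'' = (if ?x i \<in> VP then (t ''ran'')((?own i * D + col (?x i)) * D + col (?y i) := 1) else t ''ran'')"
    if "i < s ''num_arcs'' 0" "t ''i'' 0 = i" and fr: "\<And>y. y \<notin> insert ''i'' (writes arc_step) \<Longrightarrow> t y = s y" for t i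
  proof -
    have frs: "t y = s y" if "y \<in> {''arc_tail'', ''arc_head'', ''rank'', ''col'', ''is_random'', ''D''}" for y
      by (rule fr) (use that in \<open>auto simp: arc_step_def\<close>)
    have "?x i < n" using E[OF that(1)] E_sub by auto
    note rnd = random[OF this]
    show "sem arc_step t ''adj'' = (t ''adj'')((?own i * D + col (?x i)) * D + col (?y i) := 1)"
      using that(2) fixedD(1,5,6)[OF c]
      by (cases "rank (?x i) < rank (?y i)") (simp_all add: arc_step_def cell3_def upd_apply frs)
    show "sem arc_step t ''ran'' = (if ?x i \<in> VP then (t ''ran'')((?own i * D + col (?x i)) * D + col (?y i) := 1) else t ''ran'')"
      using that(2) fixedD(1,5,6)[OF c] rnd
      by (cases "rank (?x i) < rank (?y i)"; cases "?x i \<in> VP")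
         (simp_all add: arc_step_def cell3_def upd_apply frs)
  qed
  have cols: "col (?x i) < D" "col (?y i) < D" if "i < s ''num_arcs'' 0" for i
    using E[OF that] E_sub col by auto
  have "?obs ''adj'' (sem own_arcs_table s) z \<longleftrightarrow> ?obs ''adj'' s z \<or> (\<exists>i < val (Var ''num_arcs'') s. ?A i z)" for z
    unfolding own_arcs_table_eq
  proof (rule accumulate_For[where obs = "?obs ''adj''" and A = ?A], goal_cases)
    case (2 i t z)
    have i: "i < s ''num_arcs'' 0" using 2(1) by simp
    obtain v a b where z: "z = (v, a, b)" by (cases z)
    have st: "sem arc_step t ''adj'' = (t ''adj'')((?own i * D + col (?x i)) * D + col (?y i) := 1)"
      by (rule step(1)[where i = i and t = t], rule i, rule 2(2), erule 2(3))
    show ?case unfolding st z prod.case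
      by (rule single_cell[OF cols[OF i]])
  qed (simp add: upd_apply)
  from this[of "(v, a, b)"]
  have "sem own_arcs_table s ''adj'' ((v * D + a) * D + b) \<noteq> 0 \<longleftrightarrow>
      (\<exists>i < s ''num_arcs'' 0. v = ?own i \<and> a = col (?x i) \<and> b = col (?y i))"
    using ab init by simp
  also have "\<dots> \<longleftrightarrow> (\<exists>i < s ''num_arcs'' 0. (?x i, ?y i) \<in> own_arcs v \<and> a = col (?x i) \<and> b = col (?y i))"
    using own_arcs_iff[OF E] by blast
  also have "\<dots> \<longleftrightarrow> (\<exists>(x, y) \<in> E. (x, y) \<in> own_arcs v \<and> a = col x \<and> b = col y)"
    unfolding arcs by (simp add: Bex_def)
  also have "\<dots> \<longleftrightarrow> coloured (own_arcs v) a b" unfolding coloured_def own_arcs_def by auto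
  finally show "sem own_arcs_table s ''adj'' ((v * D + a) * D + b) \<noteq> 0 \<longleftrightarrow> coloured (own_arcs v) a b" .
  let ?A' = "\<lambda>e z. ?A e z \<and> ?x e \<in> VP"
  have "?obs ''ran'' (sem own_arcs_table s) z \<longleftrightarrow> ?obs ''ran'' s z \<or> (\<exists>i < val (Var ''num_arcs'') s. ?A' i z)" for z
    unfolding own_arcs_table_eq
  proof (rule accumulate_For[where obs = "?obs ''ran''" and A = ?A'], goal_cases)
    case (2 i t z)
    have i: "i < s ''num_arcs'' 0" using 2(1) by simp
    obtain v a b where z: "z = (v, a, b)" by (cases z)
    have st: "sem arc_step t ''ran'' = (if ?x i \<in> VP then (t ''ran'')((?own i * D + col (?x i)) * D + col (?y i) := 1) else t ''ran'')"
      by (rule step(2)[where i = i and t = t], rule i, rule 2(2), erule 2(3))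
    show ?case
    proof (cases "?x i \<in> VP")
      case True
      show ?thesis unfolding st z prod.case if_P[OF True]
        using single_cell[OF cols[OF i], of a b "t ''ran''" "?own i" v] True by simp
    next
      case False
      show ?thesis unfolding st z prod.case if_not_P[OF False] using False by simp
    qed
  qed (simp add: upd_apply)
  from this[of "(v, a, b)"]
  have "sem own_arcs_table s ''ran'' ((v * D + a) * D + b) \<noteq> 0 \<longleftrightarrow>
      (\<exists>i < s ''num_arcs'' 0. (v = ?own i \<and> a = col (?x i) \<and> b = col (?y i)) \<and> ?x i \<in> VP)"
    using ab init by simp
  also have "\<dots> \<longleftrightarrow> (\<exists>i < s ''num_arcs'' 0. ((?x i, ?y i) \<in> own_arcs v \<and> a = col (?x i) \<and> b = col (?y i)) \<and> ?x i \<in> VP)"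
    using own_arcs_iff[OF E] by blast
  also have "\<dots> \<longleftrightarrow> (\<exists>(x, y) \<in> E. ((x, y) \<in> own_arcs v \<and> a = col x \<and> b = col y) \<and> x \<in> VP)"
    unfolding arcs by (simp add: Bex_def)
  also have "\<dots> \<longleftrightarrow> coloured {(x, y) \<in> own_arcs v. x \<in> VP} a b" unfolding coloured_def own_arcs_def by auto
  finally show "sem own_arcs_table s ''ran'' ((v * D + a) * D + b) \<noteq> 0 \<longleftrightarrow>
      coloured {(x, y) \<in> own_arcs v. x \<in> VP} a b" .
qed

end

section \<open>Filling the base tables\<close>

abbreviation row :: "store \<Rightarrow> nat \<Rightarrow> nat \<Rightarrow> nat" where
  "row t v m \<equiv> v * t ''P'' 0 + m"

definition rel_at :: "nat \<Rightarrow> store \<Rightarrow> nat \<times> nat \<times> nat \<Rightarrow> bool" where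
  "rel_at D t = (\<lambda>(q, a, b). a < D \<and> b < D \<and> t ''rel'' ((q * D + a) * D + b) \<noteq> 0)"

definition bad_at :: "store \<Rightarrow> nat \<Rightarrow> bool" where
  "bad_at t q \<longleftrightarrow> t ''bad'' q \<noteq> 0"

lemma rel_at_upd: "x \<noteq> ''rel'' \<Longrightarrow> rel_at D (upd x i k t) = rel_at D t"
  by (simp add: rel_at_def upd_apply)

lemma bad_at_upd: "x \<noteq> ''bad'' \<Longrightarrow> bad_at (upd x i k t) = bad_at t"
  by (simp add: bad_at_def upd_apply fun_eq_iff)

lemma rel_at_write:
  "a < D \<Longrightarrow> b < D \<Longrightarrow> rel_at D (upd ''rel'' ((q * D + a) * D + b) (Suc 0) t) z \<longleftrightarrow> rel_at D t z \<or> z = (q, a, b)"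
  by (cases z) (auto simp: rel_at_def upd_apply cell_inj)

lemma bad_at_write: "bad_at (upd ''bad'' q (Suc 0) t) q' \<longleftrightarrow> bad_at t q' \<or> q' = q"
  by (simp add: bad_at_def upd_apply)

definition base_inner :: prog where
  "base_inner = PIf (bit_e (Var ''m'') (Var ''b''))
         (when (Read ''adj'' (cell3 (Var ''v'') (Var ''a'') (Var ''b'')))
           (PWrite ''rel'' (cell4 (Var ''v'') (Var ''m'') (Var ''a'') (Var ''b'')) (Const 1)))
         (when (Read ''ran'' (cell3 (Var ''v'') (Var ''a'') (Var ''b'')))
           (PWrite ''bad'' (cell2 (Var ''v'') (Var ''m'')) (Const 1)))"

lemma base_cell_eq:
  "base_cell = PFor ''a'' (Var ''D'') (when (bit_e (Var ''m'') (Var ''a'')) (PFor ''b'' (Var ''D'') base_inner))"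
  by (simp add: base_cell_def base_inner_def)

lemma writes_base_inner: "writes base_inner = {''rel'', ''bad''}"
  by (auto simp: base_inner_def)

lemma writes_base_cell: "writes base_cell = {''a'', ''b'', ''rel'', ''bad''}"
  by (auto simp: base_cell_eq writes_base_inner)

context ranking_arrays
begin

lemma fixed_frame:
  assumes "fixed s"
    and "\<And>y. y \<in> {''D'', ''P'', ''pw'', ''n'', ''rank'', ''col'', ''nbr'', ''par'', ''vert''} \<Longrightarrow> t y = s y"
  shows "fixed t"
  using assms fixed_cong[of t s] by blast

lemma base_inner_step:
  fixes t :: store
  assumes c: "fixed t" and ab: "t ''a'' 0 < D" "t ''b'' 0 < D"
  defines "a \<equiv> t ''a'' 0" and "b \<equiv> t ''b'' 0" and "q \<equiv> row t (t ''v'' 0) (t ''m'' 0)"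
  shows "rel_at D (sem base_inner t) z \<longleftrightarrow> rel_at D t z \<or>
      bit (t ''m'' 0) b \<and> t ''adj'' ((t ''v'' 0 * D + a) * D + b) \<noteq> 0 \<and> z = (q, a, b)"
    and "bad_at (sem base_inner t) q' \<longleftrightarrow> bad_at t q' \<or>
      \<not> bit (t ''m'' 0) b \<and> t ''ran'' ((t ''v'' 0 * D + a) * D + b) \<noteq> 0 \<and> q' = q"
proof -
  note f = fixedD(1,2)[OF c] fixedD(3)[OF c ab(2)]
  have "val (bit_e (Var ''m'') (Var ''b'')) t = of_bool (bit (t ''m'' 0) b)"
    by (simp add: bit_e_def f b_def bit_value)
  moreover have "val (cell3 (Var ''v'') (Var ''a'') (Var ''b'')) t = (t ''v'' 0 * D + a) * D + b"
    by (simp add: cell3_def f a_def b_def)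
  moreover have "val (cell4 (Var ''v'') (Var ''m'') (Var ''a'') (Var ''b'')) t = (q * D + a) * D + b"
    by (simp add: cell4_def cell3_def cell2_def f a_def b_def q_def)
  moreover have "val (cell2 (Var ''v'') (Var ''m'')) t = q" by (simp add: cell2_def q_def f)
  ultimately show "rel_at D (sem base_inner t) z \<longleftrightarrow> rel_at D t z \<or>
      bit (t ''m'' 0) b \<and> t ''adj'' ((t ''v'' 0 * D + a) * D + b) \<noteq> 0 \<and> z = (q, a, b)"
    and "bad_at (sem base_inner t) q' \<longleftrightarrow> bad_at t q' \<or>
      \<not> bit (t ''m'' 0) b \<and> t ''ran'' ((t ''v'' 0 * D + a) * D + b) \<noteq> 0 \<and> q' = q"
    using ab rel_at_write[of a D b q t z]
    by (simp_all add: base_inner_def rel_at_upd bad_at_upd bad_at_write a_def[symmetric] b_def[symmetric])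
qed

lemma base_cell_spec:
  fixes s :: store
  assumes c: "fixed s"
  defines "v \<equiv> s ''v'' 0" and "m \<equiv> s ''m'' 0" and "q \<equiv> row s (s ''v'' 0) (s ''m'' 0)"
  shows "rel_at D (sem base_cell s) z \<longleftrightarrow> rel_at D s z \<or>
      (\<exists>a < D. \<exists>b < D. bit m a \<and> bit m b \<and> s ''adj'' ((v * D + a) * D + b) \<noteq> 0 \<and> z = (q, a, b))"
    and "bad_at (sem base_cell s) q' \<longleftrightarrow> bad_at s q' \<or>
      (\<exists>a < D. \<exists>b < D. bit m a \<and> \<not> bit m b \<and> s ''ran'' ((v * D + a) * D + b) \<noteq> 0 \<and> q' = q)"
proof -
  let ?p = "PFor ''b'' (Var ''D'') base_inner"
  have inner: "rel_at D (sem ?p t) z \<longleftrightarrow> rel_at D t z \<or>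
      (\<exists>b < D. bit m b \<and> s ''adj'' ((v * D + a) * D + b) \<noteq> 0 \<and> z = (q, a, b))"
    "bad_at (sem ?p t) q' \<longleftrightarrow> bad_at t q' \<or>
      (\<exists>b < D. \<not> bit m b \<and> s ''ran'' ((v * D + a) * D + b) \<noteq> 0 \<and> q' = q)"
    if a: "a < D" "t ''a'' 0 = a" and fr: "\<And>y. y \<notin> {''a'', ''b'', ''rel'', ''bad''} \<Longrightarrow> t y = s y" for a t z q'
  proof -
    have ct: "fixed t" by (rule fixed_frame[OF c], rule fr) auto
    have "rel_at D (sem ?p t) z \<longleftrightarrow> rel_at D t z \<or>
      (\<exists>b < val (Var ''D'') t. bit m b \<and> s ''adj'' ((v * D + a) * D + b) \<noteq> 0 \<and> z = (q, a, b))" for z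
    proof (rule accumulate_For[where obs = "rel_at D"], goal_cases)
      case (2 b u z)
      have fu: "u y = s y" if "y \<notin> {''a'', ''b'', ''rel'', ''bad''}" for y
        using 2(3)[of y] fr[of y] that by (simp add: writes_base_inner)
      have cu: "fixed u" by (rule fixed_frame[OF c], rule fu) auto
      have ua: "u ''a'' 0 = a" using 2(3)[of "''a''"] a by (simp add: writes_base_inner)
      have b: "u ''b'' 0 < D" using 2(1,2) fixedD[OF ct] by simp
      show ?case
        using base_inner_step(1)[OF cu _ b, of z] a ua 2(2) by (simp add: fu v_def m_def q_def)
    qed (simp add: rel_at_upd)
    then show "rel_at D (sem ?p t) z \<longleftrightarrow> rel_at D t z \<or>
      (\<exists>b < D. bit m b \<and> s ''adj'' ((v * D + a) * D + b) \<noteq> 0 \<and> z = (q, a, b))"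
      using fixedD[OF ct] by simp
    have "bad_at (sem ?p t) z \<longleftrightarrow> bad_at t z \<or>
      (\<exists>b < val (Var ''D'') t. \<not> bit m b \<and> s ''ran'' ((v * D + a) * D + b) \<noteq> 0 \<and> z = q)" for z
    proof (rule accumulate_For[where obs = "bad_at"], goal_cases)
      case (2 b u z)
      have fu: "u y = s y" if "y \<notin> {''a'', ''b'', ''rel'', ''bad''}" for y
        using 2(3)[of y] fr[of y] that by (simp add: writes_base_inner)
      have cu: "fixed u" by (rule fixed_frame[OF c], rule fu) auto
      have ua: "u ''a'' 0 = a" using 2(3)[of "''a''"] a by (simp add: writes_base_inner)
      have b: "u ''b'' 0 < D" using 2(1,2) fixedD[OF ct] by simp
      show ?case
        using base_inner_step(2)[OF cu _ b, of z] a ua 2(2) by (simp add: fu v_def m_def q_def)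
    qed (simp add: bad_at_upd)
    then show "bad_at (sem ?p t) q' \<longleftrightarrow> bad_at t q' \<or>
      (\<exists>b < D. \<not> bit m b \<and> s ''ran'' ((v * D + a) * D + b) \<noteq> 0 \<and> q' = q)"
      using fixedD[OF ct] by simp
  qed
  have guard: "sem (when (bit_e (Var ''m'') (Var ''a'')) ?p) t = (if bit m a then sem ?p t else t)"
    if a: "a < D" "t ''a'' 0 = a" and fr: "\<And>y. y \<notin> {''a'', ''b'', ''rel'', ''bad''} \<Longrightarrow> t y = s y" for a t
    using a fixedD(3)[OF c a(1)] by (simp add: bit_e_def fr m_def bit_value del: sem.simps(5))
  have "rel_at D (sem base_cell s) z \<longleftrightarrow> rel_at D s z \<or>
      (\<exists>a < val (Var ''D'') s. \<exists>b < D. bit m a \<and> bit m b \<and> s ''adj'' ((v * D + a) * D + b) \<noteq> 0 \<and> z = (q, a, b))" for z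
    unfolding base_cell_eq
  proof (rule accumulate_For[where obs = "rel_at D"], goal_cases)
    case (2 a t z)
    have fr: "t y = s y" if "y \<notin> {''a'', ''b'', ''rel'', ''bad''}" for y
      using that by (intro 2(3)) (auto simp: writes_base_inner)
    have a: "a < D" using 2(1) fixedD[OF c] by simp
    have g: "sem (when (bit_e (Var ''m'') (Var ''a'')) ?p) t = (if bit m a then sem ?p t else t)"
      by (rule guard[of a t], rule a, rule 2(2), rule fr)
    have "rel_at D (sem ?p t) z \<longleftrightarrow> rel_at D t z \<or>
      (\<exists>b < D. bit m b \<and> s ''adj'' ((v * D + a) * D + b) \<noteq> 0 \<and> z = (q, a, b))"
      by (rule inner(1)[of a t], rule a, rule 2(2), rule fr)
    then show ?case unfolding g by (cases "bit m a") (simp_all del: sem.simps)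
  qed (simp add: rel_at_upd)
  then show "rel_at D (sem base_cell s) z \<longleftrightarrow> rel_at D s z \<or>
      (\<exists>a < D. \<exists>b < D. bit m a \<and> bit m b \<and> s ''adj'' ((v * D + a) * D + b) \<noteq> 0 \<and> z = (q, a, b))"
    using fixedD[OF c] by simp
  have "bad_at (sem base_cell s) z \<longleftrightarrow> bad_at s z \<or>
      (\<exists>a < val (Var ''D'') s. \<exists>b < D. bit m a \<and> \<not> bit m b \<and> s ''ran'' ((v * D + a) * D + b) \<noteq> 0 \<and> z = q)" for z
    unfolding base_cell_eq
  proof (rule accumulate_For[where obs = "bad_at"], goal_cases)
    case (2 a t z)
    have fr: "t y = s y" if "y \<notin> {''a'', ''b'', ''rel'', ''bad''}" for y
      using that by (intro 2(3)) (auto simp: writes_base_inner)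
    have a: "a < D" using 2(1) fixedD[OF c] by simp
    have g: "sem (when (bit_e (Var ''m'') (Var ''a'')) ?p) t = (if bit m a then sem ?p t else t)"
      by (rule guard[of a t], rule a, rule 2(2), rule fr)
    have "bad_at (sem ?p t) z \<longleftrightarrow> bad_at t z \<or>
      (\<exists>b < D. \<not> bit m b \<and> s ''ran'' ((v * D + a) * D + b) \<noteq> 0 \<and> z = q)"
      by (rule inner(2)[of a t], rule a, rule 2(2), rule fr)
    then show ?case unfolding g by (cases "bit m a") (simp_all del: sem.simps)
  qed (simp add: bad_at_upd)
  then show "bad_at (sem base_cell s) q' \<longleftrightarrow> bad_at s q' \<or>
      (\<exists>a < D. \<exists>b < D. bit m a \<and> \<not> bit m b \<and> s ''ran'' ((v * D + a) * D + b) \<noteq> 0 \<and> q' = q)"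
    using fixedD[OF c] by simp
qed

definition represents :: "store \<Rightarrow> nat tables \<Rightarrow> bool" where
  "represents t \<sigma> \<longleftrightarrow> (\<forall>v < n. \<forall>m < 2 ^ D.
     (bad_at t (v * 2 ^ D + m) \<longleftrightarrow> fst \<sigma> v (S m)) \<and>
     (\<forall>a < D. \<forall>b < D. rel_at D t (v * 2 ^ D + m, a, b) \<longleftrightarrow> coloured (snd \<sigma> v (S m)) a b))"

lemma base_tables_spec:
  assumes c: "fixed s" and init: "s ''rel'' = (\<lambda>_. 0)" "s ''bad'' = (\<lambda>_. 0)"
    and adj: "\<And>v a b. a < D \<Longrightarrow> b < D \<Longrightarrow>
      s ''adj'' ((v * D + a) * D + b) \<noteq> 0 \<longleftrightarrow> coloured (own_arcs v) a b"
    and ran: "\<And>v a b. a < D \<Longrightarrow> b < D \<Longrightarrow>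
      s ''ran'' ((v * D + a) * D + b) \<noteq> 0 \<longleftrightarrow> coloured {(x, y) \<in> own_arcs v. x \<in> VP} a b"
  shows "represents (sem base_tables s) base"
proof -
  let ?A = "\<lambda>v m z. \<exists>a < D. \<exists>b < D. bit m a \<and> bit m b \<and> coloured (own_arcs v) a b \<and> z = (v * 2 ^ D + m, a, b)"
  let ?B = "\<lambda>v m z. \<exists>a < D. \<exists>b < D. bit m a \<and> \<not> bit m b \<and> coloured {(x, y) \<in> own_arcs v. x \<in> VP} a b \<and> z = v * 2 ^ D + m"
  let ?W = "{''v'', ''m'', ''a'', ''b'', ''rel'', ''bad''}"
  have masks: "rel_at D (sem (PFor ''m'' (Var ''P'') base_cell) t) z \<longleftrightarrow> rel_at D t z \<or> (\<exists>m < 2 ^ D. ?A v m z)"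
    "bad_at (sem (PFor ''m'' (Var ''P'') base_cell) t) q \<longleftrightarrow> bad_at t q \<or> (\<exists>m < 2 ^ D. ?B v m q)"
    if v: "t ''v'' 0 = v" and fr: "\<And>y. y \<notin> ?W \<Longrightarrow> t y = s y" for t v z q
  proof -
    have ct: "fixed t" by (rule fixed_frame[OF c], rule fr) auto
    have st: "rel_at D (sem base_cell u) z \<longleftrightarrow> rel_at D u z \<or> ?A v m z"
      "bad_at (sem base_cell u) q \<longleftrightarrow> bad_at u q \<or> ?B v m q"
      if m: "u ''m'' 0 = m" and fu': "\<And>y. y \<notin> {''m'', ''a'', ''b'', ''rel'', ''bad''} \<Longrightarrow> u y = t y" for u m z q
    proof -
      have fu: "u y = s y" if "y \<notin> ?W" for y using fu'[of y] fr[of y] that by simp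
      have cu: "fixed u" by (rule fixed_frame[OF c], rule fu) auto
      have uv: "u ''v'' 0 = v" using fu'[of "''v''"] v by simp
      have adj': "u ''adj'' = s ''adj''" "u ''ran'' = s ''ran''" by (simp_all add: fu)
      show "rel_at D (sem base_cell u) z \<longleftrightarrow> rel_at D u z \<or> ?A v m z"
        unfolding base_cell_spec(1)[OF cu] uv m adj' fixedD(2)[OF cu] using adj by blast
      show "bad_at (sem base_cell u) q \<longleftrightarrow> bad_at u q \<or> ?B v m q"
        unfolding base_cell_spec(2)[OF cu] uv m adj' fixedD(2)[OF cu] using ran by blast
    qed
    have "rel_at D (sem (PFor ''m'' (Var ''P'') base_cell) t) z \<longleftrightarrow> rel_at D t z \<or>
        (\<exists>m < val (Var ''P'') t. ?A v m z)" for z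
    proof (rule accumulate_For[where obs = "rel_at D"], goal_cases)
      case (2 m u z)
      show ?case by (rule st(1)[where u = u and m = m], rule 2(2), rule 2(3)) (simp add: writes_base_cell)
    qed (simp add: rel_at_upd)
    then show "rel_at D (sem (PFor ''m'' (Var ''P'') base_cell) t) z \<longleftrightarrow> rel_at D t z \<or> (\<exists>m < 2 ^ D. ?A v m z)"
      using fixedD[OF ct] by simp
    have "bad_at (sem (PFor ''m'' (Var ''P'') base_cell) t) z \<longleftrightarrow> bad_at t z \<or>
        (\<exists>m < val (Var ''P'') t. ?B v m z)" for z
    proof (rule accumulate_For[where obs = "bad_at"], goal_cases)
      case (2 m u z)
      show ?case by (rule st(2)[where u = u and m = m], rule 2(2), rule 2(3)) (simp add: writes_base_cell)
    qed (simp add: bad_at_upd)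
    then show "bad_at (sem (PFor ''m'' (Var ''P'') base_cell) t) q \<longleftrightarrow> bad_at t q \<or> (\<exists>m < 2 ^ D. ?B v m q)"
      using fixedD[OF ct] by simp
  qed
  have rel: "rel_at D (sem base_tables s) z \<longleftrightarrow> rel_at D s z \<or> (\<exists>v < val (Var ''n'') s. \<exists>m < 2 ^ D. ?A v m z)" for z
    unfolding base_tables_def
  proof (rule accumulate_For[where obs = "rel_at D"], goal_cases)
    case (2 v t z)
    show ?case by (rule masks(1)[where t = t and v = v], rule 2(2), rule 2(3)) (auto simp: writes_base_cell)
  qed (simp add: rel_at_upd)
  have bad: "bad_at (sem base_tables s) z \<longleftrightarrow> bad_at s z \<or> (\<exists>v < val (Var ''n'') s. \<exists>m < 2 ^ D. ?B v m z)" for z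
    unfolding base_tables_def
  proof (rule accumulate_For[where obs = "bad_at"], goal_cases)
    case (2 v t z)
    show ?case by (rule masks(2)[where t = t and v = v], rule 2(2), rule 2(3)) (auto simp: writes_base_cell)
  qed (simp add: bad_at_upd)
  have own_V: "x < n" "y < n" if "(x, y) \<in> own_arcs v" for x y v
    using that E_sub by (auto simp: own_arcs_def)
  show ?thesis
    unfolding represents_def
  proof (intro allI impI conjI)
    fix v m assume v: "v < n" and m: "m < (2 :: nat) ^ D"
    have "bad_at (sem base_tables s) (v * 2 ^ D + m) \<longleftrightarrow>
        (\<exists>a < D. \<exists>b < D. bit m a \<and> \<not> bit m b \<and> coloured {(x, y) \<in> own_arcs v. x \<in> VP} a b)"
    proof -
      have "\<not> bad_at s q" for q using init by (simp add: bad_at_def)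
      \<comment> \<open>A row number determines vertex and mask, so only the pass for
        \<open>v\<close> and \<open>m\<close> contributes to this row.\<close>
      moreover have "?B v' m' (v * 2 ^ D + m) \<longleftrightarrow> v = v' \<and> m = m' \<and> ?B v m (v * 2 ^ D + m)"
        if "m' < 2 ^ D" for v' m'
        using row_inj[OF m that, of v v'] by (cases "v = v' \<and> m = m'") auto
      then have "(\<exists>v' < n. \<exists>m' < 2 ^ D. ?B v' m' (v * 2 ^ D + m)) \<longleftrightarrow> ?B v m (v * 2 ^ D + m)"
        using v m by blast
      ultimately show ?thesis unfolding bad by (simp add: fixedD(4)[OF c])
    qed
    also have "\<dots> \<longleftrightarrow> fst base v (S m)"
    proof
      assume "\<exists>a < D. \<exists>b < D. bit m a \<and> \<not> bit m b \<and> coloured {(x, y) \<in> own_arcs v. x \<in> VP} a b"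
      then obtain x y where xy: "(x, y) \<in> own_arcs v" "x \<in> VP" "bit m (col x)" "\<not> bit m (col y)"
        unfolding coloured_def by auto
      then have "x \<in> S m" "y \<notin> S m" using own_V by (simp_all add: S_def)
      then show "fst base v (S m)" unfolding base_def fst_conv using xy by blast
    next
      assume "fst base v (S m)"
      then obtain x y where xy: "(x, y) \<in> own_arcs v" "x \<in> VP" "x \<in> S m" "y \<notin> S m"
        unfolding base_def fst_conv by auto
      then have "bit m (col x)" "\<not> bit m (col y)" "col x < D" "col y < D"
        using own_V[OF xy(1)] col by (simp_all add: S_def)
      moreover have "coloured {(x, y) \<in> own_arcs v. x \<in> VP} (col x) (col y)"
        using xy unfolding coloured_def by blast
      ultimately show "\<exists>a < D. \<exists>b < D. bit m a \<and> \<not> bit m b \<and> coloured {(x, y) \<in> own_arcs v. x \<in> VP} a b"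
        by blast
    qed
    finally show "bad_at (sem base_tables s) (v * 2 ^ D + m) \<longleftrightarrow> fst base v (S m)" .
    fix a b assume ab: "a < D" "b < D"
    have "rel_at D (sem base_tables s) (v * 2 ^ D + m, a, b) \<longleftrightarrow> bit m a \<and> bit m b \<and> coloured (own_arcs v) a b"
    proof -
      have "\<not> rel_at D s z" for z using init by (cases z) (simp add: rel_at_def)
      moreover have "?A v' m' (v * 2 ^ D + m, a, b) \<longleftrightarrow> v = v' \<and> m = m' \<and> ?A v m (v * 2 ^ D + m, a, b)"
        if "m' < 2 ^ D" for v' m'
        using row_inj[OF m that, of v v'] by (cases "v = v' \<and> m = m'") auto
      then have "(\<exists>v' < n. \<exists>m' < 2 ^ D. ?A v' m' (v * 2 ^ D + m, a, b)) \<longleftrightarrow> ?A v m (v * 2 ^ D + m, a, b)"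
        using v m by blast
      ultimately show ?thesis unfolding rel using ab by (simp add: fixedD(4)[OF c])
    qed
    also have "\<dots> \<longleftrightarrow> coloured (snd base v (S m)) a b"
    proof
      assume "bit m a \<and> bit m b \<and> coloured (own_arcs v) a b"
      then obtain x y where xy: "(x, y) \<in> own_arcs v" "col x = a" "col y = b" "bit m a" "bit m b"
        unfolding coloured_def by auto
      then have "x \<in> S m" "y \<in> S m" using own_V by (simp_all add: S_def)
      then show "coloured (snd base v (S m)) a b" unfolding base_def snd_conv coloured_def using xy by blast
    next
      assume "coloured (snd base v (S m)) a b"
      then show "bit m a \<and> bit m b \<and> coloured (own_arcs v) a b"
        unfolding base_def snd_conv coloured_def by (auto simp: S_def)
    qed
    finally show "rel_at D (sem base_tables s) (v * 2 ^ D + m, a, b) \<longleftrightarrow> coloured (snd base v (S m)) a b" .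
  qed
qed

end

section \<open>Deciding and pushing a single mask\<close>

lemma writes_decide: "writes decide = {''m0'', ''m1'', ''out'', ''inn'', ''a'', ''mm'', ''dec''}"
  by (auto simp: decide_def)

lemma writes_push_rel: "writes push_rel = {''a'', ''b'', ''rel''}"
  by (auto simp: push_rel_def)

lemma writes_push_mask:
  "writes push_mask = {''m0'', ''m1'', ''out'', ''inn'', ''a'', ''mm'', ''dec'', ''p'', ''bad'', ''b'', ''rel''}"
  by (auto simp: push_mask_def writes_decide writes_push_rel)

definition decide_step :: prog where
  "decide_step = when (bit_e (Var ''m0'') (Var ''a''))
      (when (Read ''rel'' (cell4 (Var ''v'') (Var ''m1'') (Var ''c'') (Var ''a''))) (''out'' ::= Const 1) ;;
       when (Read ''rel'' (cell4 (Var ''v'') (Var ''m1'') (Var ''a'') (Var ''c''))) (''inn'' ::= Const 1))"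

lemma decide_eq: "decide = (''m0'' ::= Var ''m'' [-] bit_e (Var ''m'') (Var ''c'') [*] Read ''pw'' (Var ''c'') ;;
     ''m1'' ::= Var ''P'' [-] (Var ''P'' [-] (Var ''m0'' [+] Read ''pw'' (Var ''c''))) ;;
     ''out'' ::= Const 0 ;; ''inn'' ::= Const 0 ;;
     PFor ''a'' (Var ''D'') decide_step ;;
     ''mm'' ::= Var ''m0'' ;;
     when (Read ''bad'' (cell2 (Var ''v'') (Var ''m1'')) [=] Const 0) (when (Var ''out'') (when (Var ''inn'')
      (''mm'' ::= Var ''m1'' ;; PWrite ''dec'' (cell2 (Var ''v'') (Var ''m'')) (Const 1)))))"
  by (simp add: decide_def decide_step_def)

lemma writes_decide_step: "writes decide_step = {''out'', ''inn''}"
  by (auto simp: decide_step_def)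

definition push_rel_step :: prog where
  "push_rel_step = PIf (Var ''a'' [=] Var ''c'') PSkip (PIf (Var ''b'' [=] Var ''c'') PSkip
       (PIf (Read ''rel'' (cell4 (Var ''v'') (Var ''mm'') (Var ''a'') (Var ''b'')))
         (PWrite ''rel'' (cell4 (Var ''p'') (Var ''m'') (Var ''a'') (Var ''b'')) (Const 1))
         (when (Read ''rel'' (cell4 (Var ''v'') (Var ''mm'') (Var ''a'') (Var ''c'')))
           (when (Read ''rel'' (cell4 (Var ''v'') (Var ''mm'') (Var ''c'') (Var ''b'')))
             (PWrite ''rel'' (cell4 (Var ''p'') (Var ''m'') (Var ''a'') (Var ''b'')) (Const 1))))))"

lemma push_rel_eq: "push_rel = PFor ''a'' (Var ''D'') (PFor ''b'' (Var ''D'') push_rel_step)"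
  by (simp add: push_rel_def push_rel_step_def)

lemma writes_push_rel_step: "writes push_rel_step = {''rel''}"
  by (auto simp: push_rel_step_def)

context ranking_arrays
begin

text \<open>The equality is confined to \<open>X v\<close>: elsewhere the new bit adds all vertices
  that share the colour of \<open>v\<close>.\<close>

lemma S_set_bit:
  assumes v: "v < n"
  shows "S (set_bit (col v) m) \<inter> X v = insert v (S m) \<inter> X v"
proof -
  have "u \<in> S (set_bit (col v) m) \<longleftrightarrow> u \<in> insert v (S m)" if "u \<in> X v" for u
  proof -
    have "(col v = col u) = (v = u)" using col_inj[OF v _ that, of v] by auto
    then show ?thesis using X_sub[OF v that] by (auto simp: S_def bit_set_bit_iff)
  qed
  then show ?thesis by blast
qed

lemma S_unset_bit:
  assumes v: "v < n"
  shows "S (unset_bit (col v) m) \<inter> X v = (S m - {v}) \<inter> X v"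
proof -
  have "u \<in> S (unset_bit (col v) m) \<longleftrightarrow> u \<in> S m - {v}" if "u \<in> X v" for u
  proof -
    have "(col v = col u) = (v = u)" using col_inj[OF v _ that, of v] by auto
    then show ?thesis using X_sub[OF v that] by (auto simp: S_def bit_unset_bit_iff)
  qed
  then show ?thesis by blast
qed

lemma colouredI: "(x, y) \<in> R \<Longrightarrow> coloured R (col x) (col y)"
  by (auto simp: coloured_def)

lemma is_parent_rank: "is_parent p v \<longleftrightarrow> p \<in> nb v \<and> (\<forall>u \<in> nb v. rank u \<le> rank p)"
proof -
  have "pos u \<le> pos p \<longleftrightarrow> rank u \<le> rank p" if "u \<in> nb v" "p \<in> nb v" for u
    using pos_le_iff[of u p] nb_D[OF that(1)] nb_D[OF that(2)] by simp
  then show ?thesis unfolding is_parent_def by blast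
qed

lemma par_iff: "v < n \<Longrightarrow> is_parent p v \<longleftrightarrow> par v = Suc p"
proof -
  assume v: "v < n"
  show ?thesis
  proof (cases "nb v = {}")
    case True
    then show ?thesis using par[of v] by (auto simp: is_parent_def)
  next
    case False
    then obtain p' where p': "p' \<in> nb v" "par v = Suc p'" "\<forall>u \<in> nb v. rank u \<le> rank p'"
      using par[of v] by auto
    have "is_parent p v \<longleftrightarrow> p = p'"
    proof
      assume "is_parent p v"
      then have p: "p \<in> nb v" "\<forall>u \<in> nb v. rank u \<le> rank p"
        by (auto simp: is_parent_rank)
      then have "rank p = rank p'" using p' by (simp add: antisym)
      then show "p = p'" using rank_inj nb_D p(1) p'(1) by blast
    next
      assume "p = p'"
      then show "is_parent p v" using p' by (simp add: is_parent_rank)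
    qed
    then show ?thesis using p' by auto
  qed
qed

lemma cell_vals:
  assumes "fixed t"
  shows "val (cell2 x y) t = val x t * 2 ^ D + val y t"
    and "val (cell4 x y z w) t = ((val x t * 2 ^ D + val y t) * D + val z t) * D + val w t"
  using fixedD(1,2)[OF assms] by (simp_all add: cell2_def cell3_def cell4_def)

context
  fixes \<sigma> :: "nat tables" and v :: nat
  assumes loc: "local_tables \<sigma>" and v: "v < n"
begin

abbreviation "dcs m \<equiv> decision v (fst \<sigma> v) (snd \<sigma> v) (S m)"

abbreviation "eb m \<equiv> elim_bad v (fst \<sigma> v) (snd \<sigma> v) (S m)"

abbreviation "er m \<equiv> elim_rel v (fst \<sigma> v) (snd \<sigma> v) (S m)"

text \<open>The mask of \<open>pick\<close>, up to vertices outside \<open>X v\<close>.\<close>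

definition next_mask :: "nat \<Rightarrow> nat" where
  "next_mask m = (if dcs m then set_bit (col v) m else unset_bit (col v) m)"

lemma vV: "v \<in> {..<n}"
  using v by simp

text \<open>The arcs sought by the decision lie in \<open>X v \<times> X v\<close>, where vertices
  can be replaced by colours; the right-hand side is what \<open>decide\<close> tests.\<close>

lemma decision_coloured:
  "dcs m \<longleftrightarrow> \<not> fst \<sigma> v (S (set_bit (col v) m)) \<and>
    (\<exists>a < D. bit (unset_bit (col v) m) a \<and> coloured (snd \<sigma> v (S (set_bit (col v) m))) (col v) a) \<and>
    (\<exists>a < D. bit (unset_bit (col v) m) a \<and> coloured (snd \<sigma> v (S (set_bit (col v) m))) a (col v))"
proof -
  let ?R = "snd \<sigma> v (insert v (S m))"
  have b: "fst \<sigma> v (S (set_bit (col v) m)) = fst \<sigma> v (insert v (S m))"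
    by (rule local_tablesD(1)[OF loc vV S_set_bit[OF v]])
  have r: "snd \<sigma> v (S (set_bit (col v) m)) = ?R"
    by (rule local_tablesD(2)[OF loc vV S_set_bit[OF v]])
  have sub: "?R \<subseteq> (insert v (S m) \<inter> X v) \<times> (insert v (S m) \<inter> X v)"
    by (rule local_tablesD(3)[OF loc vV])
  then have sub': "?R \<subseteq> X v \<times> X v" by blast
  have fwd: "col a < D \<and> bit (unset_bit (col v) m) (col a)" if "a \<in> S m - {v}" "a \<in> X v" for a
  proof -
    have "(col v = col a) = (v = a)" using col_inj[OF v _ that(2), of v] by auto
    then show ?thesis using that col[of a] X_sub[OF v that(2)] by (auto simp: S_def bit_unset_bit_iff)
  qed
  have bwd: "y \<in> S m - {v}" if "y \<in> insert v (S m)" "bit (unset_bit (col v) m) (col y)" for y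
    using that by (auto simp: bit_unset_bit_iff)
  have "(\<exists>a \<in> S m - {v}. (v, a) \<in> ?R) \<longleftrightarrow>
      (\<exists>a < D. bit (unset_bit (col v) m) a \<and> coloured ?R (col v) a)" (is "?L \<longleftrightarrow> ?M")
  proof
    assume ?L
    then obtain a where a: "a \<in> S m - {v}" "(v, a) \<in> ?R" by auto
    then have "a \<in> X v" using sub by blast
    then show ?M using fwd[OF a(1)] a(2) unfolding coloured_def by blast
  next
    assume ?M
    then obtain x y where xy: "(x, y) \<in> ?R" "col x = col v" "bit (unset_bit (col v) m) (col y)"
      unfolding coloured_def by auto
    then have "x \<in> X v" "y \<in> insert v (S m)" using sub by blast+
    then have "x = v" "y \<in> S m - {v}" using col_inj[OF v, of x v] xy bwd[of y] by auto
    then show ?L using xy(1) by blast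
  qed
  moreover have "(\<exists>a \<in> S m - {v}. (a, v) \<in> ?R) \<longleftrightarrow>
      (\<exists>a < D. bit (unset_bit (col v) m) a \<and> coloured ?R a (col v))" (is "?L \<longleftrightarrow> ?M")
  proof
    assume ?L
    then obtain a where a: "a \<in> S m - {v}" "(a, v) \<in> ?R" by auto
    then have "a \<in> X v" using sub by blast
    then show ?M using fwd[OF a(1)] a(2) unfolding coloured_def by blast
  next
    assume ?M
    then obtain x y where xy: "(x, y) \<in> ?R" "col y = col v" "bit (unset_bit (col v) m) (col x)"
      unfolding coloured_def by auto
    then have "y \<in> X v" "x \<in> insert v (S m)" using sub by blast+
    then have "y = v" "x \<in> S m - {v}" using col_inj[OF v, of y v] xy bwd[of x] by auto
    then show ?L using xy(1) by blast
  qed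
  ultimately show ?thesis unfolding decision_def b r by simp
qed

lemma S_next_mask: "S (next_mask m) \<inter> X v = pick v (fst \<sigma> v) (snd \<sigma> v) (S m) \<inter> X v"
  unfolding next_mask_def pick_def using S_set_bit[OF v, of m] S_unset_bit[OF v, of m] by simp

lemma next_mask_less: "m < 2 ^ D \<Longrightarrow> next_mask m < 2 ^ D"
  unfolding next_mask_def using set_bit_less[of m D "col v"] unset_bit_less[of m D "col v"] col[OF v] by simp

lemma elim_bad_next_mask: "eb m = fst \<sigma> v (S (next_mask m))"
  unfolding elim_bad_def by (rule local_tablesD(1)[OF loc vV S_next_mask[symmetric]])

lemma elim_rel_next_mask:
  fixes a b m :: nat
  assumes "a < D" "b < D"
  defines "R \<equiv> snd \<sigma> v (S (next_mask m))"
  shows "coloured (er m) a b \<longleftrightarrow> a \<noteq> col v \<and> b \<noteq> col v \<and>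
    (coloured R a b \<or> coloured R a (col v) \<and> coloured R (col v) b)"
proof -
  have e: "er m = shortcut v R"
    unfolding elim_rel_def R_def local_tablesD(2)[OF loc vV S_next_mask] ..
  have "R \<subseteq> (S (next_mask m) \<inter> X v) \<times> (S (next_mask m) \<inter> X v)"
    unfolding R_def by (rule local_tablesD(3)[OF loc vV])
  then have sub: "R \<subseteq> X v \<times> X v" by blast
  \<comment> \<open>Within \<open>X v\<close> the colour of \<open>v\<close> identifies
    \<open>v\<close>, so excluding this colour excludes exactly \<open>v\<close>, and two arcs
    meeting in this colour meet in \<open>v\<close>.\<close>
  have v': "x = v" if "x \<in> X v" "col x = col v" for x using col_inj[OF v that(1) _ that(2)] by simp
  show ?thesis unfolding e
  proof
    assume "coloured (shortcut v R) a b"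
    then obtain x y where xy: "(x, y) \<in> shortcut v R" "a = col x" "b = col y" by (auto simp: coloured_def)
    then have *: "x \<noteq> v" "y \<noteq> v" "(x, y) \<in> R \<or> (x, v) \<in> R \<and> (v, y) \<in> R" by (auto simp: shortcut_def)
    then have "x \<in> X v" "y \<in> X v" using sub by blast+
    then have "a \<noteq> col v" "b \<noteq> col v" using *(1,2) xy(2,3) v' by metis+
    moreover have "coloured R a b \<or> coloured R a (col v) \<and> coloured R (col v) b"
      using *(3) unfolding xy(2,3) by (metis colouredI)
    ultimately show "a \<noteq> col v \<and> b \<noteq> col v \<and> (coloured R a b \<or> coloured R a (col v) \<and> coloured R (col v) b)"
      by simp
  next
    assume *: "a \<noteq> col v \<and> b \<noteq> col v \<and> (coloured R a b \<or> coloured R a (col v) \<and> coloured R (col v) b)"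
    show "coloured (shortcut v R) a b"
    proof (cases "coloured R a b")
      case True
      then obtain x y where "(x, y) \<in> R" "col x = a" "col y = b" unfolding coloured_def by auto
      then have "(x, y) \<in> shortcut v R" using * unfolding shortcut_def by auto
      then show ?thesis using \<open>col x = a\<close> \<open>col y = b\<close> colouredI by blast
    next
      case False
      then obtain x y x' y' where xy: "(x, y) \<in> R" "col x = a" "col y = col v" "(x', y') \<in> R" "col x' = col v" "col y' = b"
        using * unfolding coloured_def by auto
      then have "y \<in> X v" "x' \<in> X v" using sub by blast+
      then have "y = v" "x' = v" using v' xy by auto
      then have "(x, y') \<in> shortcut v R" using xy * unfolding shortcut_def by auto
      then show ?thesis using xy colouredI[of x y' "shortcut v R"] by simp
    qed
  qed
qed

definition row_ok :: "store \<Rightarrow> bool" where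
  "row_ok t \<longleftrightarrow> (\<forall>m < 2 ^ D. (bad_at t (v * 2 ^ D + m) \<longleftrightarrow> fst \<sigma> v (S m)) \<and>
     (\<forall>a < D. \<forall>b < D. rel_at D t (v * 2 ^ D + m, a, b) \<longleftrightarrow> coloured (snd \<sigma> v (S m)) a b))"

definition push_ready :: "store \<Rightarrow> bool" where
  "push_ready t \<longleftrightarrow> fixed t \<and> t ''v'' 0 = v \<and> t ''c'' 0 = col v \<and> t ''m'' 0 < 2 ^ D \<and> row_ok t"

lemma push_readyD:
  assumes "push_ready t"
  shows "fixed t" "t ''v'' 0 = v" "t ''c'' 0 = col v" "t ''m'' 0 < 2 ^ D"
    and "m < 2 ^ D \<Longrightarrow> bad_at t (v * 2 ^ D + m) \<longleftrightarrow> fst \<sigma> v (S m)"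
    and "m < 2 ^ D \<Longrightarrow> a < D \<Longrightarrow> b < D \<Longrightarrow>
      rel_at D t (v * 2 ^ D + m, a, b) \<longleftrightarrow> coloured (snd \<sigma> v (S m)) a b"
  using assms unfolding push_ready_def row_ok_def by auto

lemma decide_loop:
  fixes t :: store
  assumes f: "fixed t" and v0: "t ''v'' 0 = v" and c0: "t ''c'' 0 = col v"
    and zero: "t ''out'' 0 = 0" "t ''inn'' 0 = 0"
  defines "t' \<equiv> sem (PFor ''a'' (Var ''D'') decide_step) t"
  shows "t' ''out'' 0 \<noteq> 0 \<longleftrightarrow> (\<exists>a < D. bit (t ''m0'' 0) a \<and> rel_at D t (v * 2 ^ D + t ''m1'' 0, col v, a))"
    and "t' ''inn'' 0 \<noteq> 0 \<longleftrightarrow> (\<exists>a < D. bit (t ''m0'' 0) a \<and> rel_at D t (v * 2 ^ D + t ''m1'' 0, a, col v))"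
proof -
  \<comment> \<open>The truth value selects the flag, so that one accumulation covers both
    \<open>out\<close> and \<open>inn\<close>.\<close>
  let ?obs = "\<lambda>u z. if z then u ''out'' 0 \<noteq> 0 else u ''inn'' 0 \<noteq> (0 :: nat)"
  let ?A = "\<lambda>a z. bit (t ''m0'' 0) a \<and> (if z then rel_at D t (v * 2 ^ D + t ''m1'' 0, col v, a)
      else rel_at D t (v * 2 ^ D + t ''m1'' 0, a, col v))"
  have "?obs t' z \<longleftrightarrow> ?obs t z \<or> (\<exists>a < val (Var ''D'') t. ?A a z)" for z
    unfolding t'_def
  proof (rule accumulate_For[where obs = ?obs and A = ?A], goal_cases)
    case (2 a u z)
    have fr: "u y = t y" if "y \<notin> {''a'', ''out'', ''inn''}" for y
      using that by (intro 2(3)) (simp add: writes_decide_step)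
    have fu: "fixed u" by (rule fixed_frame[OF f], rule fr) auto
    have a: "a < D" using 2(1) fixedD(1)[OF f] by simp
    have bit: "val (bit_e (Var ''m0'') (Var ''a'')) u = of_bool (bit (t ''m0'' 0) a)"
      using 2(2) fixedD(3)[OF fu a] by (simp add: bit_e_def bit_value fr)
    have r1: "u ''rel'' (val (cell4 (Var ''v'') (Var ''m1'') (Var ''c'') (Var ''a'')) w) \<noteq> 0 \<longleftrightarrow>
        rel_at D t (v * 2 ^ D + t ''m1'' 0, col v, a)"
      and r2: "u ''rel'' (val (cell4 (Var ''v'') (Var ''m1'') (Var ''a'') (Var ''c'')) w) \<noteq> 0 \<longleftrightarrow>
        rel_at D t (v * 2 ^ D + t ''m1'' 0, a, col v)"
      if w: "w = u \<or> w = upd ''out'' 0 (Suc 0) u" for w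
    proof -
      have "fixed w" by (rule fixed_frame[OF fu]) (use w in \<open>auto simp: upd_apply\<close>)
      note cv = cell_vals(2)[OF this]
      have wv: "w ''v'' 0 = v" "w ''m1'' 0 = t ''m1'' 0" "w ''c'' 0 = col v" "w ''a'' 0 = a" "u ''rel'' = t ''rel''"
        using w by (auto simp: upd_apply fr v0 c0 2(2))
      show "u ''rel'' (val (cell4 (Var ''v'') (Var ''m1'') (Var ''c'') (Var ''a'')) w) \<noteq> 0 \<longleftrightarrow>
        rel_at D t (v * 2 ^ D + t ''m1'' 0, col v, a)"
        and "u ''rel'' (val (cell4 (Var ''v'') (Var ''m1'') (Var ''a'') (Var ''c'')) w) \<noteq> 0 \<longleftrightarrow>
        rel_at D t (v * 2 ^ D + t ''m1'' 0, a, col v)"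
        using wv col[OF v] a by (simp_all add: cv rel_at_def)
    qed
    have sem: "sem decide_step u = (if bit (t ''m0'' 0) a then
        (let w = (if rel_at D t (v * 2 ^ D + t ''m1'' 0, col v, a) then upd ''out'' 0 (Suc 0) u else u) in
         if rel_at D t (v * 2 ^ D + t ''m1'' 0, a, col v) then upd ''inn'' 0 (Suc 0) w else w) else u)"
      using r1[of u] r2[of u] r2[of "upd ''out'' 0 (Suc 0) u"] bit
      by (simp add: decide_step_def Let_def upd_apply)
    show ?case unfolding sem Let_def by (auto simp: upd_apply)
  qed (simp add: upd_apply)
  from this[of True] this[of False] zero fixedD(1)[OF f]
  show "t' ''out'' 0 \<noteq> 0 \<longleftrightarrow> (\<exists>a < D. bit (t ''m0'' 0) a \<and> rel_at D t (v * 2 ^ D + t ''m1'' 0, col v, a))"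
    and "t' ''inn'' 0 \<noteq> 0 \<longleftrightarrow> (\<exists>a < D. bit (t ''m0'' 0) a \<and> rel_at D t (v * 2 ^ D + t ''m1'' 0, a, col v))"
    by simp_all
qed

lemma decide_spec:
  assumes r: "push_ready t"
  defines "m \<equiv> t ''m'' 0"
  shows "sem decide t ''mm'' 0 = next_mask m"
    and "sem decide t ''dec'' = (if dcs m then (t ''dec'')(v * 2 ^ D + m := 1) else t ''dec'')"
proof -
  note D = push_readyD[OF r]
  note f = fixedD(1,2)[OF D(1)] fixedD(3)[OF D(1) conjunct1[OF col[OF v]]]
  have m: "m < 2 ^ D" using D(4) by (simp add: m_def)
  let ?m0 = "unset_bit (col v) m" and ?m1 = "set_bit (col v) m"
  have m1: "?m1 < 2 ^ D" by (rule set_bit_less[OF m]) (simp add: col[OF v])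
  define t0 where "t0 = upd ''inn'' 0 0 (upd ''out'' 0 0 (upd ''m1'' 0 ?m1 (upd ''m0'' 0 ?m0 t)))"
  define t1 where "t1 = sem (PFor ''a'' (Var ''D'') decide_step) t0"
  have e0: "val (Var ''m'' [-] bit_e (Var ''m'') (Var ''c'') [*] Read ''pw'' (Var ''c'')) t = ?m0"
    using D f by (simp add: bit_e_def bit_value unset_bit_nat m_def)
  have e1: "val (Var ''P'' [-] (Var ''P'' [-] (Var ''m0'' [+] Read ''pw'' (Var ''c'')))) (upd ''m0'' 0 ?m0 t) = ?m1"
    using D f m1 by (simp add: set_unset_bit upd_apply)
  have dec: "sem decide t = sem (''mm'' ::= Var ''m0'' ;;
     when (Read ''bad'' (cell2 (Var ''v'') (Var ''m1'')) [=] Const 0) (when (Var ''out'') (when (Var ''inn'')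
      (''mm'' ::= Var ''m1'' ;; PWrite ''dec'' (cell2 (Var ''v'') (Var ''m'')) (Const 1))))) t1"
    unfolding decide_eq t1_def t0_def sem.simps(2,3) e0 by (simp only: val.simps(1) e1)
  have f0: "fixed t0" by (rule fixed_frame[OF D(1)]) (auto simp: t0_def upd_apply)
  have fr1: "t1 y = t0 y" if "y \<notin> {''a'', ''out'', ''inn''}" for y
    unfolding t1_def using that by (intro sem_frame) (simp add: writes_decide_step)
  have f1: "fixed t1" by (rule fixed_frame[OF f0], rule fr1) auto
  have rel0: "rel_at D t0 = rel_at D t" by (simp add: t0_def rel_at_upd)
  have "t0 ''v'' 0 = v" "t0 ''c'' 0 = col v" "t0 ''out'' 0 = 0" "t0 ''inn'' 0 = 0"
    using D by (simp_all add: t0_def upd_apply)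
  note dl = decide_loop[OF f0 this, folded t1_def]
  have t0m: "t0 ''m0'' 0 = ?m0" "t0 ''m1'' 0 = ?m1" by (simp_all add: t0_def upd_apply)
  have cD: "col v < D" using col[OF v] by simp
  have out: "t1 ''out'' 0 \<noteq> 0 \<longleftrightarrow> (\<exists>a < D. bit ?m0 a \<and> coloured (snd \<sigma> v (S ?m1)) (col v) a)"
    unfolding dl(1) t0m rel0 using D(6)[OF m1 cD] by blast
  have inn: "t1 ''inn'' 0 \<noteq> 0 \<longleftrightarrow> (\<exists>a < D. bit ?m0 a \<and> coloured (snd \<sigma> v (S ?m1)) a (col v))"
    unfolding dl(2) t0m rel0 using D(6)[OF m1 _ cD] by blast
  have t1v: "t1 ''v'' 0 = v" "t1 ''m0'' 0 = ?m0" "t1 ''m1'' 0 = ?m1" "t1 ''m'' 0 = m" "t1 ''dec'' = t ''dec''"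
    "t1 ''bad'' = t ''bad''"
    using D by (simp_all add: fr1 t0_def upd_apply m_def)
  let ?t2 = "upd ''mm'' 0 ?m0 t1"
  let ?t3 = "upd ''mm'' 0 ?m1 ?t2"
  have f2: "fixed ?t2" by (rule fixed_frame[OF f1]) (auto simp: upd_apply)
  have f3: "fixed ?t3" by (rule fixed_frame[OF f1]) (auto simp: upd_apply)
  have bad: "?t2 ''bad'' (val (cell2 (Var ''v'') (Var ''m1'')) ?t2) \<noteq> 0 \<longleftrightarrow> fst \<sigma> v (S ?m1)"
    using D(5)[OF m1] by (simp add: cell_vals[OF f2] upd_apply t1v bad_at_def)
  have dcs: "dcs m \<longleftrightarrow> ?t2 ''bad'' (val (cell2 (Var ''v'') (Var ''m1'')) ?t2) = 0 \<and> t1 ''out'' 0 \<noteq> 0 \<and> t1 ''inn'' 0 \<noteq> 0"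
    unfolding decision_coloured out inn using bad by blast
  have cell: "val (cell2 (Var ''v'') (Var ''m'')) ?t3 = v * 2 ^ D + m"
    by (simp add: cell_vals[OF f3] upd_apply t1v)
  have all: "sem decide t = (if dcs m then upd ''dec'' (v * 2 ^ D + m) 1 ?t3 else ?t2)"
  proof (cases "dcs m")
    case True
    then have *: "?t2 ''bad'' (val (cell2 (Var ''v'') (Var ''m1'')) ?t2) = 0" "t1 ''out'' 0 \<noteq> 0" "t1 ''inn'' 0 \<noteq> 0"
      using dcs by auto
    have "?t2 ''out'' 0 \<noteq> 0" "?t2 ''inn'' 0 \<noteq> 0" "?t2 ''m1'' 0 = ?m1" using * t1v by (simp_all add: upd_apply)
    then show ?thesis using True * cell unfolding dec by (simp add: t1v)
  next
    case False
    then have "\<not> (?t2 ''bad'' (val (cell2 (Var ''v'') (Var ''m1'')) ?t2) = 0 \<and> ?t2 ''out'' 0 \<noteq> 0 \<and> ?t2 ''inn'' 0 \<noteq> 0)"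
      using dcs by (simp add: upd_apply)
    then show ?thesis using False unfolding dec by (auto simp: t1v)
  qed
  show "sem decide t ''mm'' 0 = next_mask m"
    unfolding all next_mask_def by (simp add: upd_apply)
  show "sem decide t ''dec'' = (if dcs m then (t ''dec'')(v * 2 ^ D + m := 1) else t ''dec'')"
    unfolding all by (simp add: upd_apply t1v)
qed

end

end

text \<open>Combining the three arrays in one observation lets a single induction over the masks
  provide everything the body needs: bad flags and relations of \<open>v\<close> must be known
  together before a mask can be decided.\<close>

definition observe :: "nat \<Rightarrow> store \<Rightarrow> nat + (nat \<times> nat \<times> nat) + nat \<Rightarrow> bool" where
  "observe D t z = (case z of Inl q \<Rightarrow> bad_at t q | Inr (Inl z) \<Rightarrow> rel_at D t z | Inr (Inr q) \<Rightarrow> t ''dec'' q \<noteq> 0)"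

lemma observe_simps [simp]:
  "observe D t (Inl q) = bad_at t q"
  "observe D t (Inr (Inl z)) = rel_at D t z"
  "observe D t (Inr (Inr q)) = (t ''dec'' q \<noteq> 0)"
  by (simp_all add: observe_def)

lemma observe_upd: "x \<notin> {''bad'', ''rel'', ''dec''} \<Longrightarrow> observe D (upd x i k t) = observe D t"
  by (auto simp: observe_def fun_eq_iff rel_at_upd bad_at_upd upd_apply split: sum.splits)

text \<open>Rows are read at \<open>v\<close> and written at its parent, so pushing never alters
  what it still has to read.\<close>

lemma pushed_row_ne:
  fixes p v m m' D :: nat
  assumes "p \<noteq> v" "m < 2 ^ D" "m' < 2 ^ D"
  shows "p * 2 ^ D + m \<noteq> v * 2 ^ D + m'"
  using row_inj[OF assms(2,3)] assms(1) by simp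

context ranking_arrays
begin

context
  fixes \<sigma> :: "nat tables" and v :: nat
  assumes loc: "local_tables \<sigma>" and v: "v < n"
begin

abbreviation "dc \<equiv> \<lambda>m. decision v (fst \<sigma> v) (snd \<sigma> v) (S m)"
abbreviation "el \<equiv> \<lambda>m. elim_bad v (fst \<sigma> v) (snd \<sigma> v) (S m)"
abbreviation "re \<equiv> \<lambda>m. elim_rel v (fst \<sigma> v) (snd \<sigma> v) (S m)"
abbreviation "nm \<equiv> next_mask \<sigma> v"

lemma push_rel_step_spec:
  fixes t :: store
  assumes f: "fixed t" and c: "t ''c'' 0 = col v" and vv: "t ''v'' 0 = v"
    and a: "t ''a'' 0 < D" and b: "t ''b'' 0 < D"
  defines "r \<equiv> \<lambda>a b. rel_at D t (v * 2 ^ D + t ''mm'' 0, a, b)"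
  shows "rel_at D (sem push_rel_step t) z \<longleftrightarrow> rel_at D t z \<or>
     t ''a'' 0 \<noteq> col v \<and> t ''b'' 0 \<noteq> col v \<and>
     (r (t ''a'' 0) (t ''b'' 0) \<or> r (t ''a'' 0) (col v) \<and> r (col v) (t ''b'' 0)) \<and>
     z = (t ''p'' 0 * 2 ^ D + t ''m'' 0, t ''a'' 0, t ''b'' 0)"
proof -
  have cD: "col v < D" using col[OF v] by simp
  have rr: "t ''rel'' (val (cell4 (Var ''v'') (Var ''mm'') x y) t) \<noteq> 0 \<longleftrightarrow> r (val x t) (val y t)"
    if "val x t < D" "val y t < D" for x y
    using that by (simp add: cell_vals(2)[OF f] vv r_def rel_at_def)
  have 1: "t ''rel'' (val (cell4 (Var ''v'') (Var ''mm'') (Var ''a'') (Var ''b'')) t) \<noteq> 0 \<longleftrightarrow> r (t ''a'' 0) (t ''b'' 0)"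
    and 2: "t ''rel'' (val (cell4 (Var ''v'') (Var ''mm'') (Var ''a'') (Var ''c'')) t) \<noteq> 0 \<longleftrightarrow> r (t ''a'' 0) (col v)"
    and 3: "t ''rel'' (val (cell4 (Var ''v'') (Var ''mm'') (Var ''c'') (Var ''b'')) t) \<noteq> 0 \<longleftrightarrow> r (col v) (t ''b'' 0)"
    using rr[of "Var ''a''" "Var ''b''"] rr[of "Var ''a''" "Var ''c''"] rr[of "Var ''c''" "Var ''b''"] a b c cD
    by simp_all
  have 4: "val (cell4 (Var ''p'') (Var ''m'') (Var ''a'') (Var ''b'')) t =
      ((t ''p'' 0 * 2 ^ D + t ''m'' 0) * D + t ''a'' 0) * D + t ''b'' 0"
    by (simp add: cell_vals(2)[OF f])
  have "sem push_rel_step t = (if t ''a'' 0 \<noteq> col v \<and> t ''b'' 0 \<noteq> col v \<and>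
     (r (t ''a'' 0) (t ''b'' 0) \<or> r (t ''a'' 0) (col v) \<and> r (col v) (t ''b'' 0))
     then upd ''rel'' (((t ''p'' 0 * 2 ^ D + t ''m'' 0) * D + t ''a'' 0) * D + t ''b'' 0) 1 t else t)"
    using 1 2 3 by (simp add: push_rel_step_def 4 c)
  then show ?thesis by (auto simp: rel_at_write[OF a b])
qed

lemma push_rel_spec:
  fixes t :: store
  assumes f: "fixed t" and c: "t ''c'' 0 = col v" and vv: "t ''v'' 0 = v"
    and p: "t ''p'' 0 \<noteq> v" and m: "t ''m'' 0 < 2 ^ D" "t ''mm'' 0 < 2 ^ D"
  defines "r \<equiv> \<lambda>a b. rel_at D t (v * 2 ^ D + t ''mm'' 0, a, b)"
  shows "rel_at D (sem push_rel t) z \<longleftrightarrow> rel_at D t z \<or> (\<exists>a < D. \<exists>b < D.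
     a \<noteq> col v \<and> b \<noteq> col v \<and> (r a b \<or> r a (col v) \<and> r (col v) b) \<and>
     z = (t ''p'' 0 * 2 ^ D + t ''m'' 0, a, b))"
proof -
  let ?A = "\<lambda>a b z. a \<noteq> col v \<and> b \<noteq> col v \<and> (r a b \<or> r a (col v) \<and> r (col v) b) \<and>
     z = (t ''p'' 0 * 2 ^ D + t ''m'' 0, a, b)"
  have ne: "t ''p'' 0 * 2 ^ D + t ''m'' 0 \<noteq> v * 2 ^ D + t ''mm'' 0"
    by (rule pushed_row_ne[OF p m])
  have inner: "rel_at D (sem (PFor ''b'' (Var ''D'') push_rel_step) s) z \<longleftrightarrow>
      rel_at D s z \<or> (\<exists>b < D. ?A a b z)"
    if a: "a < D" "s ''a'' 0 = a" and fr: "\<And>y. y \<notin> {''a'', ''b'', ''rel''} \<Longrightarrow> s y = t y"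
      and cur: "\<And>x y. rel_at D s (v * 2 ^ D + t ''mm'' 0, x, y) \<longleftrightarrow> r x y" for s a z
  proof -
    have fs: "fixed s" by (rule fixed_frame[OF f], rule fr) auto
    have "rel_at D (sem (PFor ''b'' (Var ''D'') push_rel_step) s) z \<longleftrightarrow>
        rel_at D s z \<or> (\<exists>b < val (Var ''D'') s. ?A a b z)" for z
    proof (rule accumulate_For[where obs = "rel_at D"], goal_cases)
      case (2 b u z)
      have fr': "u y = t y" if "y \<notin> {''a'', ''b'', ''rel''}" for y
      proof -
        have "u y = s y" by (rule 2(3)) (use that in \<open>simp add: writes_push_rel_step\<close>)
        then show ?thesis using fr[OF that] by simp
      qed
      have ua: "u ''a'' 0 = a"
      proof -
        have "u ''a'' = s ''a''" by (rule 2(3)) (simp add: writes_push_rel_step)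
        then show ?thesis using a by simp
      qed
      have b: "b < D" using 2(1) fixedD(1)[OF fs] by simp
      have fu: "fixed u" by (rule fixed_frame[OF f], rule fr') auto
      \<comment> \<open>So far only the row of \<open>t ''p'' 0\<close> and \<open>t ''m'' 0\<close>
        has received entries, and this is not the row being read.\<close>
      have cu: "rel_at D u (v * 2 ^ D + t ''mm'' 0, x, y) \<longleftrightarrow> r x y" for x y
        using 2(4)[of "(v * 2 ^ D + t ''mm'' 0, x, y)"] cur[of x y] ne by auto
      have un: "u ''c'' = t ''c''" "u ''v'' = t ''v''" "u ''p'' = t ''p''" "u ''m'' = t ''m''" "u ''mm'' = t ''mm''"
        by (simp_all add: fr')
      have "u ''c'' 0 = col v" "u ''v'' 0 = v" "u ''a'' 0 < D" "u ''b'' 0 < D"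
        using un c vv ua a b 2(2) by simp_all
      from push_rel_step_spec[OF fu this, of z] show ?case
        unfolding un ua 2(2) cu .
    qed (simp add: rel_at_upd)
    then show ?thesis using fixedD(1)[OF fs] by simp
  qed
  have "rel_at D (sem push_rel t) z \<longleftrightarrow> rel_at D t z \<or> (\<exists>a < val (Var ''D'') t. \<exists>b < D. ?A a b z)" for z
    unfolding push_rel_eq
  proof (rule accumulate_For[where obs = "rel_at D"], goal_cases)
    case (2 a s z)
    have fr: "s y = t y" if "y \<notin> {''a'', ''b'', ''rel''}" for y
      by (rule 2(3)) (use that in \<open>simp add: writes_push_rel_step\<close>)
    have a: "a < D" using 2(1) fixedD(1)[OF f] by simp
    have cur: "rel_at D s (v * 2 ^ D + t ''mm'' 0, x, y) \<longleftrightarrow> r x y" for x y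
      using 2(4)[of "(v * 2 ^ D + t ''mm'' 0, x, y)"] ne by (auto simp: r_def)
    show ?case by (rule inner[of a s z], rule a, rule 2(2), rule fr, assumption, rule cur)
  qed (simp add: rel_at_upd)
  then show ?thesis using fixedD(1)[OF f] by simp
qed

text \<open>Without a parent the first two cases are empty and only the decision is
  recorded.\<close>

definition pushes :: "nat \<Rightarrow> nat + (nat \<times> nat \<times> nat) + nat \<Rightarrow> bool" where
  "pushes m z = (case z of
      Inl q \<Rightarrow> \<exists>p. is_parent p v \<and> q = p * 2 ^ D + m \<and> el m
    | Inr (Inl z) \<Rightarrow> \<exists>p a b. is_parent p v \<and> a < D \<and> b < D \<and> z = (p * 2 ^ D + m, a, b) \<and> coloured (re m) a b
    | Inr (Inr q) \<Rightarrow> q = v * 2 ^ D + m \<and> dc m)"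

lemma push_mask_spec:
  assumes r: "push_ready \<sigma> v t"
  defines "m \<equiv> t ''m'' 0"
  shows "observe D (sem push_mask t) z \<longleftrightarrow> observe D t z \<or> pushes m z"
proof -
  note R = push_readyD[OF loc v r]
  have m: "m < 2 ^ D" using R(4) by (simp add: m_def)
  define s where "s = sem decide t"
  note dec = decide_spec[OF loc v r, folded m_def s_def]
  have fr: "s y = t y" if "y \<notin> {''m0'', ''m1'', ''out'', ''inn'', ''a'', ''mm'', ''dec''}" for y
    unfolding s_def using that by (intro sem_frame) (simp add: writes_decide)
  have fs: "fixed s" by (rule fixed_frame[OF R(1)], rule fr) auto
  have rel: "rel_at D s = rel_at D t" and bad: "bad_at s = bad_at t" by (simp_all add: rel_at_def bad_at_def fr fun_eq_iff)
  have nm: "nm m < 2 ^ D" by (rule next_mask_less[OF loc v m])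
  have obs_s: "observe D s z \<longleftrightarrow> observe D t z \<or> (\<exists>q. z = Inr (Inr q) \<and> q = v * 2 ^ D + m \<and> dc m)" for z
    using dec(2) by (auto simp: observe_def rel bad split: sum.splits)
  have par_s: "s ''par'' (s ''v'' 0) = par v" using R(2) fixedD(8)[OF R(1)] by (simp add: fr)
  show ?thesis
  proof (cases "par v")
    case 0
    then have "\<not> is_parent p v" for p using par_iff[OF v] by simp
    moreover have "sem push_mask t = s" using par_s 0 by (simp add: push_mask_def s_def)
    ultimately show ?thesis using obs_s[of z] by (auto simp: pushes_def split: sum.splits)
  next
    case (Suc p)
    then have p: "is_parent p v" and pu: "is_parent p' v \<longleftrightarrow> p' = p" for p' using par_iff[OF v] by auto
    have pv: "p \<noteq> v" using p nb_D[of p v] by (auto simp: is_parent_def)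
    define w where "w = upd ''p'' 0 p s"
    define x where "x = (if el m then upd ''bad'' (p * 2 ^ D + m) 1 w else w)"
    have fw: "fixed w" by (rule fixed_frame[OF fs]) (auto simp: w_def upd_apply)
    have fx: "fixed x" by (rule fixed_frame[OF fs]) (auto simp: x_def w_def upd_apply)
    have wv: "w ''v'' 0 = v" "w ''mm'' 0 = nm m" "w ''p'' 0 = p" "w ''m'' 0 = m" "w ''c'' 0 = col v"
      using R dec(1) by (simp_all add: w_def upd_apply fr m_def)
    have xv: "x y = w y" if "y \<noteq> ''bad''" for y using that by (simp add: x_def upd_apply)
    have "w ''bad'' (val (cell2 (Var ''v'') (Var ''mm'')) w) \<noteq> 0 \<longleftrightarrow> el m"
    proof -
      have "bad_at w = bad_at t" unfolding w_def by (simp add: bad_at_upd bad)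
      then have "bad_at w (v * 2 ^ D + nm m) \<longleftrightarrow> el m"
        using R(5)[OF nm] elim_bad_next_mask[OF loc v, of m] by simp
      then show ?thesis by (simp add: cell_vals(1)[OF fw] wv bad_at_def)
    qed
    moreover have "val (cell2 (Var ''p'') (Var ''m'')) w = p * 2 ^ D + m"
      by (simp add: cell_vals(1)[OF fw] wv)
    ultimately have x: "sem (when (Read ''bad'' (cell2 (Var ''v'') (Var ''mm''))) (PWrite ''bad'' (cell2 (Var ''p'') (Var ''m'')) (Const 1))) w = x"
      by (simp add: x_def)
    have "val (Read ''par'' (Var ''v'')) s = Suc p" using par_s Suc by simp
    then have sem: "sem push_mask t = sem push_rel x"
      unfolding push_mask_def using x
      by (cases "w ''bad'' (val (cell2 (Var ''v'') (Var ''mm'')) w) = 0")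
         (simp_all add: s_def[symmetric] w_def[symmetric])
    have relx: "rel_at D x = rel_at D t" unfolding x_def w_def by (simp add: rel_at_upd rel)
    have "x ''c'' 0 = col v" "x ''v'' 0 = v" "x ''p'' 0 \<noteq> v" "x ''m'' 0 < 2 ^ D" "x ''mm'' 0 < 2 ^ D"
      using wv pv m nm by (simp_all add: xv)
    note pr = push_rel_spec[OF fx this]
    have xs: "x ''p'' 0 = p" "x ''m'' 0 = m" "x ''mm'' 0 = nm m" using wv by (simp_all add: xv)
    have cD: "col v < D" using col[OF v] by simp
    have co: "rel_at D t (v * 2 ^ D + nm m, a, b) \<longleftrightarrow> coloured (snd \<sigma> v (S (nm m))) a b" if "a < D" "b < D" for a b
      by (rule R(6)[OF nm that])
    have relf: "rel_at D (sem push_rel x) z \<longleftrightarrow> rel_at D t z \<or>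
        (\<exists>a < D. \<exists>b < D. z = (p * 2 ^ D + m, a, b) \<and> coloured (re m) a b)" for z
    proof -
      have "a \<noteq> col v \<and> b \<noteq> col v \<and> (rel_at D t (v * 2 ^ D + nm m, a, b) \<or>
          rel_at D t (v * 2 ^ D + nm m, a, col v) \<and> rel_at D t (v * 2 ^ D + nm m, col v, b)) \<longleftrightarrow>
          coloured (re m) a b" if "a < D" "b < D" for a b
        using elim_rel_next_mask[OF loc v that, of m] co[OF that] co[OF that(1) cD] co[OF cD that(2)] by simp
      then show ?thesis unfolding pr relx xs by blast
    qed
    have fpr: "sem push_rel x y = x y" if "y \<notin> {''a'', ''b'', ''rel''}" for y
      using that by (intro sem_frame) (simp add: writes_push_rel)
    have badf: "bad_at (sem push_rel x) q \<longleftrightarrow> bad_at t q \<or> q = p * 2 ^ D + m \<and> el m" for q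
    proof -
      have "bad_at (sem push_rel x) q = bad_at x q" by (simp add: bad_at_def fpr)
      also have "bad_at x q \<longleftrightarrow> bad_at w q \<or> q = p * 2 ^ D + m \<and> el m"
        by (simp add: x_def bad_at_write)
      also have "bad_at w = bad_at t" unfolding w_def by (simp add: bad_at_upd bad)
      finally show ?thesis .
    qed
    have decf: "sem push_rel x ''dec'' = s ''dec''" by (simp add: fpr xv w_def upd_apply)
    show ?thesis unfolding sem
    proof (cases z)
      case (Inl q)
      then show "observe D (sem push_rel x) z \<longleftrightarrow> observe D t z \<or> pushes m z"
        by (simp add: badf pushes_def pu)
    next
      case (Inr z')
      then show "observe D (sem push_rel x) z \<longleftrightarrow> observe D t z \<or> pushes m z"
      proof (cases z')
        case (Inl q)
        then show ?thesis unfolding Inr Inl by (simp add: relf pushes_def pu)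
      next
        case (Inr q)
        then show ?thesis unfolding \<open>z = Inr z'\<close> Inr using dec(2) by (simp add: decf pushes_def)
      qed
    qed
  qed
qed

lemma push_masks_spec:
  fixes t :: store
  assumes f: "fixed t" and vv: "t ''v'' 0 = v" and c: "t ''c'' 0 = col v" and row: "row_ok \<sigma> v t"
  shows "observe D (sem (PFor ''m'' (Var ''P'') push_mask) t) z \<longleftrightarrow> observe D t z \<or> (\<exists>m < 2 ^ D. pushes m z)"
proof -
  have "observe D (sem (PFor ''m'' (Var ''P'') push_mask) t) z \<longleftrightarrow> observe D t z \<or>
      (\<exists>m < val (Var ''P'') t. pushes m z)" for z
  proof (rule accumulate_For[where obs = "observe D"], goal_cases)
    case (2 m u z)
    have fr: "u y = t y" if "y \<notin> {''m'', ''m0'', ''m1'', ''out'', ''inn'', ''a'', ''mm'', ''dec'', ''p'', ''bad'', ''b'', ''rel''}" for y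
      by (rule 2(3)) (use that in \<open>simp add: writes_push_mask\<close>)
    have fu: "fixed u" by (rule fixed_frame[OF f], rule fr) auto
    have m: "m < 2 ^ D" using 2(1) fixedD(2)[OF f] by simp
    \<comment> \<open>The masks treated before wrote only to the rows of the parent, so the tables
      of \<open>v\<close> are still those of \<open>\<sigma>\<close>.\<close>
    have keep_bad: "bad_at u (v * 2 ^ D + m') = bad_at t (v * 2 ^ D + m')" if "m' < 2 ^ D" for m'
    proof -
      have "\<not> pushes j (Inl (v * 2 ^ D + m'))" if "j < m" for j
        using pushed_row_ne[of _ v j D m'] \<open>m' < 2 ^ D\<close> that m nb_D by (fastforce simp: pushes_def is_parent_def)
      then show ?thesis using 2(4)[of "Inl (v * 2 ^ D + m')"] by auto
    qed
    have keep_rel: "rel_at D u (v * 2 ^ D + m', a, b) = rel_at D t (v * 2 ^ D + m', a, b)" if "m' < 2 ^ D" for m' a b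
    proof -
      have "\<not> pushes j (Inr (Inl (v * 2 ^ D + m', a, b)))" if "j < m" for j
        using pushed_row_ne[of _ v j D m'] \<open>m' < 2 ^ D\<close> that m nb_D by (fastforce simp: pushes_def is_parent_def)
      then show ?thesis using 2(4)[of "Inr (Inl (v * 2 ^ D + m', a, b))"] by auto
    qed
    have "row_ok \<sigma> v u" using row keep_bad keep_rel unfolding row_ok_def[OF loc v] by simp
    moreover have "u ''v'' 0 = v" "u ''c'' 0 = col v" using vv c by (simp_all add: fr)
    ultimately have "push_ready \<sigma> v u" using fu m 2(2) unfolding push_ready_def[OF loc v] by simp
    from push_mask_spec[OF this, of z] show ?case unfolding 2(2) .
  qed (simp add: observe_upd)
  then show ?thesis using fixedD(2)[OF f] by simp
qed

end

section \<open>Elimination of all vertices by decreasing rank\<close>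

lemma pos_vert: "i < n \<Longrightarrow> pos (vert i) = i"
  using vert[of i] by (simp add: pos_def)

lemma vert_pos: "v < n \<Longrightarrow> vert (pos v) = v"
  using rank[of v] by (simp add: pos_def)

text \<open>The mask of one colour stands for \<open>v\<close> alone at \<open>v\<close>; this
  justifies how \<open>alone\<close> is computed.\<close>

lemma S_single:
  assumes v: "v < n"
  shows "S (2 ^ col v) \<inter> X v = {v} \<inter> X v"
proof -
  have "u \<in> S (2 ^ col v) \<longleftrightarrow> u = v" if "u \<in> X v" for u
    using col_inj[OF v that, of v] X_sub[OF v that] v by (auto simp: S_def bit_exp_iff)
  then show ?thesis by blast
qed

lemma represents_row: "represents t \<sigma> \<longleftrightarrow> (\<forall>v < n. row_ok \<sigma> v t)" if "local_tables \<sigma>"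
  unfolding represents_def using row_ok_def[OF that] by auto

definition decided :: "store \<Rightarrow> nat \<Rightarrow> bool" where
  "decided t v \<longleftrightarrow> (\<forall>m < 2 ^ D. t ''dec'' (v * 2 ^ D + m) \<noteq> 0 \<longleftrightarrow>
      decision v (fst (pushed (n - 1 - pos v)) v) (snd (pushed (n - 1 - pos v)) v) (S m)) \<and>
     (t ''alone'' v \<noteq> 0 \<longleftrightarrow> \<not> fst (pushed (n - 1 - pos v)) v {v})"

text \<open>The tables follow the current state \<open>pushed i\<close>, but a recorded decision is
  compared with the state in which its vertex was eliminated. Entries of vertices still to come must
  be 0, since decisions are only ever set.\<close>

definition pushing_inv :: "nat \<Rightarrow> store \<Rightarrow> bool" where
  "pushing_inv i t \<longleftrightarrow> represents t (pushed i) \<and>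
     (\<forall>v < n. if n - 1 - pos v < i then decided t v else \<forall>m < 2 ^ D. t ''dec'' (v * 2 ^ D + m) = 0)"

lemma pushing_inv_upd: "pushing_inv j (upd ''i'' 0 k t) = pushing_inv j t"
  by (simp add: pushing_inv_def represents_def decided_def bad_at_upd rel_at_upd upd_apply)

lemma pushing_step:
  assumes f: "fixed t" and i: "i < n" "t ''i'' 0 = i" and inv: "pushing_inv i t"
  shows "pushing_inv (Suc i) (sem push_vertex t)"
proof -
  define v where "v = vert (n - 1 - i)"
  have v: "v < n" "pos v = n - 1 - i" using vert[of "n - 1 - i"] pos_vert[of "n - 1 - i"] i(1) by (auto simp: v_def)
  have iv: "n - 1 - pos v = i" using v i(1) by simp
  let ?\<sigma> = "pushed i"
  have loc: "local_tables ?\<sigma>" using local_pushed[of i] i(1) by simp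
  have cD: "col v < D" using col[OF v(1)] by simp
  have cP: "(2 :: nat) ^ col v < 2 ^ D" using cD by simp
  define s where "s = upd ''c'' 0 (col v) (upd ''v'' 0 v t)"
  have fs: "fixed s" by (rule fixed_frame[OF f]) (auto simp: s_def upd_apply)
  have sv: "s ''v'' 0 = v" "s ''c'' 0 = col v" "s ''bad'' = t ''bad''" by (simp_all add: s_def upd_apply)
  have rows: "row_ok ?\<sigma> w t" if "w < n" for w
    using inv represents_row[OF loc] that by (simp add: pushing_inv_def)
  have alone: "t ''bad'' (val (cell2 (Var ''v'') (Read ''pw'' (Var ''c''))) s) \<noteq> 0 \<longleftrightarrow> fst ?\<sigma> v {v}"
  proof -
    have "val (cell2 (Var ''v'') (Read ''pw'' (Var ''c''))) s = v * 2 ^ D + 2 ^ col v"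
      using fixedD(3)[OF fs cD] by (simp add: cell_vals(1)[OF fs] sv)
    moreover have "bad_at t (v * 2 ^ D + 2 ^ col v) \<longleftrightarrow> fst ?\<sigma> v (S (2 ^ col v))"
      using rows[OF v(1)] cP unfolding row_ok_def[OF loc v(1)] by blast
    moreover have "fst ?\<sigma> v (S (2 ^ col v)) = fst ?\<sigma> v {v}"
      by (rule local_tablesD(1)[OF loc _ S_single[OF v(1)]]) (simp add: v)
    ultimately show ?thesis by (simp add: bad_at_def)
  qed
  define u where "u = upd ''alone'' v (of_bool (\<not> fst ?\<sigma> v {v})) s"
  have sem: "sem push_vertex t = sem (PFor ''m'' (Var ''P'') push_mask) u"
  proof -
    have "val (Read ''vert'' (Var ''n'' [-] Const 1 [-] Var ''i'')) t = v"
      using fixedD(4,9)[OF f] i by (simp add: v_def)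
    moreover have "val (Read ''col'' (Var ''v'')) (upd ''v'' 0 v t) = col v"
      using fixedD(6)[OF f] by (simp add: upd_apply)
    moreover have "val (Read ''bad'' (cell2 (Var ''v'') (Read ''pw'' (Var ''c''))) [=] Const 0) s = of_bool (\<not> fst ?\<sigma> v {v})"
      using alone by (simp add: sv)
    ultimately show ?thesis
      unfolding push_vertex_def u_def s_def sem.simps(2,3) by (simp only: val.simps(1)) (simp add: upd_apply)
  qed
  have fu: "fixed u" by (rule fixed_frame[OF fs]) (auto simp: u_def upd_apply)
  have uv: "u ''v'' 0 = v" "u ''c'' 0 = col v" by (simp_all add: u_def sv upd_apply)
  have obs_u: "observe D u = observe D t" by (simp add: u_def s_def observe_upd)
  have row_u: "row_ok ?\<sigma> v u"
  proof -
    have "bad_at u = bad_at t" "rel_at D u = rel_at D t"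
      by (simp_all add: u_def s_def rel_at_upd bad_at_upd)
    then show ?thesis using rows[OF v(1)] unfolding row_ok_def[OF loc v(1)] by simp
  qed
  let ?t = "sem push_vertex t"
  have obs: "observe D ?t z \<longleftrightarrow> observe D t z \<or> (\<exists>m < 2 ^ D. pushes ?\<sigma> v m z)" for z
    unfolding sem using push_masks_spec[OF loc v(1) fu uv row_u, of z] unfolding obs_u .
  note ps = pushes_def[OF loc v(1)]
  have nxt: "pushed (Suc i) = push v ?\<sigma>" by (simp add: v_def)
  have loc': "local_tables (pushed (Suc i))" using local_pushed[of "Suc i"] i(1) by simp
  have row': "row_ok (pushed (Suc i)) w ?t" if w: "w < n" for w
    unfolding row_ok_def[OF loc' w]
  proof (intro allI impI conjI)
    fix m assume m: "m < (2 :: nat) ^ D"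
    have "bad_at ?t (w * 2 ^ D + m) \<longleftrightarrow> bad_at t (w * 2 ^ D + m) \<or>
        is_parent w v \<and> elim_bad v (fst ?\<sigma> v) (snd ?\<sigma> v) (S m)"
      using obs[of "Inl (w * 2 ^ D + m)"] row_inj[OF m] m by (auto simp: ps)
    also have "bad_at t (w * 2 ^ D + m) \<longleftrightarrow> fst ?\<sigma> w (S m)"
      using rows[OF w] m unfolding row_ok_def[OF loc w] by blast
    finally show "bad_at ?t (w * 2 ^ D + m) \<longleftrightarrow> fst (pushed (Suc i)) w (S m)"
      unfolding nxt by (simp add: push_def)
    fix a b assume ab: "a < D" "b < D"
    have "rel_at D ?t (w * 2 ^ D + m, a, b) \<longleftrightarrow> rel_at D t (w * 2 ^ D + m, a, b) \<or>
        is_parent w v \<and> coloured (elim_rel v (fst ?\<sigma> v) (snd ?\<sigma> v) (S m)) a b"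
      using obs[of "Inr (Inl (w * 2 ^ D + m, a, b))"] row_inj[OF m] m ab by (auto simp: ps)
    also have "rel_at D t (w * 2 ^ D + m, a, b) \<longleftrightarrow> coloured (snd ?\<sigma> w (S m)) a b"
      using rows[OF w] m ab unfolding row_ok_def[OF loc w] by blast
    finally show "rel_at D ?t (w * 2 ^ D + m, a, b) \<longleftrightarrow> coloured (snd (pushed (Suc i)) w (S m)) a b"
      unfolding nxt by (auto simp: push_def coloured_def)
  qed
  have dec: "?t ''dec'' (w * 2 ^ D + m) \<noteq> 0 \<longleftrightarrow> t ''dec'' (w * 2 ^ D + m) \<noteq> 0 \<or>
      w = v \<and> decision v (fst ?\<sigma> v) (snd ?\<sigma> v) (S m)" if m: "m < 2 ^ D" for w m
    using obs[of "Inr (Inr (w * 2 ^ D + m))"] row_inj[OF m] m by (auto simp: ps)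
  have al: "?t ''alone'' = (t ''alone'')(v := of_bool (\<not> fst ?\<sigma> v {v}))"
  proof -
    have "?t ''alone'' = u ''alone''" unfolding sem by (rule sem_frame) (simp add: writes_push_mask)
    then show ?thesis by (simp add: u_def s_def upd_apply)
  qed
  have "if n - 1 - pos w < Suc i then decided ?t w else \<forall>m < 2 ^ D. ?t ''dec'' (w * 2 ^ D + m) = 0"
    if w: "w < n" for w
  proof (cases "w = v")
    case True
    have "\<forall>m < 2 ^ D. t ''dec'' (v * 2 ^ D + m) = 0"
      using inv v(1) iv unfolding pushing_inv_def by (metis less_irrefl)
    then have "decided ?t v" unfolding decided_def iv using dec[of _ v] al by simp
    then show ?thesis using True iv by simp
  next
    case False
    then have "pos w \<noteq> pos v" using vert_pos w v(1) by metis
    moreover have "pos w < n" using rank[OF w] by (simp add: pos_def) linarith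
    ultimately have *: "n - 1 - pos w < Suc i \<longleftrightarrow> n - 1 - pos w < i" using v(2) i(1) by linarith
    have "?t ''alone'' w = t ''alone'' w" using al False by simp
    moreover have "?t ''dec'' (w * 2 ^ D + m) \<noteq> 0 \<longleftrightarrow> t ''dec'' (w * 2 ^ D + m) \<noteq> 0" if "m < 2 ^ D" for m
      using dec[OF that, of w] False by simp
    ultimately have "decided ?t w = decided t w"
      "(\<forall>m < 2 ^ D. ?t ''dec'' (w * 2 ^ D + m) = 0) = (\<forall>m < 2 ^ D. t ''dec'' (w * 2 ^ D + m) = 0)"
      unfolding decided_def by auto
    then show ?thesis using inv w * unfolding pushing_inv_def by simp
  qed
  then show ?thesis unfolding pushing_inv_def represents_row[OF loc'] using row' by blast
qed

lemma pushing_spec: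
  assumes f: "fixed s" and rep: "represents s base" and dec: "s ''dec'' = (\<lambda>_. 0)" and v: "v < n"
  shows "decided (sem pushing s) v"
proof -
  have "pushing_inv (val (Var ''n'') s) (sem pushing s)"
    unfolding pushing_def
  proof (rule sem_For[where I = pushing_inv], goal_cases)
    case 1
    show ?case unfolding pushing_inv_upd using rep dec by (simp add: pushing_inv_def)
  next
    case (2 i t)
    have ft: "fixed t"
      by (rule fixed_frame[OF f], rule 2(4)) (auto simp: push_vertex_def writes_push_mask)
    have "i < n" using 2(1) fixedD(4)[OF f] by simp
    from pushing_step[OF ft this 2(3,2)] show ?case unfolding pushing_inv_upd .
  qed
  then have "pushing_inv n (sem pushing s)" using fixedD(4)[OF f] by simp
  moreover have "n - 1 - pos v < n" using v by simp
  ultimately show ?thesis using v unfolding pushing_inv_def by simp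
qed

end

section \<open>Labelling\<close>

definition mask_step :: prog where
  "mask_step = when (nbr (Var ''v'') (Var ''b''))
      (when (Read ''mec'' (nbr (Var ''v'') (Var ''b'') [-] Const 1) [=] Var ''x'')
        (''m'' ::= Var ''P'' [-] (Var ''P'' [-] (Var ''m'' [+] Read ''pw'' (Var ''b'')))))"

lemma label_mask_eq: "label_mask = (''m'' ::= Const 0 ;; PFor ''b'' (Var ''D'') mask_step)"
  by (simp add: label_mask_def mask_step_def)

lemma writes_mask_step: "writes mask_step = {''m''}"
  by (simp add: mask_step_def)

lemma writes_label_mask: "writes label_mask = {''m'', ''b''}"
  by (auto simp: label_mask_eq writes_mask_step)

definition label_step :: prog where
  "label_step = when (nbr (Var ''v'') (Var ''a''))
      (''x'' ::= Read ''mec'' (nbr (Var ''v'') (Var ''a'') [-] Const 1) ;;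
       when (Var ''x'')
        (label_mask ;; when (Read ''dec'' (cell2 (Var ''v'') (Var ''m''))) (PWrite ''mec'' (Var ''v'') (Var ''x''))))"

lemma label_vertex_eq: "label_vertex = (''v'' ::= Read ''vert'' (Var ''i'') ;;
     PFor ''a'' (Var ''D'') label_step ;;
     when (Read ''mec'' (Var ''v'') [=] Const 0)
      (when (Read ''alone'' (Var ''v'')) (PWrite ''mec'' (Var ''v'') (Var ''v'' [+] Const 1))))"
  by (simp add: label_vertex_def label_step_def)

lemma writes_label_step: "writes label_step = {''x'', ''m'', ''b'', ''mec''}"
  by (auto simp: label_step_def writes_label_mask)

context ranking_arrays
begin

lemma label_mask_spec:
  assumes f: "fixed t"
  defines "v \<equiv> t ''v'' 0"
  shows "sem label_mask t ''m'' 0 < 2 ^ D"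
    and "bit (sem label_mask t ''m'' 0) k \<longleftrightarrow> k < D \<and> nt (v * D + k) \<noteq> 0 \<and> t ''mec'' (nt (v * D + k) - 1) = t ''x'' 0"
proof -
  let ?c = "\<lambda>k. nt (v * D + k) \<noteq> 0 \<and> t ''mec'' (nt (v * D + k) - 1) = t ''x'' 0"
  let ?I = "\<lambda>b u. u ''m'' 0 < 2 ^ b \<and> (\<forall>k. bit (u ''m'' 0 :: nat) k \<longleftrightarrow> k < b \<and> ?c k)"
  let ?s = "upd ''m'' 0 0 t"
  have "?I (val (Var ''D'') ?s) (sem (PFor ''b'' (Var ''D'') mask_step) ?s)"
  proof (rule sem_For[where I = ?I], goal_cases)
    case 1
    show ?case by (simp add: upd_apply)
  next
    case (2 b u)
    have fr: "u y = t y" if "y \<notin> {''b'', ''m''}" for y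
    proof -
      have "u y = ?s y" by (rule 2(4)) (use that in \<open>simp add: writes_mask_step\<close>)
      then show ?thesis using that by (simp add: upd_apply)
    qed
    have fu: "fixed u" by (rule fixed_frame[OF f], rule fr) auto
    have b: "b < D" using 2(1) fixedD(1)[OF f] by (simp add: upd_apply)
    let ?m = "u ''m'' 0"
    have nbrv: "val (nbr (Var ''v'') (Var ''b'')) u = nt (v * D + b)"
      using fixedD(1,7)[OF fu] 2(3) by (simp add: nbr_def fr v_def)
    show ?case
    proof (cases "?c b")
      case True
      have nb: "\<not> bit ?m b" using 2(2) by simp
      have "(2 :: nat) ^ Suc b \<le> 2 ^ D" using b by (intro power_increasing) auto
      \<comment> \<open>The second bound makes the double subtraction from \<open>P\<close> return
        the sum itself.\<close>
      then have le: "?m + 2 ^ b < 2 ^ Suc b" "?m + 2 ^ b \<le> 2 ^ D" using 2(2) by simp_all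
      have "sem mask_step u = upd ''m'' 0 (?m + 2 ^ b) u"
        using True nbrv fixedD(2,3)[OF fu] b 2(3) le by (simp add: mask_step_def fr)
      moreover have "?m + 2 ^ b = set_bit b ?m" using set_bit_eq[of b ?m] nb by simp
      ultimately have m': "upd ''b'' 0 (Suc b) (sem mask_step u) ''m'' 0 = set_bit b ?m" "set_bit b ?m < 2 ^ Suc b"
        using le by (simp_all add: upd_apply)
      show ?thesis unfolding m'(1) using m'(2) 2(2) True by (auto simp: bit_set_bit_iff less_Suc_eq)
    next
      case False
      then have "sem mask_step u = u"
        using nbrv by (cases "nt (v * D + b) = 0") (simp_all add: mask_step_def fr)
      moreover have "?m < 2 ^ Suc b" using 2(2) by simp
      moreover have "bit ?m k \<longleftrightarrow> k < Suc b \<and> ?c k" for k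
        using 2(2) False less_Suc_eq by metis
      ultimately show ?thesis by (simp add: upd_apply)
    qed
  qed
  moreover have "val (Var ''D'') ?s = D" using fixedD(1)[OF f] by (simp add: upd_apply)
  moreover have "sem (PFor ''b'' (Var ''D'') mask_step) ?s = sem label_mask t" by (simp add: label_mask_eq)
  ultimately have "?I D (sem label_mask t)" by simp
  then show "sem label_mask t ''m'' 0 < 2 ^ D"
    and "bit (sem label_mask t ''m'' 0) k \<longleftrightarrow> k < D \<and> nt (v * D + k) \<noteq> 0 \<and> t ''mec'' (nt (v * D + k) - 1) = t ''x'' 0"
    by blast+
qed

section \<open>Labels of the maximal end-components\<close>

abbreviation "is_mec \<equiv> mec {..<n} E VP"

text \<open>The vertex of least rank, at which the algorithm starts the component and creates the
  label \<open>v + 1\<close>.\<close>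

definition leader :: "nat set \<Rightarrow> nat" where
  "leader M = vert (Min (pos ` M))"

text \<open>The successor keeps labels nonzero, and distinct components have distinct leaders, since
  maximal end-components are disjoint.\<close>

definition label :: "nat \<Rightarrow> nat" where
  "label v = (if \<exists>M. is_mec M \<and> v \<in> M then Suc (leader (THE M. is_mec M \<and> v \<in> M)) else 0)"

lemma is_mec_sub: "is_mec M \<Longrightarrow> M \<subseteq> {..<n} \<and> M \<noteq> {}"
  by (simp add: mec_def ec_def)

lemma leader_in:
  assumes "is_mec M"
  shows "leader M \<in> M"
proof -
  have M: "M \<subseteq> {..<n}" "M \<noteq> {}" using is_mec_sub[OF assms] by auto
  then have "finite M" using finite_subset by blast
  then have "Min (pos ` M) \<in> pos ` M" using M by (intro Min_in) auto
  then obtain u where "u \<in> M" "pos u = Min (pos ` M)" by auto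
  then show ?thesis using vert_pos[of u] M by (auto simp: leader_def)
qed

lemma label_mec:
  assumes "is_mec M" "v \<in> M"
  shows "label v = Suc (leader M)"
proof -
  have "(THE M. is_mec M \<and> v \<in> M) = M"
  proof (rule the_equality)
    show "M' = M" if "is_mec M' \<and> v \<in> M'" for M'
      using mec_unique[of "{..<n}" E VP M' M v] that assms by simp
  qed (use assms in simp)
  then show ?thesis using assms by (auto simp: label_def)
qed

lemma label_eq_iff:
  assumes "is_mec M" "v \<in> M"
  shows "label w = label v \<longleftrightarrow> w \<in> M"
proof
  assume eq: "label w = label v"
  then have "label w \<noteq> 0" using label_mec[OF assms] by simp
  then obtain M' where M': "is_mec M'" "w \<in> M'" by (auto simp: label_def split: if_splits)
  then have "leader M' = leader M" using eq label_mec[OF assms] label_mec[OF M'] by simp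
  then have "M' = M" using leader_in[OF M'(1)] leader_in[OF assms(1)] mec_unique[OF M'(1) assms(1)] by simp
  then show "w \<in> M" using M' by simp
qed (simp add: label_mec[OF assms] label_mec[OF assms(1)])

lemma label_nonzero: "label v \<noteq> 0 \<longleftrightarrow> (\<exists>M. is_mec M \<and> v \<in> M)"
  by (simp add: label_def)

lemma nb_below: "v < n \<Longrightarrow> u \<in> nb v \<Longrightarrow> u \<in> below (pos v)"
  using N_sub[of v u] by (auto simp: below_def)

lemma decision_nb:
  assumes "local_tables \<sigma>" "v < n" "decision v (fst \<sigma> v) (snd \<sigma> v) S'"
  shows "\<exists>u \<in> nb v. u \<in> S'"
proof -
  obtain a where a: "a \<in> S' - {v}" "(v, a) \<in> snd \<sigma> v (insert v S')"
    using assms(3) unfolding decision_def by blast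
  have "snd \<sigma> v (insert v S') \<subseteq> (insert v S' \<inter> X v) \<times> (insert v S' \<inter> X v)"
    by (rule local_tablesD(3)[OF assms(1)]) (simp add: assms(2))
  then have "a \<in> X v" using a(2) by blast
  then show ?thesis using a(1) by blast
qed

lemma pushed_local: "local_tables (pushed (n - 1 - pos v))"
  by (rule local_pushed) simp

text \<open>The mask of the neighbours labelled like \<open>u\<close> agrees on \<open>nb v\<close>
  with the trace of the component of \<open>u\<close>, and the decision at \<open>v\<close> depends
  on nothing else.\<close>

lemma dec_label:
  assumes d: "decided s v" and v: "v < n" and u: "u \<in> nb v" "label u \<noteq> 0"
    and m: "m < 2 ^ D" "\<And>w. w \<in> nb v \<Longrightarrow> w \<in> S m \<longleftrightarrow> label w = label u"
  shows "s ''dec'' (v * 2 ^ D + m) \<noteq> 0 \<longleftrightarrow> label v = label u"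
proof -
  let ?\<sigma> = "pushed (n - 1 - pos v)"
  obtain M where M: "is_mec M" "u \<in> M" using u(2) label_nonzero by auto
  have ne: "M \<inter> below (pos v) \<noteq> {}" using nb_below[OF v u(1)] M(2) by auto
  have eq: "S m \<inter> nb v = (M \<inter> below (pos v)) \<inter> nb v"
    using m(2) label_eq_iff[OF M] nb_below[OF v] by blast
  have "s ''dec'' (v * 2 ^ D + m) \<noteq> 0 \<longleftrightarrow> decision v (fst ?\<sigma> v) (snd ?\<sigma> v) (S m)"
    using d m(1) unfolding decided_def by blast
  also have "\<dots> \<longleftrightarrow> decision v (fst ?\<sigma> v) (snd ?\<sigma> v) (M \<inter> below (pos v))"
    by (rule decision_local[OF pushed_local _ eq]) (simp add: v)
  also have "\<dots> \<longleftrightarrow> v \<in> M" using mec_step(1)[OF _ refl M(1) ne] v by simp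
  also have "\<dots> \<longleftrightarrow> label v = label u" using label_eq_iff[OF M] by simp
  finally show ?thesis .
qed

text \<open>The earlier vertices of the component of \<open>v\<close> may be far from
  \<open>v\<close> in the graph. Yet the decision for it is positive, and a positive decision
  exhibits an arc of the table between \<open>v\<close> and the trace, whose other end lies in
  \<open>nb v\<close>. So inspecting the row of \<open>v\<close> is enough.\<close>

lemma label_neighbour:
  assumes v: "v < n"
  shows "(\<exists>u \<in> nb v. label u \<noteq> 0 \<and> label u = label v) \<longleftrightarrow>
    (\<exists>M. is_mec M \<and> v \<in> M \<and> M \<inter> below (pos v) \<noteq> {})"
proof
  assume "\<exists>u \<in> nb v. label u \<noteq> 0 \<and> label u = label v"
  then obtain u where u: "u \<in> nb v" "label u \<noteq> 0" "label u = label v" by auto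
  then obtain M where M: "is_mec M" "v \<in> M" using label_nonzero by metis
  then have "u \<in> M" using label_eq_iff[OF M] u(3) by simp
  then show "\<exists>M. is_mec M \<and> v \<in> M \<and> M \<inter> below (pos v) \<noteq> {}" using M nb_below[OF v u(1)] by blast
next
  assume "\<exists>M. is_mec M \<and> v \<in> M \<and> M \<inter> below (pos v) \<noteq> {}"
  then obtain M where M: "is_mec M" "v \<in> M" "M \<inter> below (pos v) \<noteq> {}" by auto
  let ?\<sigma> = "pushed (n - 1 - pos v)"
  have "decision v (fst ?\<sigma> v) (snd ?\<sigma> v) (M \<inter> below (pos v))"
    using mec_step(1)[OF _ refl M(1,3)] v M(2) by simp
  from decision_nb[OF pushed_local v this] obtain u where u: "u \<in> nb v" "u \<in> M" by auto
  then show "\<exists>u \<in> nb v. label u \<noteq> 0 \<and> label u = label v"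
    using label_mec[OF M(1,2)] label_mec[OF M(1) u(2)] by (intro bexI[of _ u]) auto
qed

lemma alone_label:
  assumes d: "decided s v" and v: "v < n" and no: "\<not> (\<exists>u \<in> nb v. label u \<noteq> 0 \<and> label u = label v)"
  shows "label v = (if s ''alone'' v \<noteq> 0 then Suc v else 0)"
proof -
  let ?\<sigma> = "pushed (n - 1 - pos v)"
  have new: "M \<inter> below (pos v) = {}" if "is_mec M" "v \<in> M" for M
    using no that unfolding label_neighbour[OF v] by blast
  have al: "s ''alone'' v \<noteq> 0 \<longleftrightarrow> (\<exists>M. is_mec M \<and> v \<in> M)"
    using d mec_step(2)[OF _ refl new] v unfolding decided_def by auto
  show ?thesis
  proof (cases "\<exists>M. is_mec M \<and> v \<in> M")
    case True
    then obtain M where M: "is_mec M" "v \<in> M" by auto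
    \<comment> \<open>Any other leader would precede \<open>v\<close> in its component, contrary to
      the absence of earlier vertices.\<close>
    have "leader M = v"
    proof (rule ccontr)
      assume ne: "leader M \<noteq> v"
      have L: "leader M \<in> M" "leader M < n" using leader_in[OF M(1)] is_mec_sub[OF M(1)] by auto
      have fin: "finite (pos ` M)" using is_mec_sub[OF M(1)] finite_subset by blast
      have "Min (pos ` M) \<in> pos ` M" using fin M(2) by (intro Min_in) auto
      then have lt: "Min (pos ` M) < n" using is_mec_sub[OF M(1)] rk_less by auto
      then have "pos (leader M) = Min (pos ` M)" unfolding leader_def by (rule pos_vert)
      then have "pos (leader M) \<le> pos v" using fin M(2) by simp
      moreover have "pos (leader M) \<noteq> pos v" using ne L(2) v vert_pos by metis
      ultimately have "leader M \<in> below (pos v)" using L(2) by (simp add: below_def)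
      then show False using new[OF M] L(1) by auto
    qed
    then show ?thesis using al True label_mec[OF M] by simp
  next
    case False
    then have "label v = 0" "s ''alone'' v = 0" using al label_nonzero[of v] by auto
    then show ?thesis by simp
  qed
qed

lemma label_vertex_spec:
  assumes f: "fixed t" and i: "i < n" "t ''i'' 0 = i"
    and dec: "\<And>v. v < n \<Longrightarrow> decided t v"
    and old: "\<And>v. v < n \<Longrightarrow> pos v < i \<Longrightarrow> t ''mec'' v = label v" and zero: "t ''mec'' (vert i) = 0"
  shows "sem label_vertex t ''mec'' = (t ''mec'')(vert i := label (vert i))"
proof -
  define v where "v = vert i"
  have v: "v < n" "pos v = i" using vert[OF i(1)] pos_vert[OF i(1)] by (auto simp: v_def)
  define s where "s = upd ''v'' 0 v t"
  have fs: "fixed s" by (rule fixed_frame[OF f]) (auto simp: s_def upd_apply)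
  have nb_label: "t ''mec'' u = label u" "u \<noteq> v" if "u \<in> nb v" for u
  proof -
    have "u < n" "pos u < i" using nb_below[OF v(1) that] v(2) by (auto simp: below_def)
    then show "t ''mec'' u = label u" "u \<noteq> v" using old v(2) by auto
  qed
  let ?P = "\<lambda>a. \<exists>u. nt (v * D + a) = Suc u \<and> label u \<noteq> 0 \<and> label u = label v"
  \<comment> \<open>The entry of \<open>v\<close> remains 0 until a neighbour carrying the label of
    \<open>v\<close> is met; every later successful test writes the same label.\<close>
  let ?I = "\<lambda>a u. u ''mec'' = (t ''mec'')(v := if \<exists>a' < a. ?P a' then label v else 0)"
  have loop: "?I (val (Var ''D'') s) (sem (PFor ''a'' (Var ''D'') label_step) s)"
  proof (rule sem_For[where I = ?I], goal_cases)
    case 1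
    show ?case using zero by (auto simp: s_def upd_apply v_def)
  next
    case (2 a u)
    have fr: "u y = s y" if "y \<notin> {''a'', ''x'', ''m'', ''b'', ''mec''}" for y
      by (rule 2(4)) (use that in \<open>simp add: writes_label_step\<close>)
    have fu: "fixed u" by (rule fixed_frame[OF fs], rule fr) auto
    have a: "a < D" using 2(1) fixedD(1)[OF fs] by simp
    have uv: "u ''v'' 0 = v" "u ''dec'' = t ''dec''" by (simp_all add: fr s_def upd_apply)
    have nbrv: "val (nbr (Var ''v'') (Var ''a'')) u = nt (v * D + a)"
      using fixedD(1,7)[OF fu] 2(3) uv by (simp add: nbr_def)
    have skip: "(\<exists>a' < Suc a. ?P a') \<longleftrightarrow> (\<exists>a' < a. ?P a')" if "\<not> ?P a"
      using that less_Suc_eq by metis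
    show ?case
    proof (cases "nt (v * D + a)")
      case 0
      then have "sem label_step u = u" using nbrv by (simp add: label_step_def)
      moreover have "\<not> ?P a" using 0 by simp
      ultimately show ?thesis unfolding skip[OF \<open>\<not> ?P a\<close>] using 2(2) by (simp add: upd_apply)
    next
      case (Suc w)
      then have w: "w \<in> nb v" "col w = a" using nt_iff[OF a] by auto
      have mw: "u ''mec'' w = label w" using 2(2) nb_label[OF w(1)] by simp
      show ?thesis
      proof (cases "label w = 0")
        case True
        then have "sem label_step u = upd ''x'' 0 0 u" using nbrv Suc mw by (simp add: label_step_def upd_apply)
        moreover have "\<not> ?P a" using Suc True by simp
        ultimately show ?thesis unfolding skip[OF \<open>\<not> ?P a\<close>] using 2(2) by (simp add: upd_apply)
      next
        case False
        define u1 where "u1 = upd ''x'' 0 (label w) u"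
        define u2 where "u2 = sem label_mask u1"
        have f1: "fixed u1" by (rule fixed_frame[OF fu]) (auto simp: u1_def upd_apply)
        have fr2: "u2 y = u1 y" if "y \<notin> {''m'', ''b''}" for y
          unfolding u2_def using that by (intro sem_frame) (simp add: writes_label_mask)
        have f2: "fixed u2" by (rule fixed_frame[OF f1], rule fr2) auto
        let ?m = "u2 ''m'' 0"
        have v1: "u1 ''v'' 0 = v" "u1 ''x'' 0 = label w" "u1 ''mec'' = u ''mec''" by (simp_all add: u1_def upd_apply uv)
        note lm = label_mask_spec[OF f1, folded u2_def, unfolded v1]
        have "x \<in> S ?m \<longleftrightarrow> label x = label w" if x: "x \<in> nb v" for x
        proof -
          have xn: "x < n" "col x < D" using nb_D[OF x] col[of x] by auto
          have ntx: "nt (v * D + col x) = Suc x" using nt_iff[OF xn(2)] x by simp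
          have "u ''mec'' x = label x" using 2(2) nb_label[OF x] by simp
          then show ?thesis using lm(2)[of "col x"] xn ntx by (simp add: S_def)
        qed
        then have "t ''dec'' (v * 2 ^ D + ?m) \<noteq> 0 \<longleftrightarrow> label v = label w"
          using dec_label[OF dec[OF v(1)] v(1) w(1) False lm(1)] by simp
        moreover have "val (Read ''dec'' (cell2 (Var ''v'') (Var ''m''))) u2 = t ''dec'' (v * 2 ^ D + ?m)"
          by (simp add: cell_vals(1)[OF f2]) (simp add: fr2 u1_def upd_apply uv)
        moreover have "sem label_step u = sem (when (Read ''dec'' (cell2 (Var ''v'') (Var ''m''))) (PWrite ''mec'' (Var ''v'') (Var ''x''))) u2"
          using nbrv Suc mw False by (simp add: label_step_def u2_def u1_def upd_apply)
        ultimately have sem: "sem label_step u = (if label v = label w then upd ''mec'' v (label w) u2 else u2)"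
          by (simp add: fr2 v1)
        have P: "?P a \<longleftrightarrow> label v = label w" using Suc False by auto
        have mec2: "u2 ''mec'' = u ''mec''" by (simp add: fr2 v1)
        show ?thesis
        proof (cases "label v = label w")
          case True
          have "\<exists>a' < Suc a. ?P a'" using P True by blast
          then show ?thesis using sem True mec2 2(2) by (simp add: upd_apply)
        next
          case False
          then have "\<not> ?P a" using P by simp
          then show ?thesis unfolding skip[OF \<open>\<not> ?P a\<close>] using sem False mec2 2(2) by (simp add: upd_apply)
        qed
      qed
    qed
  qed
  define s1 where "s1 = sem (PFor ''a'' (Var ''D'') label_step) s"
  have ex: "(\<exists>a < D. ?P a) \<longleftrightarrow> (\<exists>u \<in> nb v. label u \<noteq> 0 \<and> label u = label v)"
    unfolding nb_set_def by blast
  have mec1: "s1 ''mec'' = (t ''mec'')(v := if \<exists>u \<in> nb v. label u \<noteq> 0 \<and> label u = label v then label v else 0)"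
    using loop fixedD(1)[OF fs] ex unfolding s1_def[symmetric] by simp
  have fr1: "s1 y = s y" if "y \<notin> {''a'', ''x'', ''m'', ''b'', ''mec''}" for y
    unfolding s1_def using that by (intro sem_frame) (simp add: writes_label_step)
  have v1: "s1 ''v'' 0 = v" "s1 ''alone'' = t ''alone''" by (simp_all add: fr1 s_def upd_apply)
  have sem: "sem label_vertex t = sem (when (Read ''mec'' (Var ''v'') [=] Const 0)
      (when (Read ''alone'' (Var ''v'')) (PWrite ''mec'' (Var ''v'') (Var ''v'' [+] Const 1)))) s1"
    using fixedD(9)[OF f] i by (simp add: label_vertex_eq s1_def s_def v_def del: sem.simps(5))
  show ?thesis
  proof (cases "\<exists>u \<in> nb v. label u \<noteq> 0 \<and> label u = label v")
    case True
    then have "s1 ''mec'' v = label v" "label v \<noteq> 0" using mec1 by auto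
    then show ?thesis unfolding sem using mec1 True by (simp add: v1 v_def)
  next
    case False
    have mec0: "s1 ''mec'' = (t ''mec'')(v := 0)" using mec1 unfolding if_not_P[OF False] .
    then have "s1 ''mec'' v = 0" by simp
    moreover note alone_label[OF dec[OF v(1)] v(1) False]
    ultimately show ?thesis unfolding sem v_def[symmetric] by (simp add: v1 upd_apply mec0)
  qed
qed

lemma labelling_spec:
  assumes f: "fixed s" and dec: "\<And>v. v < n \<Longrightarrow> decided s v" and zero: "s ''mec'' = (\<lambda>_. 0)" and v: "v < n"
  shows "sem labelling s ''mec'' v = label v"
proof -
  let ?I = "\<lambda>i t. \<forall>v < n. t ''mec'' v = (if pos v < i then label v else 0)"
  have "?I (val (Var ''n'') s) (sem labelling s)"
    unfolding labelling_def
  proof (rule sem_For[where I = ?I], goal_cases)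
    case 1
    show ?case using zero by (simp add: upd_apply)
  next
    case (2 i t)
    have fr: "t y = s y" if "y \<notin> {''i'', ''v'', ''a'', ''x'', ''m'', ''b'', ''mec''}" for y
      by (rule 2(4)) (use that in \<open>simp add: label_vertex_eq writes_label_step\<close>)
    have ft: "fixed t" by (rule fixed_frame[OF f], rule fr) auto
    have dt: "decided t w" if "w < n" for w using dec[OF that] by (simp add: decided_def fr)
    have i: "i < n" using 2(1) fixedD(4)[OF f] by simp
    have sp: "sem label_vertex t ''mec'' = (t ''mec'')(vert i := label (vert i))"
      by (rule label_vertex_spec[OF ft i 2(3) dt]) (use 2(2) vert[OF i] pos_vert[OF i] in auto)
    have "pos w < Suc i \<longleftrightarrow> pos w < i \<or> w = vert i" if "w < n" for w
      using vert_pos[OF that] pos_vert[OF i] less_Suc_eq by metis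
    then show ?case using 2(2) by (simp add: upd_apply sp)
  qed
  moreover have "pos v < n" using rk_less[of v] v by simp
  ultimately show ?thesis using v fixedD(4)[OF f] by simp
qed

lemma output_classes_spec:
  assumes "\<And>v. v < n \<Longrightarrow> s ''mec'' v = label v"
  shows "output_classes n s = ({M. is_mec M}, {..<n} - \<Union>{M. is_mec M})"
proof -
  have "{u. u < n \<and> s ''mec'' u = s ''mec'' v} = M" if "is_mec M" "v \<in> M" for M v
  proof -
    have "v < n" using is_mec_sub[OF that(1)] that(2) by auto
    then have "s ''mec'' u = s ''mec'' v \<longleftrightarrow> u \<in> M" if "u < n" for u
      using label_eq_iff[OF \<open>is_mec M\<close> \<open>v \<in> M\<close>, of u] assms[OF that] assms[of v] by simp
    then show ?thesis using is_mec_sub[OF that(1)] by blast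
  qed
  note cls = this
  have "(\<lambda>v. {u. u < n \<and> s ''mec'' u = s ''mec'' v}) ` {v. v < n \<and> s ''mec'' v \<noteq> 0} = {M. is_mec M}"
  proof (intro equalityI subsetI)
    fix M assume "M \<in> (\<lambda>v. {u. u < n \<and> s ''mec'' u = s ''mec'' v}) ` {v. v < n \<and> s ''mec'' v \<noteq> 0}"
    then obtain v where v: "v < n" "s ''mec'' v \<noteq> 0" "M = {u. u < n \<and> s ''mec'' u = s ''mec'' v}" by auto
    then obtain M' where "is_mec M'" "v \<in> M'" using assms label_nonzero by auto
    then show "M \<in> {M. is_mec M}" using cls v(3) by simp
  next
    fix M assume "M \<in> {M. is_mec M}"
    then have M: "is_mec M" by simp
    then obtain v where v: "v \<in> M" "v < n" using is_mec_sub by blast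
    then have "s ''mec'' v \<noteq> 0" using assms label_mec[OF M v(1)] by simp
    then show "M \<in> (\<lambda>v. {u. u < n \<and> s ''mec'' u = s ''mec'' v}) ` {v. v < n \<and> s ''mec'' v \<noteq> 0}"
      using cls[OF M v(1)] v(2) by (intro image_eqI[of _ _ v]) auto
  qed
  moreover have "{v. v < n \<and> s ''mec'' v = 0} = {..<n} - \<Union>{M. is_mec M}"
  proof -
    have "s ''mec'' v = 0 \<longleftrightarrow> (\<forall>M. is_mec M \<longrightarrow> v \<notin> M)" if "v < n" for v
      using assms[OF that] label_nonzero[of v] by auto
    then show ?thesis by blast
  qed
  ultimately show ?thesis by (simp add: output_classes_def)
qed

end

section \<open>Correctness\<close>

lemma arcs_ends_induced: "arcs_ends (with_proj G \<restriction> U) = res (parcs G) U"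
  by (auto simp: arcs_ends_def arc_to_ends_def res_def image_iff)

text \<open>Reachability in the induced subgraph is the reflexive transitive closure of the
  restricted arcs when the walk starts inside; nonemptiness is part of strong connectivity.\<close>

lemma end_component_iff: "end_component G VP U \<longleftrightarrow> ec (pverts G) (parcs G) VP U"
proof -
  have "res (parcs G) U \<inter> U \<times> U = res (parcs G) U" by (auto simp: res_def)
  then have "reachable (with_proj G \<restriction> U) u v \<longleftrightarrow> (u, v) \<in> (res (parcs G) U)\<^sup>*" if "u \<in> U" for u v
    using reachable_rtrancl[of "with_proj G \<restriction> U" u v] rtrancl_reachable[of u v "with_proj G \<restriction> U"] that
    by (auto simp: arcs_ends_induced)
  then show ?thesis
    unfolding end_component_def ec_def strongly_connected_def closed_set_def by auto
qed

lemma mec_decomposition_eq: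
  "mec_decomposition G VP =
    ({M. mec (pverts G) (parcs G) VP M}, pverts G - \<Union>{M. mec (pverts G) (parcs G) VP M})"
proof -
  have "MECs G VP = {M. mec (pverts G) (parcs G) VP M}"
    unfolding MECs_def mec_def end_component_iff by auto
  then show ?thesis by (simp add: mec_decomposition_def)
qed

section \<open>Composition of the passes on a given input\<close>

locale decomposed_instance =
  fixes n k :: nat and G :: "nat pair_pre_digraph" and VP :: "nat set" and T :: "nat set pair_pre_digraph"
    and es :: "(nat \<times> nat) list" and bags :: "nat list list" and links :: "(nat \<times> nat) list"
  assumes fin: "pair_fin_digraph G" and pverts: "pverts G = {..<n}"
    and td: "tree_decomposition (mk_symmetric (with_proj G)) T" and width: "width T = k"
    and input: "lists_input G T es bags links"
begin

abbreviation "nbags \<equiv> length bags"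
abbreviation "bag_of i \<equiv> set (bags ! i)"

lemma arcs_sub: "parcs G \<subseteq> {..<n} \<times> {..<n}"
proof -
  interpret pair_fin_digraph G by (rule fin)
  show ?thesis using wellformed' pverts by auto
qed

lemma tree: "undirected_tree T"
  using td by (simp add: tree_decomposition_def)

lemma bags_Union: "\<Union>(pverts T) = {..<n}"
  using td pverts by (simp add: tree_decomposition_def mk_symmetric_def)

lemma arc_in_bag: "(u, v) \<in> parcs G \<Longrightarrow> \<exists>X \<in> pverts T. u \<in> X \<and> v \<in> X"
proof -
  assume "(u, v) \<in> parcs G"
  then have "(u, v) \<in> parcs (mk_symmetric (with_proj G))" by (auto simp: mk_symmetric_def)
  then show ?thesis using td unfolding tree_decomposition_def by fast
qed

lemma vertex_connected:
  "v < n \<Longrightarrow> Digraph_Component.connected (with_proj T \<restriction> {X \<in> pverts T. v \<in> X})"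
  using td pverts by (simp add: tree_decomposition_def mk_symmetric_def)

lemma bags_bij: "bij_betw bag_of {..<nbags} (pverts T)"
proof -
  have d: "distinct (map set bags)" and s: "set (map set bags) = pverts T"
    using input by (simp_all add: lists_input_def)
  have "inj_on bag_of {..<nbags}"
    using d by (auto simp: inj_on_def distinct_conv_nth)
  moreover have "bag_of ` {..<nbags} = pverts T"
  proof -
    have "set bags = (\<lambda>i. bags ! i) ` {..<nbags}" by (auto simp: in_set_conv_nth)
    then have "set ` set bags = bag_of ` {..<nbags}" by (simp only: image_image)
    then show ?thesis using s by simp
  qed
  ultimately show ?thesis by (simp add: bij_betw_def)
qed

lemma distinct_bag: "i < nbags \<Longrightarrow> distinct (bags ! i)"
  using input by (simp add: lists_input_def)

lemma link_bounds: "l < length links \<Longrightarrow> fst (links ! l) < nbags \<and> snd (links ! l) < nbags"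
proof -
  assume "l < length links"
  then have "links ! l \<in> {..<nbags} \<times> {..<nbags}"
    using input unfolding lists_input_def by (meson nth_mem subsetD)
  then show ?thesis by (cases "links ! l") auto
qed

lemma links_arcs: "(\<lambda>(i, j). (bag_of i, bag_of j)) ` set links = parcs T"
  using input by (simp add: lists_input_def)

lemma nbags_pos: "0 < nbags"
proof -
  have "pverts T \<noteq> {}"
    using tree unfolding undirected_tree_def Digraph_Component.connected_def strongly_connected_def
    by (auto simp: mk_symmetric_def)
  then show ?thesis using bags_bij by (auto simp: bij_betw_def)
qed

lemma finite_pverts_T: "finite (pverts T)"
  using bags_bij bij_betw_finite by blast

lemma card_bag: "X \<in> pverts T \<Longrightarrow> card X \<le> Suc k"
proof -
  assume X: "X \<in> pverts T"
  have "card X \<le> Max (card ` pverts T)" using X finite_pverts_T by (intro Max_ge) auto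
  then show ?thesis using width by (simp add: width_def)
qed

lemma length_bag: "i < nbags \<Longrightarrow> length (bags ! i) \<le> Suc k"
  using card_bag[of "bag_of i"] distinct_card[OF distinct_bag] bags_bij by (auto simp: bij_betw_def)

definition s0 :: store where
  "s0 = input_store n VP es bags links"

lemma input_arrays:
  "s0 ''n'' 0 = n" "s0 ''num_arcs'' 0 = length es" "s0 ''num_bags'' 0 = nbags" "s0 ''num_links'' 0 = length links"
  "v < n \<Longrightarrow> s0 ''is_random'' v = (if v \<in> VP then 1 else 0)"
  "e < length es \<Longrightarrow> s0 ''arc_tail'' e = fst (es ! e)" "e < length es \<Longrightarrow> s0 ''arc_head'' e = snd (es ! e)"
  "i \<le> nbags \<Longrightarrow> s0 ''bag_start'' i = length (concat (take i bags))"
  "s0 ''bag'' = array (concat bags)"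
  "l < length links \<Longrightarrow> s0 ''link_fst'' l = fst (links ! l)" "l < length links \<Longrightarrow> s0 ''link_snd'' l = snd (links ! l)"
  by (simp_all add: s0_def input_store_def array_def del: upt_Suc)

lemma input_zero:
  "x \<notin> {''n'', ''is_random'', ''num_arcs'', ''arc_tail'', ''arc_head'', ''num_bags'', ''bag_start'', ''bag'',
     ''num_links'', ''link_fst'', ''link_snd''} \<Longrightarrow> s0 x = (\<lambda>_. 0)"
  by (simp add: s0_def input_store_def)

lemma bag_size_input: "i < nbags \<Longrightarrow> s0 ''bag_start'' (Suc i) - s0 ''bag_start'' i = length (bags ! i)"
  by (simp add: input_arrays take_Suc_conv_app_nth)

lemma bag_set_input: "i < nbags \<Longrightarrow> bag_set s0 i = bag_of i"
proof -
  assume i: "i < nbags"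
  have "concat bags = concat (take i bags) @ bags ! i @ concat (drop (Suc i) bags)"
    by (metis concat.simps(2) concat_append append_take_drop_id Cons_nth_drop_Suc i)
  then have "s0 ''bag'' (s0 ''bag_start'' i + l) = bags ! i ! l" if "l < length (bags ! i)" for l
    using that i by (simp add: input_arrays array_def nth_append)
  then show ?thesis
    unfolding bag_set_def bag_size_input[OF i] set_conv_nth by (intro Collect_cong) metis
qed

definition s1 :: store where "s1 = sem max_bag s0"
definition s2 :: store where "s2 = sem powers s1"
definition s3 :: store where "s3 = sem adjacency s2"
definition s4 :: store where "s4 = sem traversal s3"
definition s5 :: store where "s5 = sem ranking s4"
definition s6 :: store where "s6 = sem own_arcs_table s5"
definition s7 :: store where "s7 = sem base_tables s6"
definition s8 :: store where "s8 = sem pushing s7"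
definition s9 :: store where "s9 = sem labelling s8"

lemma frame1: "x \<notin> {''i'', ''D''} \<Longrightarrow> s1 x = s0 x"
  unfolding s1_def by (rule sem_frame) (simp add: max_bag_def)

lemma frame2: "x \<notin> {''pw'', ''P'', ''i'', ''Q'', ''j''} \<Longrightarrow> s2 x = s1 x"
  unfolding s2_def by (rule sem_frame) (simp add: powers_def)

lemma frame3: "x \<notin> {''i'', ''next'', ''first''} \<Longrightarrow> s3 x = s2 x"
  unfolding s3_def by (rule sem_frame) (simp add: adjacency_def)

lemma frame4: "x \<notin> {''seen'', ''tail'', ''e'', ''i'', ''t'', ''order'', ''cur''} \<Longrightarrow> s4 x = s3 x"
  unfolding s4_def by (rule sem_frame) (simp add: traversal_def)

lemma frame5: "x \<notin> {''i'', ''B'', ''lo'', ''len'', ''j'', ''v'', ''best'', ''l'', ''u'', ''nbr'', ''par'', ''col'',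
    ''vert'', ''r'', ''rank''} \<Longrightarrow> s5 x = s4 x"
  unfolding s5_def by (rule sem_frame) (simp add: ranking_def rank_bag_def writes_rank_vertex)

lemma frame6: "x \<notin> {''i'', ''x'', ''y'', ''v'', ''adj'', ''ran''} \<Longrightarrow> s6 x = s5 x"
  unfolding s6_def by (rule sem_frame) (simp add: own_arcs_table_def)

lemma frame7: "x \<notin> {''v'', ''m'', ''a'', ''b'', ''rel'', ''bad''} \<Longrightarrow> s7 x = s6 x"
  unfolding s7_def by (rule sem_frame) (simp add: base_tables_def writes_base_cell)

lemma frame8: "x \<notin> {''i'', ''v'', ''c'', ''alone'', ''m'', ''m0'', ''m1'', ''out'', ''inn'', ''a'', ''mm'', ''dec'', ''p'',
    ''bad'', ''b'', ''rel''} \<Longrightarrow> s8 x = s7 x"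
  unfolding s8_def by (rule sem_frame) (simp add: pushing_def push_vertex_def writes_push_mask)

definition D :: nat where "D = s1 ''D'' 0"

lemma bag_le_D: "i < nbags \<Longrightarrow> length (bags ! i) \<le> D"
  using max_bag_spec[of s0] input_zero[of "''D''"] bag_size_input
  by (simp add: D_def s1_def[symmetric] input_arrays(3))

lemma D_le: "D \<le> Suc k"
proof -
  have "D = 0 \<or> (\<exists>i < nbags. D = length (bags ! i))"
    using max_bag_spec[of s0] input_zero[of "''D''"] bag_size_input
    by (auto simp: D_def s1_def[symmetric] input_arrays(3))
  then show ?thesis using length_bag by auto
qed

lemma powers2: "s2 ''D'' 0 = D" "s2 ''P'' 0 = 2 ^ D" "j \<le> D \<Longrightarrow> s2 ''pw'' j = 2 ^ j"
  using powers_spec(1)[where s = s1] powers_spec(2)[where s = s1]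
  by (simp_all add: s2_def[symmetric] D_def frame2)

lemma link_lists: "link_lists (length links) nbags (s0 ''link_fst'') (s0 ''link_snd'') (s3 ''next'') (s3 ''first'')"
proof
  fix b
  have "s2 ''first'' = (\<lambda>_. 0)" "s2 ''link_fst'' = s0 ''link_fst''" "s2 ''num_links'' = s0 ''num_links''"
    using input_zero[of "''first''"] by (simp_all add: frame2 frame1)
  then show "chain (s3 ''next'') (s3 ''first'' b) (links_from (s0 ''link_fst'') (length links) b)"
    using adjacency_spec[of s2 b] by (simp add: s3_def[symmetric] input_arrays(4))
qed (use link_bounds in \<open>simp_all add: input_arrays\<close>)

lemma links_eq: "link_lists.links (length links) (s0 ''link_fst'') (s0 ''link_snd'') = set links"
proof -
  interpret link_lists "length links" nbags "s0 ''link_fst''" "s0 ''link_snd''" "s3 ''next''" "s3 ''first''"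
    by (rule link_lists)
  have "local.links = {links ! l | l. l < length links}"
    unfolding links_def by (force simp: input_arrays)
  then show ?thesis by (auto simp: set_conv_nth)
qed

lemma bag_of_inj: "i < nbags \<Longrightarrow> j < nbags \<Longrightarrow> bag_of i = bag_of j \<Longrightarrow> i = j"
  using bags_bij by (auto simp: bij_betw_def inj_on_def)

lemma arc_link:
  assumes "(bag_of i, bag_of j) \<in> parcs T" "i < nbags" "j < nbags"
  shows "(i, j) \<in> set links"
proof -
  obtain i' j' where ij: "(i', j') \<in> set links" "bag_of i = bag_of i'" "bag_of j = bag_of j'"
    using assms(1) unfolding links_arcs[symmetric] by auto
  then have "i' < nbags" "j' < nbags" using input by (auto simp: lists_input_def)
  then show ?thesis using ij assms bag_of_inj by metis
qed

lemma links_connected: "b < nbags \<Longrightarrow> (0, b) \<in> (set links)\<^sup>*"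
proof -
  assume b: "b < nbags"
  have verts: "bag_of i \<in> pverts T" if "i < nbags" for i using that bags_bij by (auto simp: bij_betw_def)
  have sym: "(v, u) \<in> parcs T" if "(u, v) \<in> parcs T" for u v
  proof -
    interpret pair_graph T using tree by (simp add: undirected_tree_def)
    show ?thesis using pair_sym_arcs that unfolding symmetric_def by (auto dest: symD)
  qed
  have wf: "u \<in> pverts T \<and> v \<in> pverts T" if "(u, v) \<in> parcs T" for u v
  proof -
    interpret pair_graph T using tree by (simp add: undirected_tree_def)
    show ?thesis using wellformed' that by blast
  qed
  have "reachable (with_proj (mk_symmetric (with_proj T))) (bag_of 0) (bag_of b)"
    using tree verts[OF nbags_pos] verts[OF b]
    unfolding undirected_tree_def Digraph_Component.connected_def strongly_connected_def
    by (simp add: mk_symmetric_def)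
  from reachable_rtrancl[OF this] have "(bag_of 0, bag_of b) \<in> (parcs T)\<^sup>*"
    by (rule rtrancl_mono[THEN subsetD, rotated]) (auto simp: mk_symmetric_def intro: sym)
  then have "\<exists>j < nbags. bag_of b = bag_of j \<and> (0, j) \<in> (set links)\<^sup>*"
  proof (induction rule: rtrancl_induct)
    case base
    show ?case using nbags_pos by (intro exI[of _ 0]) simp
  next
    case (step X Y)
    then obtain j where j: "j < nbags" "X = bag_of j" "(0, j) \<in> (set links)\<^sup>*" by auto
    obtain l where l: "l < nbags" "Y = bag_of l"
      using wf[OF step.hyps(2)] bags_bij by (auto simp: bij_betw_def)
    then have "(j, l) \<in> set links" using arc_link[of j l] step.hyps(2) j by simp
    then show ?case using j l by (intro exI[of _ l]) (auto intro: rtrancl_into_rtrancl)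
  qed
  then show ?thesis using bag_of_inj b by metis
qed

definition ord :: "nat \<Rightarrow> nat" where "ord = s4 ''order''"

lemma traversal_facts:
  "bij_betw ord {..<nbags} {..<nbags}"
  "x < nbags \<Longrightarrow> 0 < x \<Longrightarrow> \<exists>y < x. (ord y, ord x) \<in> set links"
proof -
  have e: "s3 ''num_links'' 0 = length links" "s3 ''num_bags'' 0 = nbags" "s3 ''link_fst'' = s0 ''link_fst''"
    "s3 ''link_snd'' = s0 ''link_snd''" "s3 ''seen'' = (\<lambda>_. 0)" "s3 ''order'' = (\<lambda>_. 0)" "s3 ''cur'' 0 = 0"
    using input_zero[of "''seen''"] input_zero[of "''order''"] input_zero[of "''cur''"]
    by (simp_all add: frame3 frame2 frame1 input_arrays)
  have ll: "link_lists (s3 ''num_links'' 0) (s3 ''num_bags'' 0) (s3 ''link_fst'') (s3 ''link_snd'') (s3 ''next'') (s3 ''first'')"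
    unfolding e by (rule link_lists)
  have con: "(0, b) \<in> (link_lists.links (s3 ''num_links'' 0) (s3 ''link_fst'') (s3 ''link_snd''))\<^sup>*"
    if "b < s3 ''num_bags'' 0" for b
    using links_connected that unfolding e links_eq by simp
  have nb: "0 < s3 ''num_bags'' 0" unfolding e by (rule nbags_pos)
  note ts = traversal_spec[OF ll con nb e(5,6,7), folded s4_def, unfolded e links_eq, folded ord_def]
  show "bij_betw ord {..<nbags} {..<nbags}" by (rule ts(1))
  show "x < nbags \<Longrightarrow> 0 < x \<Longrightarrow> \<exists>y < x. (ord y, ord x) \<in> set links" by (rule ts(2))
qed

lemma ord_less: "x < nbags \<Longrightarrow> ord x < nbags"
  using traversal_facts(1) by (auto simp: bij_betw_def)

lemma tree_order: "tree_order T (\<lambda>x. bag_of (ord x)) nbags"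
proof
  show "undirected_tree T" by (rule tree)
  show "bij_betw (\<lambda>x. bag_of (ord x)) {..<nbags} (pverts T)"
    using bij_betw_trans[OF traversal_facts(1) bags_bij] by (simp add: o_def)
  show "\<exists>y < x. (bag_of (ord y), bag_of (ord x)) \<in> parcs T" if "x < nbags" "0 < x" for x
    using traversal_facts(2)[OF that] unfolding links_arcs[symmetric] by force
qed

lemma bag_V: "i < nbags \<Longrightarrow> bag_of i \<subseteq> {..<n}"
  using bags_Union bags_bij by (auto simp: bij_betw_def)

lemma ranking_facts: "ranking_inv D n s5 {..<n} (pverts T)"
proof -
  interpret tree_order T "\<lambda>x. bag_of (ord x)" nbags by (rule tree_order)
  have e: "s4 ''D'' 0 = D" "s4 ''num_bags'' 0 = nbags" "s4 ''order'' = ord" "s4 ''bag_start'' = s0 ''bag_start''"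
    "s4 ''bag'' = s0 ''bag''" "s4 ''rank'' = (\<lambda>_. 0)" "s4 ''nbr'' = (\<lambda>_. 0)" "s4 ''par'' = (\<lambda>_. 0)" "s4 ''r'' 0 = 0"
    using input_zero[of "''rank''"] input_zero[of "''nbr''"] input_zero[of "''par''"] input_zero[of "''r''"] powers2(1)
    by (simp_all add: frame4 frame3 frame2 frame1 input_arrays ord_def)
  have bs: "bag_set s4 (ord x) = bag_of (ord x)" if "x < nbags" for x
    using bag_set_cong[of s4 s0] bag_set_input[OF ord_less[OF that]] e by simp
  have "ranking_inv (s4 ''D'' 0) n (sem ranking s4) (\<Union>x < s4 ''num_bags'' 0. bag_set s4 (s4 ''order'' x))
      ((\<lambda>x. bag_set s4 (s4 ''order'' x)) ` {..<s4 ''num_bags'' 0})"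
  proof (rule ranking_spec, unfold e)
    show "s0 ''bag_start'' (Suc (ord x)) - s0 ''bag_start'' (ord x) \<le> D" if "x < nbags" for x
      using bag_size_input[OF ord_less[OF that]] bag_le_D[OF ord_less[OF that]] by simp
    show "bag_set s4 (ord x) \<subseteq> {..<n}" if "x < nbags" for x
      using bs[OF that] bag_V[OF ord_less[OF that]] by simp
    show "\<exists>y < x. \<forall>z < x. bag_set s4 (ord z) \<inter> bag_set s4 (ord x) \<subseteq> bag_set s4 (ord y)" if x: "x < nbags" "0 < x" for x
    proof -
      obtain y where y: "y < x" "(bag_of (ord y), bag_of (ord x)) \<in> parcs T" using earlier[OF x] by auto
      have "bag_of (ord z) \<inter> bag_of (ord x) \<subseteq> bag_of (ord y)" if z: "z < x" for z
      proof
        fix v assume v: "v \<in> bag_of (ord z) \<inter> bag_of (ord x)"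
        have xz: "bag_of (ord x) \<in> pverts T" "bag_of (ord z) \<in> pverts T" using f_verts x(1) z by simp_all
        then have "v < n" using v bags_Union by blast
        \<comment> \<open>The bags containing \<open>v\<close> are connected in the tree and include
          the node at \<open>x\<close> as well as the earlier one at \<open>z\<close>; hence the
          parent of \<open>x\<close> is among them.\<close>
        have "bag_of (ord y) \<in> {X \<in> pverts T. v \<in> X}"
          by (rule connected_earlier[OF _ vertex_connected[OF \<open>v < n\<close>] x(1) _ z _ y]) (use v xz in auto)
        then show "v \<in> bag_of (ord y)" by simp
      qed
      then show ?thesis using y(1) bs x(1) by (intro exI[of _ y]) auto
    qed
  qed (simp_all add: e)
  moreover have "(\<lambda>x. bag_set s4 (ord x)) ` {..<nbags} = (\<lambda>x. bag_of (ord x)) ` {..<nbags}"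
    using bs by (intro image_cong) auto
  moreover have "(\<lambda>x. bag_of (ord x)) ` {..<nbags} = pverts T" using bij by (simp add: bij_betw_def)
  moreover from this have "(\<Union>x<nbags. bag_of (ord x)) = {..<n}" using bags_Union by simp
  moreover have "(\<Union>x<nbags. bag_set s4 (ord x)) = (\<Union>x<nbags. bag_of (ord x))"
    using bs by (intro SUP_cong) auto
  ultimately show ?thesis unfolding e s5_def[symmetric] by simp
qed

text \<open>Every vertex lies in a bag and is therefore ranked; \<open>vert\<close> and
  \<open>rank\<close> are inverse up to the shift by 1, so the counter has reached
  \<open>n\<close>.\<close>

lemma ranked_count: "s5 ''r'' 0 = n"
proof -
  have rk: "ranked D n s5" and V: "\<And>u. s5 ''rank'' u \<noteq> 0 \<longleftrightarrow> u < n"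
    using ranking_facts by (auto simp: ranking_inv_def)
  have "bij_betw (s5 ''vert'') {..<s5 ''r'' 0} {..<n}"
    unfolding bij_betw_def
  proof (intro conjI equalityI subsetI)
    have r: "s5 ''rank'' (s5 ''vert'' i) = Suc i" if "i < s5 ''r'' 0" for i
      using rk that by (simp add: ranked_def)
    show "inj_on (s5 ''vert'') {..<s5 ''r'' 0}" by (rule inj_onI) (metis r lessThan_iff nat.inject)
    show "x \<in> {..<n}" if "x \<in> s5 ''vert'' ` {..<s5 ''r'' 0}" for x using that r V by fastforce
    show "x \<in> s5 ''vert'' ` {..<s5 ''r'' 0}" if "x \<in> {..<n}" for x
    proof -
      have "s5 ''rank'' x \<noteq> 0" using V that by simp
      then have "s5 ''rank'' x \<le> s5 ''r'' 0 \<and> s5 ''vert'' (s5 ''rank'' x - 1) = x"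
        using rk unfolding ranked_def by blast
      then show ?thesis using \<open>s5 ''rank'' x \<noteq> 0\<close>
        by (intro image_eqI[of _ _ "s5 ''rank'' x - 1"]) auto
    qed
  qed
  then show ?thesis using bij_betw_same_card by fastforce
qed

lemma arrays: "ranking_arrays n D (s5 ''rank'') (s5 ''col'') (s5 ''nbr'') (s5 ''par'') (s5 ''vert'') (parcs G)"
proof -
  let ?nb = "nb_set D (s5 ''nbr'')"
  have rk: "ranked D n s5" and V: "\<And>u. s5 ''rank'' u \<noteq> 0 \<longleftrightarrow> u < n"
    and prs: "\<And>X. X \<in> pverts T \<Longrightarrow> pairs D s5 X"
    and cov: "\<And>v. v < n \<Longrightarrow> \<exists>X \<in> pverts T. insert v (?nb v) \<subseteq> X"
    using ranking_facts by (auto simp: ranking_inv_def)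
  note r1 = rk[unfolded ranked_def, THEN conjunct1, rule_format]
    and r2 = rk[unfolded ranked_def, THEN conjunct2, THEN conjunct1, rule_format]
    and r3 = rk[unfolded ranked_def, THEN conjunct2, THEN conjunct2, THEN conjunct1, rule_format]
    and r4 = rk[unfolded ranked_def, THEN conjunct2, THEN conjunct2, THEN conjunct2, THEN conjunct1, rule_format]
    and r5 = rk[unfolded ranked_def, THEN conjunct2, THEN conjunct2, THEN conjunct2, THEN conjunct2, rule_format]
  have pr: "x \<in> ?nb y" if "X \<in> pverts T" "x \<in> X" "y \<in> X" "s5 ''rank'' x < s5 ''rank'' y" for X x y
  proof -
    have "x < n" using bags_Union that by auto
    then have "s5 ''rank'' x \<noteq> 0" using V by simp
    then show ?thesis using prs[OF that(1)] that unfolding pairs_def by blast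
  qed
  show ?thesis
  proof
    show "parcs G \<subseteq> {..<n} \<times> {..<n}" by (rule arcs_sub)
    show "0 < s5 ''rank'' v \<and> s5 ''rank'' v \<le> n \<and> s5 ''vert'' (s5 ''rank'' v - 1) = v" if "v < n" for v
      using V[of v] r1[of v] that ranked_count by auto
    show "s5 ''vert'' i < n \<and> s5 ''rank'' (s5 ''vert'' i) = Suc i" if "i < n" for i
      using r2[of i] V[of "s5 ''vert'' i"] that ranked_count by auto
    show "u < n \<and> s5 ''rank'' u < s5 ''rank'' v \<and> s5 ''col'' u = a"
      if "a < D" "s5 ''nbr'' (v * D + a) = Suc u" for a v u
      using r3[OF that] V[of u] by auto
    show "s5 ''col'' v < D \<and> s5 ''nbr'' (v * D + s5 ''col'' v) = 0" if "v < n" for v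
      using r4[of v] V[of v] that by auto
    show "?nb v = {} \<and> s5 ''par'' v = 0 \<or>
      (\<exists>p \<in> ?nb v. s5 ''par'' v = Suc p \<and> (\<forall>u \<in> ?nb v. s5 ''rank'' u \<le> s5 ''rank'' p))" for v
      by (rule r5)
    show "x \<in> ?nb y" if "(x, y) \<in> parcs G \<or> (y, x) \<in> parcs G" "s5 ''rank'' x < s5 ''rank'' y" for x y
      using that arc_in_bag[of x y] arc_in_bag[of y x] pr by blast
    \<comment> \<open>All of \<open>nb v\<close> lies in one bag, and vertices of a bag are
      paired.\<close>
    show "u \<in> ?nb w" if "v < n" "u \<in> ?nb v" "w \<in> ?nb v" "s5 ''rank'' u < s5 ''rank'' w" for v u w
      using cov[OF that(1)] pr that by blast
  qed
qed

sublocale ranking_arrays n D "s5 ''rank''" "s5 ''col''" "s5 ''nbr''" "s5 ''par''" "s5 ''vert''" "parcs G" VP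
  by (rule arrays)

lemma fixed5: "fixed s5"
  using powers2 by (simp add: fixed_def frame5 frame4 frame3 frame2 frame1 input_arrays)

lemma fixed6: "fixed s6"
  by (rule fixed_frame[OF fixed5], rule frame6) auto

lemma fixed7: "fixed s7"
  by (rule fixed_frame[OF fixed6], rule frame7) auto

lemma fixed8: "fixed s8"
  by (rule fixed_frame[OF fixed7], rule frame8) auto

lemma zero5: "x \<in> {''adj'', ''ran'', ''rel'', ''bad'', ''dec'', ''mec''} \<Longrightarrow> s5 x = (\<lambda>_. 0)"
  using input_zero[of x] by (auto simp: frame5 frame4 frame3 frame2 frame1)

theorem output_correct: "output_classes n s9 = mec_decomposition G VP"
proof -
  have e5: "s5 ''num_arcs'' 0 = length es" "s5 ''arc_tail'' = s0 ''arc_tail''" "s5 ''arc_head'' = s0 ''arc_head''"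
    "s5 ''is_random'' = s0 ''is_random''"
    by (simp_all add: frame5 frame4 frame3 frame2 frame1 input_arrays)
  have "(\<lambda>e. (s0 ''arc_tail'' e, s0 ''arc_head'' e)) ` {..<length es} = (\<lambda>e. es ! e) ` {..<length es}"
    by (intro image_cong) (auto simp: input_arrays)
  also have "\<dots> = set es" by (auto simp: set_conv_nth)
  also have "\<dots> = parcs G" using input by (simp add: lists_input_def)
  finally have arcs: "parcs G = (\<lambda>e. (s5 ''arc_tail'' e, s5 ''arc_head'' e)) ` {..<s5 ''num_arcs'' 0}"
    unfolding e5 by simp
  have rnd: "s5 ''is_random'' x \<noteq> 0 \<longleftrightarrow> x \<in> VP" if "x < n" for x
    unfolding e5 using that by (simp add: input_arrays)
  have z: "s5 ''adj'' = (\<lambda>_. 0)" "s5 ''ran'' = (\<lambda>_. 0)" by (simp_all add: zero5)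
  have "represents s7 base"
    unfolding s7_def
  proof (rule base_tables_spec[OF fixed6])
    show "s6 ''rel'' = (\<lambda>_. 0)" "s6 ''bad'' = (\<lambda>_. 0)" by (simp_all add: frame6 zero5)
    fix v a b assume ab: "a < D" "b < D"
    show "s6 ''adj'' ((v * D + a) * D + b) \<noteq> 0 \<longleftrightarrow> coloured (own_arcs v) a b"
      unfolding s6_def by (rule own_arcs_table_spec(1)[OF fixed5 z arcs _ ab]) (rule rnd)
    show "s6 ''ran'' ((v * D + a) * D + b) \<noteq> 0 \<longleftrightarrow> coloured {(x, y) \<in> own_arcs v. x \<in> VP} a b"
      unfolding s6_def by (rule own_arcs_table_spec(2)[OF fixed5 z arcs _ ab]) (rule rnd)
  qed
  then have "decided s8 v" if "v < n" for v
    unfolding s8_def using that by (intro pushing_spec[OF fixed7]) (simp_all add: frame7 frame6 zero5)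
  then have "s9 ''mec'' v = label v" if "v < n" for v
    unfolding s9_def using that by (intro labelling_spec[OF fixed8]) (simp_all add: frame8 frame7 frame6 zero5)
  then show ?thesis unfolding mec_decomposition_eq pverts by (rule output_classes_spec)
qed

end

section \<open>Running time\<close>

text \<open>The fixed costs 8 and 11 add up to 19, and \<open>cost e\<close> is charged once outside
  and once per pass. With \<open>N\<close> and \<open>Y\<close> positive all of it is absorbed by
  the monomial \<open>N * Y\<close>, so nested loops multiply their bounds and add their
  constants.\<close>

lemma static_time_For_le:
  assumes "static_time p s \<le> c * Y" "val e s \<le> N" "1 \<le> N" "1 \<le> Y"
  shows "static_time (PFor x e p) s \<le> (19 + 2 * cost e + c) * (N * Y)"
proof -
  have "val e s * (11 + cost e + static_time p s) \<le> N * ((11 + cost e) * Y + c * Y)"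
    using assms by (intro mult_le_mono add_mono) auto
  moreover have "(8 + cost e) * 1 \<le> (8 + cost e) * (N * Y)"
    using assms by (intro mult_le_mono2) simp
  ultimately show ?thesis by (simp add: algebra_simps)
qed

lemma ok_mec_prog: "ok mec_prog"
proof -
  have "ok max_bag" "ok powers" "ok adjacency" "ok traversal"
    by (simp_all add: prog_defs expr_defs slow_def)
  moreover have "ok ranking" by (simp add: prog_defs expr_defs slow_def)
  moreover have "ok own_arcs_table" "ok base_tables" by (simp_all add: prog_defs expr_defs slow_def)
  moreover have "ok pushing" by (simp add: prog_defs expr_defs slow_def)
  moreover have "ok labelling" by (simp add: prog_defs expr_defs slow_def)
  ultimately show ?thesis by (simp add: mec_prog_def main_part_def)
qed

lemma loop_reads_max_bag: "loop_reads max_bag \<inter> writes max_bag = {}"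
  by (simp add: prog_defs expr_defs)

lemma loop_reads_main_part: "loop_reads main_part \<inter> writes main_part = {}"
  by code_simp

context
  fixes s :: store and Y :: nat
  assumes D: "s ''D'' 0 \<le> Y" and Y: "1 \<le> Y"
begin

lemma squares: "s ''D'' 0 * s ''D'' 0 \<le> Y\<^sup>2" "s ''D'' 0 \<le> Y\<^sup>2" "1 \<le> Y\<^sup>2"
  using D Y mult_le_mono[of "s ''D'' 0" Y 1 Y] by (simp_all add: mult_le_mono power2_eq_square)

lemma static_time_rank_vertex: "static_time rank_vertex s \<le> 200 * Y"
proof -
  have "static_time scan_bag s \<le> 120 * Y"
    using D Y by (simp add: scan_bag_def)
  moreover have "static_time choose_colour s \<le> 60 * Y"
    using D Y by (simp add: choose_colour_def expr_defs)
  ultimately show ?thesis using Y by (simp add: rank_vertex_def)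
qed

lemma static_time_rank_bag: "static_time rank_bag s \<le> 400 * Y\<^sup>2"
proof -
  let ?body = "when (Var ''j'' [<] Var ''len'')
      (''v'' ::= Read ''bag'' (Var ''lo'' [+] Var ''j'') ;;
       when (Read ''rank'' (Var ''v'') [=] Const 0) rank_vertex)"
  have "static_time ?body s \<le> 250 * Y"
    using static_time_rank_vertex Y by simp
  then have "static_time (PFor ''j'' (Var ''D'') ?body) s \<le> (19 + 2 * cost (Var ''D'') + 250) * (Y * Y)"
    using D Y by - (rule static_time_For_le, simp_all del: static_time.simps)
  then have "static_time (PFor ''j'' (Var ''D'') ?body) s \<le> 300 * Y\<^sup>2"
    using squares(3) by (simp del: static_time.simps add: power2_eq_square)
  then show ?thesis
    unfolding rank_bag_def using squares(3) by (simp del: static_time.simps(5) one_le_power add: expr_defs)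
qed

lemma static_time_base_cell: "static_time base_cell s \<le> 400 * Y\<^sup>2"
  by (simp add: base_cell_def expr_defs algebra_simps) (use squares in linarith)

lemma static_time_push_mask: "static_time push_mask s \<le> 1000 * Y\<^sup>2"
proof -
  have "static_time push_rel s \<le> 400 * Y\<^sup>2"
    by (simp add: push_rel_def expr_defs algebra_simps) (use squares in linarith)
  moreover have "static_time decide s \<le> 500 * Y\<^sup>2"
    by (simp add: decide_def expr_defs algebra_simps) (use squares in linarith)
  ultimately show ?thesis
    by (simp add: push_mask_def expr_defs) (use squares in linarith)
qed

lemma static_time_label_vertex: "static_time label_vertex s \<le> 1000 * Y\<^sup>2"
  by (simp add: label_vertex_def label_mask_def expr_defs algebra_simps) (use squares in linarith)

end

lemma static_time_push_vertex:
  assumes "s ''D'' 0 \<le> Y" "1 \<le> Y" "s ''P'' 0 \<le> Q" "1 \<le> Q"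
  shows "static_time push_vertex s \<le> 1100 * (Q * Y\<^sup>2)"
proof -
  have "static_time (PFor ''m'' (Var ''P'') push_mask) s \<le> (19 + 2 * cost (Var ''P'') + 1000) * (Q * Y\<^sup>2)"
    using assms static_time_push_mask[of s Y] by - (rule static_time_For_le, simp_all del: static_time.simps)
  then have *: "static_time (PFor ''m'' (Var ''P'') push_mask) s \<le> 1023 * (Q * Y\<^sup>2)"
    by (simp del: static_time.simps)
  have "1 \<le> Q * Y\<^sup>2" using assms by simp
  with * show ?thesis
    unfolding push_vertex_def static_time.simps(2,3) expr_defs cost.simps by linarith
qed

text \<open>The seven passes are brought to the common monomial \<open>N * Q * Y\<^sup>2\<close>;
  their constants sum to 4300, rounded up generously. Taking upper bounds that are at least 1 avoids
  empty cases such as \<open>n = 0\<close>.\<close>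

lemma static_time_main_part:
  assumes D: "s ''D'' 0 \<le> Y" "1 \<le> Y" and P: "s ''P'' 0 \<le> Q" "1 \<le> Q"
    and N: "s ''n'' 0 \<le> N" "1 \<le> N" and bags: "s ''num_bags'' 0 \<le> N * Q"
    and links: "s ''num_links'' 0 \<le> 2 * (N * Q)" and arcs: "s ''num_arcs'' 0 \<le> N * (2 * Y)"
  shows "static_time main_part s \<le> 10000 * (N * Q * Y\<^sup>2)"
proof -
  let ?X = "N * Q * Y\<^sup>2"
  have Y2: "1 \<le> Y\<^sup>2" "Y \<le> Y\<^sup>2" using D by (simp_all add: power2_eq_square)
  have NQ: "1 \<le> N * Q" using N P by simp
  have "N * Q * 1 \<le> ?X" using Y2 by (intro mult_le_mono) auto
  then have NQX: "N * Q \<le> ?X" by simp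
  have "N * 1 * Y \<le> ?X" using Y2 P by (intro mult_le_mono) auto
  then have NYX: "N * Y \<le> ?X" by simp
  have X: "1 \<le> ?X" using NQ NQX by linarith
  have 1: "static_time adjacency s \<le> 100 * ?X"
    by (simp add: adjacency_def) (use links NQX X in linarith)
  have 2: "static_time traversal s \<le> 400 * ?X"
    by (simp add: traversal_def) (use links bags NQX X in linarith)
  have "static_time ranking s \<le> (19 + 2 * cost (Var ''num_bags'') + 400) * (N * Q * Y\<^sup>2)"
    unfolding ranking_def using D bags NQ Y2 static_time_rank_bag[of s Y]
    by - (rule static_time_For_le, simp_all del: static_time.simps)
  then have 3: "static_time ranking s \<le> 500 * ?X" by (simp del: static_time.simps)
  have 4: "static_time own_arcs_table s \<le> 400 * ?X"
    by (simp add: own_arcs_table_def expr_defs) (use arcs NYX X in linarith)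
  have "static_time (PFor ''m'' (Var ''P'') base_cell) s \<le> (19 + 2 * cost (Var ''P'') + 400) * (Q * Y\<^sup>2)"
    using P Y2 static_time_base_cell[of s Y] D by - (rule static_time_For_le, simp_all del: static_time.simps)
  then have "static_time base_tables s \<le>
      (19 + 2 * cost (Var ''n'') + (19 + 2 * cost (Var ''P'') + 400)) * (N * (Q * Y\<^sup>2))"
    unfolding base_tables_def using N P Y2 by - (rule static_time_For_le, simp_all del: static_time.simps)
  then have 5: "static_time base_tables s \<le> 600 * ?X" by (simp del: static_time.simps add: mult.assoc)
  have "static_time pushing s \<le> (19 + 2 * cost (Var ''n'') + 1100) * (N * (Q * Y\<^sup>2))"
    unfolding pushing_def using N P Y2 static_time_push_vertex[of s Y Q] D by - (rule static_time_For_le, simp_all del: static_time.simps)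
  then have 6: "static_time pushing s \<le> 1200 * ?X" by (simp del: static_time.simps add: mult.assoc)
  have "static_time labelling s \<le> (19 + 2 * cost (Var ''n'') + 1000) * (N * Y\<^sup>2)"
    unfolding labelling_def using N Y2 static_time_label_vertex[of s Y] D by - (rule static_time_For_le, simp_all del: static_time.simps)
  then have "static_time labelling s \<le> 1100 * (N * Y\<^sup>2)" by (simp del: static_time.simps)
  moreover have "N * 1 * Y\<^sup>2 \<le> ?X" using P by (intro mult_le_mono) auto
  ultimately have 7: "static_time labelling s \<le> 1100 * ?X" unfolding mult_1_right by linarith
  show ?thesis unfolding main_part_def static_time.simps(3) using 1 2 3 4 5 6 7 X by linarith
qed

section \<open>Sizes of the input lists\<close>

context decomposed_instance
begin

lemma card_nb: "v < n \<Longrightarrow> card (nb v) \<le> k"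
proof -
  assume v: "v < n"
  then obtain X where X: "X \<in> pverts T" "insert v (nb v) \<subseteq> X"
    using ranking_facts unfolding ranking_inv_def by blast
  have fin: "finite X" using X(1) bags_Union by (metis Union_upper finite_lessThan finite_subset)
  have "v \<notin> nb v" using nb_D by blast
  then have "Suc (card (nb v)) \<le> card X"
    using X(2) card_mono[OF fin X(2)] finite_subset[OF _ fin, of "nb v"] by simp
  then show ?thesis using card_bag[OF X(1)] by simp
qed

lemma nb_finite: "finite (nb v)"
  by (rule finite_subset[of _ "{..<n}"]) (use nb_D in auto)

lemma nbags_le: "nbags \<le> n * 2 ^ k + 1"
proof -
  have "pverts T \<subseteq> insert {} (\<Union>v<n. insert v ` Pow (nb v))"
  proof
    fix X assume X: "X \<in> pverts T"
    then have XV: "X \<subseteq> {..<n}" using bags_Union by blast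
    show "X \<in> insert {} (\<Union>v<n. insert v ` Pow (nb v))"
    proof (cases "X = {}")
      case False
      have fin: "finite X" using XV finite_subset by blast
      have "Max (s5 ''rank'' ` X) \<in> s5 ''rank'' ` X" using fin False by (intro Max_in) auto
      then obtain v where v: "v \<in> X" and m: "Max (s5 ''rank'' ` X) = s5 ''rank'' v" by auto
      have last: "s5 ''rank'' u \<le> s5 ''rank'' v" if "u \<in> X" for u
        unfolding m[symmetric] using fin that by (intro Max_ge) auto
      have "X - {v} \<subseteq> nb v"
      proof
        fix u assume u: "u \<in> X - {v}"
        then have "u < n" "v < n" using v XV by auto
        then have "s5 ''rank'' u \<noteq> s5 ''rank'' v" "s5 ''rank'' u \<noteq> 0"
          using rank_inj[of u v] rank[of u] u by auto
        moreover from this have "s5 ''rank'' u < s5 ''rank'' v" using last[of u] u by simp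
        moreover have "pairs D s5 X" using ranking_facts X by (simp add: ranking_inv_def)
        ultimately show "u \<in> nb v" using u v unfolding pairs_def by blast
      qed
      then have "X \<in> insert v ` Pow (nb v)" using v by (intro image_eqI[of _ _ "X - {v}"]) auto
      then show ?thesis using v XV by auto
    qed simp
  qed
  then have "card (pverts T) \<le> card (insert {} (\<Union>v<n. insert v ` Pow (nb v)))"
    by (rule card_mono[rotated]) (simp add: nb_finite)
  also have "\<dots> \<le> Suc (card (\<Union>v<n. insert v ` Pow (nb v)))"
    by (simp add: card_insert_if nb_finite)
  also have "card (\<Union>v<n. insert v ` Pow (nb v)) \<le> (\<Sum>v<n. card (insert v ` Pow (nb v)))"
    by (rule card_UN_le) simp
  also have "\<dots> \<le> (\<Sum>v<n. 2 ^ k)"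
  proof (rule sum_mono)
    fix v assume "v \<in> {..<n}"
    then have "card (Pow (nb v)) \<le> 2 ^ k" using card_nb by (simp add: card_Pow nb_finite)
    then show "card (insert v ` Pow (nb v)) \<le> 2 ^ k"
      using card_image_le[of "Pow (nb v)" "insert v"] nb_finite by (simp add: le_trans)
  qed
  finally have "card (pverts T) \<le> n * 2 ^ k + 1" by simp
  then show ?thesis using bij_betw_same_card[OF bags_bij] by simp
qed

text \<open>Charge each arc to its later end: a vertex pays for a possible loop and for at most
  \<open>k\<close> arcs in each direction.\<close>

lemma length_es: "length es \<le> n * (2 * k + 1)"
proof -
  have "parcs G \<subseteq> (\<Union>v<n. {v} \<times> insert v (nb v) \<union> nb v \<times> {v})"
  proof
    fix e assume "e \<in> parcs G"
    then obtain x y where e: "e = (x, y)" "(x, y) \<in> parcs G" by (metis surj_pair)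
    then have xy: "x < n" "y < n" using arcs_sub by auto
    then consider "x = y" | "s5 ''rank'' x < s5 ''rank'' y" | "s5 ''rank'' y < s5 ''rank'' x"
      using rank_inj[of x y] by linarith
    then show "e \<in> (\<Union>v<n. {v} \<times> insert v (nb v) \<union> nb v \<times> {v})"
      by cases (use e xy arc_nb[of x y] arc_nb[of y x] in auto)
  qed
  then have "card (parcs G) \<le> card (\<Union>v<n. {v} \<times> insert v (nb v) \<union> nb v \<times> {v})"
    by (rule card_mono[rotated]) (simp add: nb_finite)
  also have "\<dots> \<le> (\<Sum>v<n. card ({v} \<times> insert v (nb v) \<union> nb v \<times> {v}))"
    by (rule card_UN_le) simp
  also have "\<dots> \<le> (\<Sum>v<n. 2 * k + 1)"
  proof (rule sum_mono)
    fix v assume "v \<in> {..<n}"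
    then have "card (nb v) \<le> k" using card_nb by simp
    then have "card ({v} \<times> insert v (nb v)) + card (nb v \<times> {v}) \<le> 2 * k + 1"
      by (simp add: card_cartesian_product card_insert_if nb_finite)
    then show "card ({v} \<times> insert v (nb v) \<union> nb v \<times> {v}) \<le> 2 * k + 1"
      using card_Un_le le_trans by blast
  qed
  finally have "card (parcs G) \<le> n * (2 * k + 1)" by simp
  then show ?thesis using input distinct_card[of es] by (simp add: lists_input_def)
qed

text \<open>Bags with different indices are different sets, so the links are in bijection with the
  arcs of the tree.\<close>

lemma length_links: "length links \<le> 2 * nbags"
proof -
  have bounds: "i < nbags \<and> j < nbags" if "(i, j) \<in> set links" for i j
    using input that by (auto simp: lists_input_def)
  have "inj_on (\<lambda>(i, j). (bag_of i, bag_of j)) (set links)"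
    using bag_of_inj by (auto simp: inj_on_def dest: bounds)
  then have "card (set links) = card (parcs T)" using links_arcs card_image by metis
  then show ?thesis using tree_order.card_arcs[OF tree_order] input distinct_card[of links]
    by (simp add: lists_input_def)
qed

end

section \<open>Word size and the final bound\<close>

lemma array_le: "\<forall>y \<in> set xs. y \<le> M \<Longrightarrow> array xs i \<le> M"
  by (auto simp: array_def)

lemma length_concat_le: "\<forall>x \<in> set xs. length x \<le> c \<Longrightarrow> length (concat xs) \<le> length xs * c"
  by (induction xs) auto

text \<open>The constant factor is moved into the exponent by
  \<open>C \<le> 2 ^ C \<le> B ^ C\<close>, so that the word size is a pure power of
  \<open>B\<close>. The remaining unit of the exponent pays for adding the initial bound on the
  cells.\<close>

lemma word_bound:
  fixes B C t :: nat
  assumes B: "2 \<le> B" and t: "t \<le> C * B ^ 3"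
  shows "B\<^sup>2 + t \<le> B ^ (C + 4)"
proof -
  have "C \<le> 2 ^ C" using less_exp[of C] by simp
  also have "\<dots> \<le> B ^ C" using B by (rule power_mono) simp
  finally have "C * B ^ 3 \<le> B ^ C * B ^ 3" by (rule mult_le_mono1)
  then have "t \<le> B ^ (C + 3)" unfolding power_add using t by linarith
  moreover have "B\<^sup>2 \<le> B ^ (C + 3)" using B by (intro power_increasing) auto
  moreover have "2 * B ^ (C + 3) \<le> B * B ^ (C + 3)" using B by (rule mult_le_mono1)
  moreover have "B * B ^ (C + 3) = B ^ (C + 4)" by (simp add: numeral_eq_Suc)
  ultimately show ?thesis by linarith
qed

context decomposed_instance
begin

lemma Suc_k_le: "Suc k \<le> 2 ^ k"
  by (rule Suc_leI) (rule less_exp)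

lemma time_mec_prog: "time mec_prog s0 \<le> 90000 * (max 1 n * 2 ^ k * (max 1 k)\<^sup>2)"
proof -
  let ?N = "max 1 n" and ?K = "max 1 k"
  let ?X = "?N * 2 ^ k * ?K\<^sup>2"
  have "1 * 2 ^ k * 1 \<le> ?X" by (intro mult_le_mono) auto
  then have P: "2 ^ k \<le> ?X" by simp
  then have X: "1 \<le> ?X" using one_le_power[of "2::nat" k] by linarith
  have "?N * 2 ^ k * 1 \<le> ?X" by (rule mult_le_mono) auto
  moreover have "n * 2 ^ k + 1 * 2 ^ k \<le> ?N * 2 ^ k + ?N * 2 ^ k"
    by (intro add_mono mult_le_mono1) auto
  then have "n * 2 ^ k + 1 \<le> ?N * 2 ^ k + ?N * 2 ^ k" using one_le_power[of "2::nat" k] by linarith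
  then have nb: "nbags \<le> 2 * (?N * 2 ^ k)" using nbags_le by linarith
  ultimately have nbX: "nbags \<le> 2 * ?X" by linarith
  have P_le: "(2::nat) ^ D \<le> 2 * 2 ^ k" using power_increasing[OF D_le, of "2::nat"] by simp
  have "time max_bag s0 \<le> static_time max_bag s0" by (rule time_le_static_time[OF loop_reads_max_bag])
  also have "\<dots> = 10 + nbags * 38" by (simp add: max_bag_def expr_defs input_arrays)
  also have "\<dots> \<le> 100 * ?X" using nbX X by linarith
  finally have 1: "time max_bag s0 \<le> 100 * ?X" .
  have 2: "time powers s1 \<le> 200 * ?X" using time_powers[of s1] P_le P unfolding D_def by linarith
  have "time main_part s2 \<le> static_time main_part s2"
    by (rule time_le_static_time[OF loop_reads_main_part])
  \<comment> \<open>From \<open>D \<le> k + 1\<close> follow the factors 2 in the bounds for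
    \<open>P\<close> and \<open>D\<close>. The bound for \<open>D\<close> enters squared, hence the
    factor 8 that leads to 80000.\<close>
  also have "\<dots> \<le> 10000 * (?N * (2 * 2 ^ k) * (2 * ?K)\<^sup>2)"
  proof (rule static_time_main_part)
    have e: "s2 ''n'' 0 = n" "s2 ''num_bags'' 0 = nbags" "s2 ''num_links'' 0 = length links"
      "s2 ''num_arcs'' 0 = length es"
      by (simp_all add: frame2 frame1 input_arrays)
    show "s2 ''D'' 0 \<le> 2 * ?K" using D_le powers2(1) by simp
    show "s2 ''P'' 0 \<le> 2 * 2 ^ k" using P_le powers2(2) by simp
    show "s2 ''n'' 0 \<le> ?N" using e by simp
    show "s2 ''num_bags'' 0 \<le> ?N * (2 * 2 ^ k)" using e nb by simp
    show "s2 ''num_links'' 0 \<le> 2 * (?N * (2 * 2 ^ k))" using e nb length_links by simp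
    have "n * (2 * k + 1) \<le> ?N * (2 * (2 * ?K))" by (rule mult_le_mono) auto
    then show "s2 ''num_arcs'' 0 \<le> ?N * (2 * (2 * ?K))" using e length_es by linarith
  qed simp_all
  also have "\<dots> = 80000 * ?X" by (simp add: power2_eq_square)
  finally have 3: "time main_part s2 \<le> 80000 * ?X" .
  have "time mec_prog s0 = 2 + time max_bag s0 + time powers s1 + time main_part s2"
    by (simp add: mec_prog_def s1_def s2_def)
  then show ?thesis using 1 2 3 X by linarith
qed

lemma sem_mec_prog: "sem mec_prog s0 = s9"
  by (simp add: mec_prog_def main_part_def s1_def s2_def s3_def s4_def s5_def s6_def s7_def s8_def s9_def)

text \<open>The number of bags, \<open>k + 1\<close> and \<open>n\<close> are each at most
  \<open>(n + 2) * 2 ^ k\<close>. The square is needed for quantities that are products of two of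
  these, such as the total length of the bags.\<close>

lemma cells_input: "cells_le (((n + 2) * 2 ^ k)\<^sup>2) s0"
proof -
  define B where "B = (n + 2) * 2 ^ k"
  let ?M = "B\<^sup>2"
  have B: "2 * 2 ^ k \<le> B" unfolding B_def by (rule mult_le_mono1) simp
  have "(n + 2) * 1 \<le> B" unfolding B_def by (rule mult_le_mono2) simp
  then have nB: "n + 2 \<le> B" by simp
  have MB: "b * c \<le> ?M" if "b \<le> B" "c \<le> B" for b c
    using mult_le_mono[OF that] by (simp add: power2_eq_square)
  have k: "2 * k + 2 \<le> B" using le_trans[OF mult_le_mono2[OF Suc_k_le] B] by simp
  have "(n + 2) * 1 \<le> ?M" using nB by (intro MB) linarith+
  then have nM: "n + 2 \<le> ?M" by simp
  have "n * 2 ^ k + 1 * 1 \<le> n * 2 ^ k + 2 * 2 ^ k" by (intro add_mono mult_le_mono) auto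
  also have "\<dots> = B" by (simp add: B_def algebra_simps)
  finally have nb: "nbags \<le> B" using nbags_le by linarith
  have nbM: "2 * nbags \<le> ?M" using nb nB by (intro MB) linarith+
  have "n * (2 * k + 1) \<le> ?M" using nB k by (intro MB) linarith+
  then have es: "length es \<le> ?M" using length_es by linarith
  have links: "length links \<le> ?M" using length_links nbM by linarith
  have start: "length (concat (take i bags)) \<le> ?M" for i
  proof -
    have "\<forall>b \<in> set (take i bags). length b \<le> Suc k"
      using length_bag by (metis in_set_conv_nth in_set_takeD)
    then have "length (concat (take i bags)) \<le> length (take i bags) * Suc k" by (rule length_concat_le)
    also have "\<dots> \<le> ?M" using nb k by (intro MB) auto
    finally show ?thesis .
  qed
  have bag: "u \<le> ?M" if "b \<in> set bags" "u \<in> set b" for u b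
  proof -
    have "set b \<in> pverts T" using input that(1) unfolding lists_input_def by (metis image_eqI set_map)
    then have "u < n" using bags_Union that(2) by blast
    then show ?thesis using nM by linarith
  qed
  have arc: "u \<le> ?M \<and> v \<le> ?M" if "(u, v) \<in> set es" for u v
  proof -
    have "u < n \<and> v < n" using that input arcs_sub by (auto simp: lists_input_def)
    then show ?thesis using nM by linarith
  qed
  have link: "i \<le> ?M \<and> j \<le> ?M" if "(i, j) \<in> set links" for i j
  proof -
    have "i < nbags \<and> j < nbags" using that input by (auto simp: lists_input_def)
    then show ?thesis using nbM by linarith
  qed
  have small: "n \<le> ?M" "(1::nat) \<le> ?M" "nbags \<le> ?M" using nM nbM by linarith+
  have all: "input_store n VP es bags links x i \<le> ?M" for x i
  proof -
    have "array [n] i \<le> ?M" "array [length es] i \<le> ?M" "array [nbags] i \<le> ?M" "array [length links] i \<le> ?M"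
      using small es links by (intro array_le; simp)+
    moreover have "array (map (\<lambda>v. if v \<in> VP then 1 else 0) [0..<n]) i \<le> ?M"
      using small by (intro array_le) auto
    moreover have "array (map fst es) i \<le> ?M" "array (map snd es) i \<le> ?M"
      using arc by (intro array_le; force)+
    moreover have "array (map (\<lambda>i. length (concat (take i bags))) [0..<nbags + 1]) i \<le> ?M"
      using start by (intro array_le) (simp del: upt_Suc)
    moreover have "array (concat bags) i \<le> ?M" using bag by (intro array_le) auto
    moreover have "array (map fst links) i \<le> ?M" "array (map snd links) i \<le> ?M"
      using link by (intro array_le; force)+
    ultimately show ?thesis unfolding input_store_def fun_upd_apply by (simp split: if_split)
  qed
  show ?thesis unfolding cells_le_def s0_def B_def[symmetric] using all by blast
qed

text \<open>The constant is hidden behind a variable to keep powers with such an exponent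
  symbolic.\<close>

lemma exec_mec_prog:
  assumes "C = 90000"
  shows "exec (((n + 2) * 2 ^ k) ^ ((C + 4) * max_cost mec_prog)) (compile mec_prog) s0 (time mec_prog s0) s9"
proof -
  let ?B = "(n + 2) * 2 ^ k"
  let ?K = "max 1 k"
  have "2 * 1 \<le> ?B" "1 * 2 ^ k \<le> ?B" by (rule mult_le_mono; simp)+
  then have B: "2 \<le> ?B" "2 ^ k \<le> ?B" by linarith+
  have K: "?K \<le> ?B" using Suc_k_le B by linarith
  have "max 1 n * 2 ^ k * ?K\<^sup>2 \<le> ?B * ?B\<^sup>2"
    using K by (intro mult_le_mono power_mono) auto
  also have "\<dots> = ?B ^ 3" by (simp only: power2_eq_square power3_eq_cube mult.assoc)
  finally have "C * (max 1 n * 2 ^ k * ?K\<^sup>2) \<le> C * ?B ^ 3" by (rule mult_le_mono2)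
  then have "time mec_prog s0 \<le> C * ?B ^ 3" using time_mec_prog unfolding assms by linarith
  from word_bound[OF B(1) this]
  have "exec ((?B ^ (C + 4)) ^ max_cost mec_prog) (compile mec_prog) s0 (time mec_prog s0) (sem mec_prog s0)"
    using exec_compile[OF ok_mec_prog order_refl cells_input _, of "?B ^ (C + 4)"] B(1)
    by (metis one_le_numeral order_trans power2_nat_le_imp_le self_le_power zero_less_numeral)
  then show ?thesis by (simp only: power_mult sem_mec_prog)
qed

end

theorem theorem3:
  shows "\<exists>(algorithm :: com) (C :: real) (d :: nat).
    \<forall>(n :: nat) (k :: nat) (G :: nat pair_pre_digraph) (V1 :: nat set) (VP :: nat set)
      (\<delta> :: nat \<Rightarrow> nat pmf) (T :: nat set pair_pre_digraph) es bags links.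
      mdp G V1 VP \<delta> \<and> pverts G = {..<n} \<and>
      tree_decomposition (mk_symmetric (with_proj G)) T \<and> width T = k \<and>
      lists_input G T es bags links \<longrightarrow>
      (\<exists>t s. exec (((n + 2) * 2 ^ k) ^ d) algorithm (input_store n VP es bags links) t s \<and>
        real t \<le> C * (real (max 1 n) * 2 ^ k * real (max 1 k) powr 2.38) \<and>
        output_classes n s = mec_decomposition G VP)"
proof -
  define c :: nat where "c = 90000"
  let ?d = "(c + 4) * max_cost mec_prog"
  have main: "\<exists>t s. exec (((n + 2) * 2 ^ k) ^ ?d) (compile mec_prog) (input_store n VP es bags links) t s \<and>
        real t \<le> 90000 * (real (max 1 n) * 2 ^ k * real (max 1 k) powr 2.38) \<and>
        output_classes n s = mec_decomposition G VP"
    if prem: "mdp G V1 VP \<delta> \<and> pverts G = {..<n} \<and> tree_decomposition (mk_symmetric (with_proj G)) T \<and>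
      width T = k \<and> lists_input G T es bags links"
    for n k G V1 VP \<delta> T es bags links
  proof -
    interpret decomposed_instance n k G VP T es bags links
      using prem by (simp add: decomposed_instance_def mdp_def)
    have "real (time mec_prog s0) \<le> real (90000 * (max 1 n * 2 ^ k * (max 1 k)\<^sup>2))"
      using time_mec_prog by (simp only: of_nat_le_iff)
    also have "\<dots> = 90000 * (real (max 1 n) * 2 ^ k * real (max 1 k) ^ 2)" by simp
    also have "real (max 1 k) ^ 2 = real (max 1 k) powr 2" by (simp add: powr_realpow)
    \<comment> \<open>Raising the exponent from 2 to 2.38 is monotone because the base
      \<open>max 1 k\<close> is at least 1.\<close>
    also have "90000 * (real (max 1 n) * 2 ^ k * real (max 1 k) powr 2) \<le>
        90000 * (real (max 1 n) * 2 ^ k * real (max 1 k) powr 2.38)"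
      by (intro mult_left_mono powr_mono) auto
    finally show ?thesis using exec_mec_prog[OF c_def] output_correct unfolding s0_def by blast
  qed
  show ?thesis
    by (rule exI[of _ "compile mec_prog"], rule exI[of _ 90000], rule exI[of _ ?d], intro allI impI, erule main)
qed

end
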